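(* Let $\{(x^r,y^r,z^r,V_r)\}_{r\ge 0}$ be an infinite sequence generated by Algorithm 1 (described in the context) applied to the problem of minimizing $f(x)-\mu\log\det F(x)$ over $x\in\mathbb{R}^n$ subject to $g(x,\tau)\le 0$ for all $\tau\in T$, $F(x)\in S^m_{++}$ and $Gx=h$. Suppose that the following assumptions hold. Assumption A: (1) for every $r\ge 0$ the scaling matrix $P_r$ is the HRVW/KSH/M matrix or the NT matrix; (2) the sequence of penalty parameters $\{\rho_r\}$ is bounded; (3) the sequence $\{x^r\}$ is bounded; (4) $Gx^0=h$. Assumption B: there are constants $\eta_2>\eta_1>0$ such that $\eta_2 I\succeq B_r\succeq \eta_1 I$ for all $r\ge 0$. Then the sequence $\{(x^r,y^r,z^r,V_r)\}$ is bounded in $\mathbb{R}^n\times\mathcal{M}(T)\times\mathbb{R}^s\times S^m$ (with the total variation norm on $\mathcal{M}(T)$). Furthermore, any weak* accumulation point $(x^*,y^*,z^*,V_* )$ of $\{(x^r,y^r,z^r,V_r)\}$ (weak* topology on the $\mathcal{M}(T)$-component, as dual of $\mathcal{C}(T)$, and the usual topology on the other components) is a KKT point of the problem, that is, $$\nabla f(x^* )+\int_T\nabla_xg(x^*,\tau)\,dy^*(\tau)-(F_i\bullet V_* )_{i=1}^n+G^{\top}z^*=0,$$ $$F(x^* )\circ V_*=\mu I,\quad F(x^* )\in S^m_{++},\quad V_*\in S^m_{++},$$ $$\int_Tg(x^*,\tau)\,dy^*(\tau)=0,\quad g(x^*,\tau)\le 0\ (\tau\in T),\quad y^*\in\mathcal{M}_+(T),\qquad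 Gx^*=h.$$
   Context: Notation. $S^m$, $S^m_{+}$, $S^m_{++}$: real symmetric, symmetric positive semidefinite, symmetric positive definite $m\times m$ matrices. For $X,Y\in S^m$: $X\circ Y=(XY+YX)/2$, $X\bullet Y=\mathrm{Tr}(XY)$, $\mathcal{L}_X:S^m\to S^m$, $\mathcal{L}_X(Z)=X\circ Z$. $(\zeta)_+=\max(\zeta,0)$. $\mathcal{C}(T)$ is the space of continuous real functions on $T$ with sup norm, $\mathcal{M}(T)$ its dual, i.e. finite signed regular Borel measures on $T$ with $\|y\|=\sup_A y(A)-\inf_A y(A)$ (over Borel sets $A$); $\mathcal{M}_+(T)$ the nonnegative ones. "Finitely supported" $y\in\mathcal{M}_+(T)$ means a finite nonnegative combination of Dirac measures, and $\mathrm{supp}(y)=\{\tau: y(\{\tau\})\ne0\}$. Problem data (standing). $T$ is a compact metric space, $\mu>0$, $f:\mathbb{R}^n\to\mathbb{R}$ is continuously differentiable, $g:\mathbb{R}^n\times T\to\mathbb{R}$ is continuous with $g(\cdot,\tau)$ convex and continuously differentiable for each $\tau\in T$, $F(x)=F_0+\sum_{i=1}^n x_iF_i$ with $F_i\in S^m$, $G\in\mathbb{R}^{s\times n}$, $h\in\mathbb{R}^s$. A Slater point exists: some $\bar x$ with $F(\bar x)\in S^m_{++}$, $g(\bar x,\tau)<0$ for all $\tau\in T$, $G\bar x=h$. Auxiliary functions. $\xi(x)=(F_i\bullet F(x)^{-1})_{i=1}^n$; $\psi(x,V)=F(x)\bullet V-\mu\log\det(F(x)V)$; $\chi_\rho(x)=f(x)-\mu\log\det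 F(x)+\rho\max_{\tau\in T}(g(x,\tau))_++\rho\|Gx-h\|_1$; $\Phi_\rho(x,V)=\chi_\rho(x)+\nu\psi(x,V)$ (for $F(x),V\in S^m_{++}$). $\psi'(x,V;\Delta x,\Delta V)$ is the directional derivative of $\psi$ at $(x,V)$ along $(\Delta x,\Delta V)$. Scaling. For nonsingular $P\in\mathbb{R}^{m\times m}$: $\tilde F(x)=PF(x)P^\top$, $\tilde F_i=PF_iP^\top$, $\tilde V=P^{-\top}VP^{-1}$. The HRVW/KSH/M matrix at $(x,V)$ is $P=F(x)^{-1/2}$; the NT matrix is $P=W^{-1/2}$ with $W=F(x)^{1/2}(F(x)^{1/2}VF(x)^{1/2})^{-1/2}F(x)^{1/2}$. Algorithm 1. Choose $x^0$ with $F(x^0)\in S^m_{++}$, $V_0\in S^m_{++}$, $z^0\in\mathbb{R}^s$, finitely supported $y^0\in\mathcal{M}_+(T)$, and parameters $\alpha,\beta_1,\beta_2,\sigma\in(0,1)$, $\delta,\nu,\rho_0,\gamma_0>0$. For $r=0,1,2,\dots$ (stopping if $(x^r,y^r,z^r,V_r)$ is a KKT point): (a) choose a nonsingular $P_r\in\mathbb{R}^{m\times m}$ and a positive definite $B_r\in S^n$; (b) find $\Delta x^r\in\mathbb{R}^n$, finitely supported $y^{r+1}\in\mathcal{M}_+(T)$ and $z^{r+1}\in\mathbb{R}^s$ with $\nabla f(x^r)+B_r\Delta x^r-\mu\xi(x^r)+\int_T\nabla_xg(x^r,\tau)dy^{r+1}(\tau)+G^\top z^{r+1}=0$; $g(x^r,\tau)+\nabla_xg(x^r,\tau)^\top\Delta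 x^r\le0$ for $\tau\in\mathrm{supp}(y^{r+1})$; $\int_T(g(x^r,\tau)+\nabla_xg(x^r,\tau)^\top\Delta x^r)dy^{r+1}(\tau)=0$; $G(x^r+\Delta x^r)=h$; $\max_{\tau\in T}(g(x^r,\tau)+\nabla_xg(x^r,\tau)^\top\Delta x^r)_+\le\gamma_r$; and set, with scaling by $P=P_r$ and $V=V_r$, $\Delta V_r=\mu F(x^r)^{-1}-V_r-\sum_{i=1}^n\Delta x^r_i P_r^\top\mathcal{L}_{\tilde F(x^r)}^{-1}\mathcal{L}_{\tilde V_r}\tilde F_iP_r$; (c) if $\rho_r>\max(\|y^{r+1}\|,\|z^{r+1}\|_\infty)$ set $\rho_{r+1}=\rho_r$, otherwise $\rho_{r+1}=\delta+\max(\|y^{r+1}\|,\|z^{r+1}\|_\infty)$; (d) let $\bar s=\min(s_x,s_V,1)$, where $s_x=-\sigma/\lambda$ if $\lambda:=\lambda_{\min}(F(x^r)^{-1}\sum_i\Delta x_i^rF_i)<0$ and $s_x=1$ otherwise, and $s_V=-\sigma/\lambda'$ if $\lambda':=\lambda_{\min}(V_r^{-1}\Delta V_r)<0$ and $s_V=1$ otherwise; let $s_r=\bar s\beta_1^\ell$ with the smallest integer $\ell\ge0$ such that $\Phi_{\rho_{r+1}}(x^r+s_r\Delta x^r,V_r+s_r\Delta V_r)\le\Phi_{\rho_{r+1}}(x^r,V_r)-\alpha s_r\left((\Delta x^r)^\top B_r\Delta x^r-\nu\psi'(x^r,V_r;\Delta x^r,\Delta V_r)\right)+\rho_{r+1}s_r\gamma_r$;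 (e) set $x^{r+1}=x^r+s_r\Delta x^r$, $V_{r+1}=V_r+s_r\Delta V_r$, $\gamma_{r+1}=\beta_2\gamma_r$. All iterates satisfy $F(x^r)\in S^m_{++}$, $V_r\in S^m_{++}$. *)

theory Defs
  imports "HOL-Analysis.Analysis"
begin

definition sym_mats :: "(real^'m^'m) set" where
  "sym_mats = {A. transpose A = A}"

definition psd_mats :: "(real^'m^'m) set" where
  "psd_mats = {A \<in> sym_mats. \<forall>v. 0 \<le> v \<bullet> (A *v v)}"

definition pd_mats :: "(real^'m^'m) set" where
  "pd_mats = {A \<in> sym_mats. \<forall>v. v \<noteq> 0 \<longrightarrow> 0 < v \<bullet> (A *v v)}"

definition jordan_prod :: "real^'m^'m \<Rightarrow> real^'m^'m \<Rightarrow> real^'m^'m" where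
  "jordan_prod X Y = (1/2) *\<^sub>R (X ** Y + Y ** X)"

definition mat_inner :: "real^'m^'m \<Rightarrow> real^'m^'m \<Rightarrow> real" where
  "mat_inner X Y = trace (X ** Y)"

text \<open>Inverse of the operator \<open>Z \<mapsto> X \<circ> Z\<close> on the space of symmetric matrices
  (used for positive definite \<open>X\<close>, where this operator is a bijection of that space).\<close>

definition jordan_prod_inv :: "real^'m^'m \<Rightarrow> real^'m^'m \<Rightarrow> real^'m^'m" where
  "jordan_prod_inv X = inv_into sym_mats (jordan_prod X)"

definition mat_sqrt :: "real^'m^'m \<Rightarrow> real^'m^'m" where
  "mat_sqrt A = (THE R. R \<in> psd_mats \<and> R ** R = A)"

text \<open>Smallest real eigenvalue. It is applied below to products of a positive definite
  and a symmetric matrix, all of whose eigenvalues are real.\<close>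

definition lambda_min :: "real^'m^'m \<Rightarrow> real" where
  "lambda_min A = Min {c. \<exists>v. v \<noteq> 0 \<and> A *v v = c *\<^sub>R v}"

definition grad :: "('a::real_inner \<Rightarrow> real) \<Rightarrow> 'a \<Rightarrow> 'a" where
  "grad f x = (THE D. GDERIV f x :> D)"

definition continuously_differentiable :: "('a::real_inner \<Rightarrow> real) \<Rightarrow> bool" where
  "continuously_differentiable f \<longleftrightarrow>
     (\<forall>x. f differentiable (at x)) \<and> continuous_on UNIV (grad f)"

definition dir_deriv :: "('a::real_vector \<Rightarrow> real) \<Rightarrow> 'a \<Rightarrow> 'a \<Rightarrow> real" where
  "dir_deriv \<phi> p d = Lim (at_right 0) (\<lambda>t. (\<phi> (p + t *\<^sub>R d) - \<phi> p) / t)"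

definition borel_subsets :: "'t::metric_space set \<Rightarrow> 't set set" where
  "borel_subsets T = sets (restrict_space borel T)"

text \<open>A signed measure is represented by its real-valued set function, put equal to \<open>0\<close>
  outside the Borel subsets of \<open>T\<close>, so that equal measures are equal functions.\<close>

definition signed_measures :: "'t::metric_space set \<Rightarrow> ('t set \<Rightarrow> real) set" where
  "signed_measures T = {y.
     (\<forall>A. A \<notin> borel_subsets T \<longrightarrow> y A = 0) \<and>
     y {} = 0 \<and>
     (\<forall>A :: nat \<Rightarrow> 't set. range A \<subseteq> borel_subsets T \<longrightarrow> disjoint_family A \<longrightarrow>
        (\<lambda>i. y (A i)) sums y (\<Union>i. A i)) \<and>
     (\<forall>A \<in> borel_subsets T. \<forall>\<epsilon>>0. \<exists>K U. compact K \<and> openin (top_of_set T) U \<and>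
        K \<subseteq> A \<and> A \<subseteq> U \<and> (\<forall>B \<in> borel_subsets T. B \<subseteq> U - K \<longrightarrow> \<bar>y B\<bar> < \<epsilon>))}"

definition nonneg_measures :: "'t::metric_space set \<Rightarrow> ('t set \<Rightarrow> real) set" where
  "nonneg_measures T = {y \<in> signed_measures T. \<forall>A \<in> borel_subsets T. 0 \<le> y A}"

definition tv_norm :: "'t::metric_space set \<Rightarrow> ('t set \<Rightarrow> real) \<Rightarrow> real" where
  "tv_norm T y = (SUP A\<in>borel_subsets T. y A) - (INF A\<in>borel_subsets T. y A)"

text \<open>The Jordan decomposition \<open>y = y\<^sup>+ - y\<^sup>-\<close>, where
  \<open>y\<^sup>+ A = sup {y B | B \<subseteq> A}\<close> and \<open>y\<^sup>- = (- y)\<^sup>+\<close>.\<close>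

definition pos_part :: "'t::metric_space set \<Rightarrow> ('t set \<Rightarrow> real) \<Rightarrow> 't measure" where
  "pos_part T y = measure_of T (borel_subsets T)
     (\<lambda>A. ennreal (SUP B\<in>{B \<in> borel_subsets T. B \<subseteq> A}. y B))"

definition neg_part :: "'t::metric_space set \<Rightarrow> ('t set \<Rightarrow> real) \<Rightarrow> 't measure" where
  "neg_part T y = pos_part T (\<lambda>A. - y A)"

definition signed_integral ::
  "'t::metric_space set \<Rightarrow> ('t set \<Rightarrow> real) \<Rightarrow> ('t \<Rightarrow> 'b::{banach, second_countable_topology}) \<Rightarrow> 'b"
where
  "signed_integral T y \<phi> = integral\<^sup>L (pos_part T y) \<phi> - integral\<^sup>L (neg_part T y) \<phi>"

definition dirac :: "'t::metric_space set \<Rightarrow> 't \<Rightarrow> 't set \<Rightarrow> real" where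
  "dirac T \<tau> A = (if A \<in> borel_subsets T \<and> \<tau> \<in> A then 1 else 0)"

definition finitely_supported :: "'t::metric_space set \<Rightarrow> ('t set \<Rightarrow> real) \<Rightarrow> bool" where
  "finitely_supported T y \<longleftrightarrow>
     (\<exists>S c. finite S \<and> S \<subseteq> T \<and> (\<forall>\<tau>\<in>S. 0 \<le> c \<tau>) \<and> y = (\<lambda>A. \<Sum>\<tau>\<in>S. c \<tau> * dirac T \<tau> A))"

definition supp :: "'t::metric_space set \<Rightarrow> ('t set \<Rightarrow> real) \<Rightarrow> 't set" where
  "supp T y = {\<tau> \<in> T. y {\<tau>} \<noteq> 0}"

definition weak_star_topology :: "'t::metric_space set \<Rightarrow> ('t set \<Rightarrow> real) topology" where
  "weak_star_topology T = topology_generated_by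
     {{y \<in> signed_measures T. signed_integral T y \<phi> \<in> U} | (\<phi> :: 't \<Rightarrow> real) U.
        continuous_on T \<phi> \<and> open U}"

definition accumulation_point :: "'a topology \<Rightarrow> (nat \<Rightarrow> 'a) \<Rightarrow> 'a \<Rightarrow> bool" where
  "accumulation_point X u p \<longleftrightarrow>
     p \<in> topspace X \<and> (\<forall>U. openin X U \<and> p \<in> U \<longrightarrow> (\<exists>\<^sub>F r in sequentially. u r \<in> U))"

definition iterate_topology ::
  "'t::metric_space set \<Rightarrow> ((real^'n) \<times> ('t set \<Rightarrow> real) \<times> (real^'s) \<times> (real^'m^'m)) topology" where
  "iterate_topology T =
     prod_topology euclidean
       (prod_topology (weak_star_topology T) (prod_topology euclidean (top_of_set sym_mats)))"

definition lin_part :: "('n \<Rightarrow> real^'m^'m) \<Rightarrow> real^'n \<Rightarrow> real^'m^'m" where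
  "lin_part F d = (\<Sum>i\<in>UNIV. (d $ i) *\<^sub>R F i)"

definition pencil :: "real^'m^'m \<Rightarrow> ('n \<Rightarrow> real^'m^'m) \<Rightarrow> real^'n \<Rightarrow> real^'m^'m" where
  "pencil F0 F x = F0 + lin_part F x"

definition problem_data ::
  "'t::metric_space set \<Rightarrow> real \<Rightarrow> (real^'n \<Rightarrow> real) \<Rightarrow> (real^'n \<Rightarrow> 't \<Rightarrow> real) \<Rightarrow>
   real^'m^'m \<Rightarrow> ('n \<Rightarrow> real^'m^'m) \<Rightarrow> real^'n^'s \<Rightarrow> real^'s \<Rightarrow> bool"
where
  "problem_data T \<mu> f g F0 F G h \<longleftrightarrow>
     compact T \<and> T \<noteq> {} \<and> 0 < \<mu> \<and>
     continuously_differentiable f \<and>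
     continuous_on (UNIV \<times> T) (\<lambda>(x, \<tau>). g x \<tau>) \<and>
     (\<forall>\<tau>\<in>T. convex_on UNIV (\<lambda>x. g x \<tau>) \<and> continuously_differentiable (\<lambda>x. g x \<tau>)) \<and>
     F0 \<in> sym_mats \<and> (\<forall>i. F i \<in> sym_mats) \<and>
     (\<exists>x. pencil F0 F x \<in> pd_mats \<and> (\<forall>\<tau>\<in>T. g x \<tau> < 0) \<and> G *v x = h)"

definition kkt_point ::
  "'t::metric_space set \<Rightarrow> real \<Rightarrow> (real^'n \<Rightarrow> real) \<Rightarrow> (real^'n \<Rightarrow> 't \<Rightarrow> real) \<Rightarrow>
   real^'m^'m \<Rightarrow> ('n \<Rightarrow> real^'m^'m) \<Rightarrow> real^'n^'s \<Rightarrow> real^'s \<Rightarrow>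
   real^'n \<Rightarrow> ('t set \<Rightarrow> real) \<Rightarrow> real^'s \<Rightarrow> real^'m^'m \<Rightarrow> bool"
where
  "kkt_point T \<mu> f g F0 F G h x y z V \<longleftrightarrow>
     grad f x + signed_integral T y (\<lambda>\<tau>. grad (\<lambda>u. g u \<tau>) x)
       - (\<chi> i. mat_inner (F i) V) + transpose G *v z = 0 \<and>
     jordan_prod (pencil F0 F x) V = \<mu> *\<^sub>R mat 1 \<and>
     pencil F0 F x \<in> pd_mats \<and> V \<in> pd_mats \<and>
     signed_integral T y (\<lambda>\<tau>. g x \<tau>) = 0 \<and> (\<forall>\<tau>\<in>T. g x \<tau> \<le> 0) \<and>
     y \<in> nonneg_measures T \<and> G *v x = h"

definition xi :: "real^'m^'m \<Rightarrow> ('n \<Rightarrow> real^'m^'m) \<Rightarrow> real^'n \<Rightarrow> real^'n" where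
  "xi F0 F x = (\<chi> i. mat_inner (F i) (matrix_inv (pencil F0 F x)))"

definition psi ::
  "real \<Rightarrow> real^'m^'m \<Rightarrow> ('n \<Rightarrow> real^'m^'m) \<Rightarrow> (real^'n) \<times> (real^'m^'m) \<Rightarrow> real" where
  "psi \<mu> F0 F = (\<lambda>(x, V).
     mat_inner (pencil F0 F x) V - \<mu> * ln (det (pencil F0 F x ** V)))"

definition max_pos_part :: "'t set \<Rightarrow> ('t \<Rightarrow> real) \<Rightarrow> real" where
  "max_pos_part T \<phi> = (SUP \<tau>\<in>T. max (\<phi> \<tau>) 0)"

definition chi ::
  "'t::metric_space set \<Rightarrow> real \<Rightarrow> (real^'n \<Rightarrow> real) \<Rightarrow> (real^'n \<Rightarrow> 't \<Rightarrow> real) \<Rightarrow>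
   real^'m^'m \<Rightarrow> ('n \<Rightarrow> real^'m^'m) \<Rightarrow> real^'n^'s \<Rightarrow> real^'s \<Rightarrow> real \<Rightarrow> real^'n \<Rightarrow> real"
where
  "chi T \<mu> f g F0 F G h \<rho> x =
     f x - \<mu> * ln (det (pencil F0 F x)) + \<rho> * max_pos_part T (g x)
       + \<rho> * (\<Sum>j\<in>UNIV. \<bar>(G *v x - h) $ j\<bar>)"

definition merit ::
  "'t::metric_space set \<Rightarrow> real \<Rightarrow> (real^'n \<Rightarrow> real) \<Rightarrow> (real^'n \<Rightarrow> 't \<Rightarrow> real) \<Rightarrow>
   real^'m^'m \<Rightarrow> ('n \<Rightarrow> real^'m^'m) \<Rightarrow> real^'n^'s \<Rightarrow> real^'s \<Rightarrow> real \<Rightarrow> real \<Rightarrow>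
   real^'n \<Rightarrow> real^'m^'m \<Rightarrow> real"
where
  "merit T \<mu> f g F0 F G h \<nu> \<rho> x V = chi T \<mu> f g F0 F G h \<rho> x + \<nu> * psi \<mu> F0 F (x, V)"

definition scale_primal :: "real^'m^'m \<Rightarrow> real^'m^'m \<Rightarrow> real^'m^'m" where
  "scale_primal P A = P ** A ** transpose P"

definition scale_dual :: "real^'m^'m \<Rightarrow> real^'m^'m \<Rightarrow> real^'m^'m" where
  "scale_dual P V = transpose (matrix_inv P) ** V ** matrix_inv P"

definition hrvw_matrix :: "real^'m^'m \<Rightarrow> real^'m^'m" where
  "hrvw_matrix X = matrix_inv (mat_sqrt X)"

definition nt_matrix :: "real^'m^'m \<Rightarrow> real^'m^'m \<Rightarrow> real^'m^'m" where
  "nt_matrix X V =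
     (let R = mat_sqrt X; W = R ** matrix_inv (mat_sqrt (R ** V ** R)) ** R
      in matrix_inv (mat_sqrt W))"

definition newton_V ::
  "real \<Rightarrow> real^'m^'m \<Rightarrow> ('n \<Rightarrow> real^'m^'m) \<Rightarrow> real^'m^'m \<Rightarrow>
   real^'n \<Rightarrow> real^'m^'m \<Rightarrow> real^'n \<Rightarrow> real^'m^'m"
where
  "newton_V \<mu> F0 F P x V d =
     \<mu> *\<^sub>R matrix_inv (pencil F0 F x) - V
       - (\<Sum>i\<in>UNIV. (d $ i) *\<^sub>R
            (transpose P **
             jordan_prod_inv (scale_primal P (pencil F0 F x))
               (jordan_prod (scale_dual P V) (scale_primal P (F i))) ** P))"

definition step_solution ::
  "'t::metric_space set \<Rightarrow> real \<Rightarrow> (real^'n \<Rightarrow> real) \<Rightarrow> (real^'n \<Rightarrow> 't \<Rightarrow> real) \<Rightarrow>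
   real^'m^'m \<Rightarrow> ('n \<Rightarrow> real^'m^'m) \<Rightarrow> real^'n^'s \<Rightarrow> real^'s \<Rightarrow> real^'n^'n \<Rightarrow> real \<Rightarrow>
   real^'n \<Rightarrow> real^'n \<Rightarrow> ('t set \<Rightarrow> real) \<Rightarrow> real^'s \<Rightarrow> bool"
where
  "step_solution T \<mu> f g F0 F G h B \<gamma> x d y z \<longleftrightarrow>
     (let glin = (\<lambda>\<tau>. g x \<tau> + grad (\<lambda>u. g u \<tau>) x \<bullet> d) in
      finitely_supported T y \<and>
      grad f x + B *v d - \<mu> *\<^sub>R xi F0 F x
        + signed_integral T y (\<lambda>\<tau>. grad (\<lambda>u. g u \<tau>) x) + transpose G *v z = 0 \<and>
      (\<forall>\<tau>\<in>supp T y. glin \<tau> \<le> 0) \<and>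
      signed_integral T y glin = 0 \<and>
      G *v (x + d) = h \<and>
      max_pos_part T glin \<le> \<gamma>)"

definition step_bound :: "real \<Rightarrow> real^'m^'m \<Rightarrow> real^'m^'m \<Rightarrow> real" where
  "step_bound \<sigma> X D =
     (let l = lambda_min (matrix_inv X ** D) in if l < 0 then - \<sigma> / l else 1)"

definition sufficient_decrease ::
  "'t::metric_space set \<Rightarrow> real \<Rightarrow> (real^'n \<Rightarrow> real) \<Rightarrow> (real^'n \<Rightarrow> 't \<Rightarrow> real) \<Rightarrow>
   real^'m^'m \<Rightarrow> ('n \<Rightarrow> real^'m^'m) \<Rightarrow> real^'n^'s \<Rightarrow> real^'s \<Rightarrow> real \<Rightarrow> real \<Rightarrow>
   real \<Rightarrow> real \<Rightarrow> real^'n^'n \<Rightarrow> real^'n \<Rightarrow> real^'m^'m \<Rightarrow> real^'n \<Rightarrow> real^'m^'m \<Rightarrow> real \<Rightarrow> bool"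
where
  "sufficient_decrease T \<mu> f g F0 F G h \<alpha> \<nu> \<rho> \<gamma> B x V d D t \<longleftrightarrow>
     merit T \<mu> f g F0 F G h \<nu> \<rho> (x + t *\<^sub>R d) (V + t *\<^sub>R D)
     \<le> merit T \<mu> f g F0 F G h \<nu> \<rho> x V
        - \<alpha> * t * (d \<bullet> (B *v d) - \<nu> * dir_deriv (psi \<mu> F0 F) (x, V) (d, D))
        + \<rho> * t * \<gamma>"

text \<open>An infinite run: the stopping test fails at every iteration.  Besides the iterates, the run
  records the choices \<open>P r\<close>, \<open>B r\<close>, the directions \<open>dx r\<close>, \<open>dV r\<close>, the penalty and
  tolerance parameters \<open>\<rho> r\<close>, \<open>\<gamma> r\<close> and the step lengths \<open>s r\<close>.\<close>

definition algorithm_run ::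
  "'t::metric_space set \<Rightarrow> real \<Rightarrow> (real^'n \<Rightarrow> real) \<Rightarrow> (real^'n \<Rightarrow> 't \<Rightarrow> real) \<Rightarrow>
   real^'m^'m \<Rightarrow> ('n \<Rightarrow> real^'m^'m) \<Rightarrow> real^'n^'s \<Rightarrow> real^'s \<Rightarrow>
   real \<Rightarrow> real \<Rightarrow> real \<Rightarrow> real \<Rightarrow> real \<Rightarrow> real \<Rightarrow>
   (nat \<Rightarrow> real^'n) \<Rightarrow> (nat \<Rightarrow> 't set \<Rightarrow> real) \<Rightarrow> (nat \<Rightarrow> real^'s) \<Rightarrow> (nat \<Rightarrow> real^'m^'m) \<Rightarrow>
   (nat \<Rightarrow> real^'m^'m) \<Rightarrow> (nat \<Rightarrow> real^'n^'n) \<Rightarrow> (nat \<Rightarrow> real^'n) \<Rightarrow> (nat \<Rightarrow> real^'m^'m) \<Rightarrow>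
   (nat \<Rightarrow> real) \<Rightarrow> (nat \<Rightarrow> real) \<Rightarrow> (nat \<Rightarrow> real) \<Rightarrow> bool"
where
  "algorithm_run T \<mu> f g F0 F G h \<alpha> \<beta>1 \<beta>2 \<sigma> \<delta> \<nu> x y z V P B dx dV \<rho> \<gamma> s \<longleftrightarrow>
     \<alpha> \<in> {0<..<1} \<and> \<beta>1 \<in> {0<..<1} \<and> \<beta>2 \<in> {0<..<1} \<and> \<sigma> \<in> {0<..<1} \<and>
     0 < \<delta> \<and> 0 < \<nu> \<and> 0 < \<rho> 0 \<and> 0 < \<gamma> 0 \<and>
     pencil F0 F (x 0) \<in> pd_mats \<and> V 0 \<in> pd_mats \<and> finitely_supported T (y 0) \<and>
     (\<forall>r.
        \<not> kkt_point T \<mu> f g F0 F G h (x r) (y r) (z r) (V r) \<and>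
        invertible (P r) \<and> B r \<in> pd_mats \<and>
        step_solution T \<mu> f g F0 F G h (B r) (\<gamma> r) (x r) (dx r) (y (Suc r)) (z (Suc r)) \<and>
        dV r = newton_V \<mu> F0 F (P r) (x r) (V r) (dx r) \<and>
        (let b = max (tv_norm T (y (Suc r))) (infnorm (z (Suc r)))
         in \<rho> (Suc r) = (if \<rho> r > b then \<rho> r else \<delta> + b)) \<and>
        (let sbar = min (min (step_bound \<sigma> (pencil F0 F (x r)) (lin_part F (dx r)))
                             (step_bound \<sigma> (V r) (dV r))) 1;
             ok = (\<lambda>l::nat. sufficient_decrease T \<mu> f g F0 F G h \<alpha> \<nu> (\<rho> (Suc r)) (\<gamma> r) (B r)
                              (x r) (V r) (dx r) (dV r) (sbar * \<beta>1 ^ l))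
         in \<exists>l. ok l \<and> (\<forall>k<l. \<not> ok k) \<and> s r = sbar * \<beta>1 ^ l) \<and>
        x (Suc r) = x r + s r *\<^sub>R dx r \<and>
        V (Suc r) = V r + s r *\<^sub>R dV r \<and>
        \<gamma> (Suc r) = \<beta>2 * \<gamma> r)"

end

theory Submission
  imports Defs
begin

text \<open>
  The penalty parameter grows by at least \<open>\<delta>\<close> whenever it changes, so a bounded penalty parameter is
  eventually constant; being larger than both multiplier norms, it bounds \<open>y\<close> and \<open>z\<close>.  From then on a single
  merit function \<open>\<Phi>\<close> decreases up to the summable errors \<open>\<rho> s\<^sub>r \<gamma>\<^sub>r\<close>, hence stays bounded above.
  On a bounded set of points each of its summands \<open>f\<close>, \<open>- \<mu> log det F\<close>, the penalty and \<open>\<psi>\<close> is bounded below, so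
  each of them is also bounded above.  An upper bound on \<open>- log det F(x\<^sub>r)\<close> keeps the matrices \<open>F(x\<^sub>r)\<close> uniformly
  positive definite, and the bound on \<open>\<psi>\<close> does the same for \<open>V\<^sub>r\<close> and bounds it (\<open>primal_dual_bounds\<close>).

  For both scalings the slope of \<open>\<psi>\<close> along the Newton direction equals
  \<open>- \<Sum>\<^sub>i (\<lambda>\<^sub>i - \<mu>)\<^sup>2 / \<lambda>\<^sub>i\<close>, where \<open>\<lambda>\<^sub>i\<close> are the eigenvalues of \<open>F(x) V\<close> (\<open>psi_slope_newton\<close>,
  \<open>centrality_gap\<close>).  The predicted decrease \<open>Q\<^sub>r = dx\<^sub>r \<bullet> B\<^sub>r dx\<^sub>r + \<nu> gap\<^sub>r\<close> is therefore nonnegative, and it vanishes only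
  on the central path.  All first-order expansions of the merit function hold with
  an error that is uniform along the run, so for every \<open>\<epsilon> > 0\<close> the Armijo test accepts every sufficiently short step
  as soon as \<open>Q\<^sub>r \<ge> \<epsilon>\<close> (\<open>armijo_uniform\<close>).  Thus \<open>Q\<^sub>r \<ge> \<epsilon>\<close> forces a step length bounded away from zero, and
  since \<open>\<Sum>\<^sub>r s\<^sub>r Q\<^sub>r\<close> is finite, \<open>Q\<^sub>r\<close> tends to zero (\<open>Q_tendsto\<close>).

  Consequently \<open>dx\<^sub>r\<close> tends to zero and \<open>F(x\<^sub>r) V\<^sub>r\<close> tends to \<open>\<mu> I\<close>.  The system solved in iteration \<open>r\<close> says that the
  stationarity residual at \<open>x\<^sub>r\<close> with the new multipliers is \<open>- B\<^sub>r dx\<^sub>r\<close>; because \<open>x\<^sub>r\<^sub>+\<^sub>1 - x\<^sub>r\<close> vanishes, the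
  residual may be evaluated at \<open>x\<^sub>r\<^sub>+\<^sub>1\<close> instead, and every KKT condition passes to the limit
  (\<open>accumulation_point_kkt\<close>).  Three facts make the limits legitimate: the gradient of \<open>g\<close> in its first argument is jointly
  continuous, by convexity (\<open>continuous_on_grad_parametric\<close>); \<open>log det\<close> satisfies a gradient inequality in both
  directions, which replaces second derivatives (\<open>ln_det_gradient_ineq\<close>); and a regular signed measure that is nonnegative
  on nonnegative continuous functions is a nonnegative measure (\<open>nonneg_of_positive_functional\<close>).
\<close>

section \<open>The spectral theorem for real symmetric matrices\<close>

lemma sym_mats_inner: "A \<in> sym_mats \<Longrightarrow> (A *v u) \<bullet> w = u \<bullet> (A *v w)"
  by (metis (mono_tags, lifting) dot_lmul_matrix mem_Collect_eq sym_mats_def transpose_matrix_vector)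

lemma transpose_add: "transpose (A + B) = transpose A + transpose B"
  by (simp add: transpose_def vec_eq_iff)
lemma transpose_diff: "transpose (A - B) = transpose A - transpose (B::real^'a^'b)"
  by (simp add: transpose_def vec_eq_iff)

lemma sym_mats_subspace: "subspace sym_mats"
  by (auto simp: subspace_def sym_mats_def transpose_add transpose_scalar transpose_def vec_eq_iff)

lemma pd_matsD: "A \<in> pd_mats \<Longrightarrow> A \<in> sym_mats" "A \<in> pd_mats \<Longrightarrow> v \<noteq> 0 \<Longrightarrow> 0 < v \<bullet> (A *v v)"
  by (auto simp: pd_mats_def)

text \<open>
  The quadratic polynomial \<open>t \<mapsto> (v + t w) \<bullet> N (v + t w)\<close> is nonnegative and
  vanishes at \<open>t = 0\<close>, so its linear coefficient is zero.
\<close>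

lemma psd_null:
  fixes N :: "real^'m^'m"
  assumes S: "subspace S" and N: "N \<in> sym_mats" and pos: "\<And>w. w \<in> S \<Longrightarrow> 0 \<le> w \<bullet> (N *v w)"
    and v: "v \<in> S" and z: "v \<bullet> (N *v v) = 0" and w: "w \<in> S"
  shows "w \<bullet> (N *v v) = 0"
proof (rule ccontr)
  let ?b = "w \<bullet> (N *v v)" and ?a = "w \<bullet> (N *v w)"
  assume nz: "?b \<noteq> 0"
  have q: "0 \<le> 2 * t * ?b + t\<^sup>2 * ?a" for t
  proof -
    have "v + t *\<^sub>R w \<in> S" using S v w by (simp add: subspace_add subspace_scale)
    from pos[OF this] show ?thesis
      using z sym_mats_inner[OF N, of v w] by (simp add: inner_add_left inner_add_right inner_commute
          matrix_vector_right_distrib matrix_vector_mult_scaleR power2_eq_square algebra_simps)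
  qed
  have a: "0 \<le> ?a" using pos w by blast
  \<comment> \<open>The step \<open>- b / (a + 1)\<close> makes the polynomial negative; adding one avoids division by zero.\<close>
  define k where "k = ?a + 1"
  have k: "k > 0" using a by (simp add: k_def)
  have "0 \<le> 2 * (- ?b / k) * ?b + (- ?b / k)\<^sup>2 * ?a" by (rule q)
  also have "\<dots> = ?b\<^sup>2 / k\<^sup>2 * (?a - 2 * k)"
    using k by (simp add: field_simps power2_eq_square)
  also have "\<dots> < 0" using a nz k by (intro mult_pos_neg) (auto simp: k_def)
  finally show False by simp
qed

text \<open>
  A maximizer of the Rayleigh quotient on the unit sphere of \<open>S\<close> is an eigenvector: if
  \<open>c\<close> is the maximum, then \<open>c I - A\<close> is positive semidefinite on \<open>S\<close>
  and its form vanishes at the maximizer.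
\<close>

lemma eigenvector_exists:
  fixes A :: "real^'m^'m"
  assumes S: "subspace S" and A: "A \<in> sym_mats" and inv: "\<And>v. v \<in> S \<Longrightarrow> A *v v \<in> S" and nz: "S \<noteq> {0}"
  obtains v c where "v \<in> S" "norm v = 1" "A *v v = c *\<^sub>R v"
proof -
  let ?C = "S \<inter> sphere 0 1"
  have "compact ?C" using S by (simp add: closed_Int_compact closed_subspace)
  moreover obtain u where "u \<in> S" "u \<noteq> 0" using nz S subspace_0 by blast
  then have "u /\<^sub>R norm u \<in> ?C" using S by (simp add: subspace_scale)
  then have "?C \<noteq> {}" by blast
  moreover have "continuous_on ?C (\<lambda>v. v \<bullet> (A *v v))"
    by (intro continuous_intros linear_continuous_on) (simp add: linear_linear[symmetric])
  ultimately obtain v where v: "v \<in> ?C" and max: "\<And>w. w \<in> ?C \<Longrightarrow> w \<bullet> (A *v w) \<le> v \<bullet> (A *v v)"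
    using continuous_attains_sup[of ?C "\<lambda>v. v \<bullet> (A *v v)"] by blast
  define c where "c = v \<bullet> (A *v v)"
  define N where "N = c *\<^sub>R mat 1 - A"
  have Nv: "N *v w = c *\<^sub>R w - A *v w" for w
    by (simp add: N_def matrix_vector_mult_diff_rdistrib scaleR_matrix_vector_assoc[symmetric])
  have N: "N \<in> sym_mats"
    using A by (simp add: N_def sym_mats_def transpose_diff transpose_scalar)
  have pos: "0 \<le> w \<bullet> (N *v w)" if w: "w \<in> S" for w
  proof (cases "w = 0")
    case False
    have "w /\<^sub>R norm w \<in> ?C" using S w False by (simp add: subspace_scale)
    from max[OF this] have "(w \<bullet> (A *v w)) / (norm w)\<^sup>2 \<le> c"
      by (simp add: c_def matrix_vector_mult_scaleR power2_eq_square divide_inverse mult_ac)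
    then show ?thesis using False
      by (simp add: Nv inner_diff_right field_simps power2_norm_eq_inner)
  qed (simp)
  have "v \<bullet> (N *v v) = 0" using v by (simp add: Nv inner_diff_right c_def norm_eq_1)
  then have "w \<bullet> (N *v v) = 0" if "w \<in> S" for w
    using psd_null[OF S N pos _ _ that, of v] v by auto
  moreover have "N *v v \<in> S" using inv v S by (simp add: Nv subspace_diff subspace_scale)
  ultimately have "N *v v = 0" by fastforce
  then have "A *v v = c *\<^sub>R v" by (simp add: Nv)
  then show thesis using that v by auto
qed

text \<open>
  Induction on the dimension of an invariant subspace: split off one eigenvector and continue in its
  orthogonal complement, which is again invariant because \<open>A\<close> is symmetric.
\<close>

lemma orthonormal_eigenbasis:
  fixes A :: "real^'m^'m"
  assumes A: "A \<in> sym_mats"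
  shows "subspace S \<Longrightarrow> (\<And>v. v \<in> S \<Longrightarrow> A *v v \<in> S) \<Longrightarrow>
    \<exists>B\<subseteq>S. pairwise orthogonal B \<and> (\<forall>v\<in>B. norm v = 1 \<and> (\<exists>c. A *v v = c *\<^sub>R v)) \<and> S \<subseteq> span B"
proof (induction "dim S" arbitrary: S rule: less_induct)
  case less
  show ?case
  proof (cases "S = {0}")
    case True
    then show ?thesis by (intro exI[of _ "{}"]) auto
  next
    case False
    obtain v c where v: "v \<in> S" "norm v = 1" "A *v v = c *\<^sub>R v"
      using eigenvector_exists[OF less.prems(1) A less.prems(2) False] by blast
    define S' where "S' = {w \<in> S. v \<bullet> w = 0}"
    have sub: "subspace S'" using less.prems(1) unfolding S'_def subspace_def
      by (auto simp: inner_add_right)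
    have inv: "A *v w \<in> S'" if "w \<in> S'" for w
      using that less.prems(2) sym_mats_inner[OF A, of v w] v(3) unfolding S'_def by auto
    have "v \<notin> S'" using v by (auto simp: S'_def norm_eq_1)
    then have "S' \<subset> S" using v(1) unfolding S'_def by blast
    then have "dim S' < dim S" using sub less.prems(1)
      by (metis dim_psubset psubsetE span_eq_iff psubsetI)
    from less.hyps[OF this sub inv] obtain B where B: "B \<subseteq> S'" "pairwise orthogonal B"
      "\<forall>v\<in>B. norm v = 1 \<and> (\<exists>c. A *v v = c *\<^sub>R v)" "S' \<subseteq> span B" by blast
    have "S \<subseteq> span (insert v B)"
    proof
      fix w assume w: "w \<in> S"
      have "w - (v \<bullet> w) *\<^sub>R v \<in> S'" using w v less.prems(1)
        by (simp add: S'_def subspace_diff subspace_scale inner_diff_right norm_eq_1)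
      then show "w \<in> span (insert v B)" using B(4) by (auto simp: span_insert)
    qed
    moreover have "pairwise orthogonal (insert v B)"
      using B(1,2) by (auto simp: pairwise_insert S'_def orthogonal_def inner_commute)
    ultimately show ?thesis using B v
      by (intro exI[of _ "insert v B"]) (auto simp: S'_def)
  qed
qed

text \<open>
  For orthogonal \<open>Q\<close> this is the functional calculus of the symmetric matrices whose
  eigenvectors are the columns of \<open>Q\<close>.
\<close>

definition diag_conj :: "real^'m^'m \<Rightarrow> ('m \<Rightarrow> real) \<Rightarrow> real^'m^'m" where
  "diag_conj Q d = Q ** (\<chi> i j. if i = j then d i else 0) ** transpose Q"

lemma spectral_decomposition:
  fixes A :: "real^'m^'m"
  assumes A: "A \<in> sym_mats"
  obtains Q d where "orthogonal_matrix Q" "A = diag_conj Q d"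
proof -
  obtain B :: "(real^'m) set" where B: "pairwise orthogonal B" 
      "\<forall>v\<in>B. norm v = 1 \<and> (\<exists>c. A *v v = c *\<^sub>R v)" "UNIV \<subseteq> span B"
    using orthonormal_eigenbasis[OF A subspace_UNIV] by blast
  have "independent B" using B by (intro pairwise_orthogonal_independent) auto
  then have "card B = CARD('m)" "finite B" using B(3)
    by (simp_all add: basis_card_eq_dim[of B UNIV, simplified] independent_bound)
  then obtain b where b: "bij_betw b (UNIV::'m set) B"
    using finite_same_card_bij[of "UNIV::'m set" B] by auto
  then have bB: "b i \<in> B" for i by (auto simp: bij_betw_def)
  have "\<exists>c. A *v b i = c *\<^sub>R b i" for i using B(2) bB by blast
  then obtain d where d: "A *v b i = d i *\<^sub>R b i" for i by metis
  have bb: "b i \<bullet> b j = (if i = j then 1 else 0)" for i j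
  proof (cases "i = j")
    case True then show ?thesis using B(2) bB[of j] by (simp add: norm_eq_1)
  next
    case False
    then have "b i \<noteq> b j" using b by (auto simp: bij_betw_def inj_on_def)
    then show ?thesis using B(1) bB False by (auto simp: pairwise_def orthogonal_def)
  qed
  define Q where "Q = (\<chi> i j. b j $ i)"
  let ?D = "(\<chi> i j. if i = j then d i else 0) :: real^'m^'m"
  have Q: "transpose Q ** Q = mat 1"
    using bb by (simp add: vec_eq_iff Q_def matrix_matrix_mult_def transpose_def mat_def inner_vec_def)
  then have oQ: "orthogonal_matrix Q" by (simp add: orthogonal_matrix)
  have "A ** Q = Q ** ?D"
  proof -
    have "(A ** Q) $ i $ j = (A *v b j) $ i" for i j
      by (simp add: matrix_matrix_mult_def matrix_vector_mult_def Q_def)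
    moreover have "(Q ** ?D) $ i $ j = d j * b j $ i" for i j
      by (simp add: matrix_matrix_mult_def Q_def mult_delta_left mult_delta_right)
    ultimately show ?thesis using d by (simp add: vec_eq_iff)
  qed
  then have "A ** (Q ** transpose Q) = diag_conj Q d" by (simp add: diag_conj_def matrix_mul_assoc)
  then have "A = diag_conj Q d" using oQ by (simp add: orthogonal_matrix_def)
  with oQ show thesis by (rule that)
qed

lemma diag_conj_mult: "orthogonal_matrix Q \<Longrightarrow> diag_conj Q d ** diag_conj Q e = diag_conj Q (\<lambda>i. d i * e i)"
proof -
  assume Q: "orthogonal_matrix Q"
  let ?D = "\<lambda>d. (\<chi> i j. if i = j then d i else 0) :: real^'a^'a"
  have "diag_conj Q d ** diag_conj Q e = Q ** ?D d ** (transpose Q ** Q) ** ?D e ** transpose Q"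
    by (simp add: diag_conj_def matrix_mul_assoc)
  also have "\<dots> = Q ** (?D d ** ?D e) ** transpose Q"
    using Q by (simp add: orthogonal_matrix_def matrix_mul_assoc)
  also have "?D d ** ?D e = ?D (\<lambda>i. d i * e i)"
    by (simp add: vec_eq_iff matrix_matrix_mult_def mult_delta_left mult_delta_right)
  finally show ?thesis by (simp add: diag_conj_def)
qed

lemma diag_conj_const: "orthogonal_matrix Q \<Longrightarrow> diag_conj Q (\<lambda>_. c) = c *\<^sub>R mat 1"
proof -
  assume Q: "orthogonal_matrix Q"
  have "Q ** (\<chi> i j. if i = j then c else 0) = c *\<^sub>R Q"
    by (simp add: vec_eq_iff matrix_matrix_mult_def mult_delta_left mult_delta_right)
  then show ?thesis using Q 
    by (simp add: diag_conj_def orthogonal_matrix_def scalar_matrix_assoc[symmetric] )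
qed

lemma diag_conj_eigen: "orthogonal_matrix Q \<Longrightarrow> diag_conj Q d *v column i Q = d i *\<^sub>R column i Q"
proof -
  assume Q: "orthogonal_matrix Q"
  have "transpose Q *v column i Q = axis i 1"
    using Q by (auto simp: orthogonal_matrix vec_eq_iff matrix_matrix_mult_def transpose_def mat_def
      matrix_vector_mult_def axis_def column_def simp del: transpose_matrix_vector)
  moreover have "(\<chi> i j. if i = j then d i else 0) *v axis i (1::real) = d i *\<^sub>R axis i 1"
    by (simp add: vec_eq_iff matrix_vector_mult_def axis_def mult_delta_left mult_delta_right)
  moreover have "Q *v axis i 1 = column i Q" by (simp add: matrix_vector_mult_basis)
  ultimately show ?thesis
    by (simp add: diag_conj_def matrix_vector_mul_assoc[symmetric] matrix_vector_mult_scaleR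
        del: transpose_matrix_vector)
qed

section \<open>Positive definite matrices, square roots and centrality\<close>

lemma matrix_diff_ldistrib: "A ** (B - C) = A ** B - A ** (C::real^'a^'b)"
  by (vector matrix_matrix_mult_def sum_subtractf[symmetric] right_diff_distrib)
lemma matrix_add_rdistrib: "(B + C) ** A = B ** A + (C::real^'a^'b) ** A"
  by (vector matrix_matrix_mult_def sum.distrib[symmetric] distrib_right)
lemma matrix_diff_rdistrib: "(B - C) ** A = B ** A - (C::real^'a^'b) ** A"
  by (vector matrix_matrix_mult_def sum_subtractf[symmetric] left_diff_distrib)
lemma matrix_scaleR_left: "(k *\<^sub>R A) ** B = k *\<^sub>R (A ** (B::real^'a^'b))"
  by (simp add: scalar_matrix_assoc)
lemma matrix_scaleR_right: "A ** (k *\<^sub>R B) = k *\<^sub>R (A ** (B::real^'a^'b))"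
  by (simp add: matrix_scalar_ac scalar_matrix_assoc)
lemma trace_scaleR: "trace (k *\<^sub>R A) = k * trace (A::real^'a^'a)"
  by (simp add: trace_def sum_distrib_left)

lemmas matrix_distribs = matrix_add_ldistrib matrix_add_rdistrib matrix_diff_ldistrib matrix_diff_rdistrib
  matrix_scaleR_left matrix_scaleR_right

lemma transpose_conj_sym: "A \<in> sym_mats \<Longrightarrow> transpose M ** A ** M \<in> sym_mats"
  by (simp add: sym_mats_def matrix_transpose_mul matrix_mul_assoc)

lemma matrix_inv_unique:
  fixes A B :: "real^'m^'m"
  assumes AB: "A ** B = mat 1"
  shows "matrix_inv A = B"
proof -
  have BA: "B ** A = mat 1" using AB matrix_left_right_inverse by blast
  have "A ** matrix_inv A = mat 1 \<and> matrix_inv A ** A = mat 1"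
    unfolding matrix_inv_def by (rule someI[of _ B]) (use AB BA in blast)
  then have "B ** (A ** matrix_inv A) = B" by simp
  then show ?thesis by (simp add: matrix_mul_assoc BA)
qed

lemma matrix_inv_mult:
  fixes A :: "real^'m^'m"
  assumes "invertible A"
  shows "A ** matrix_inv A = mat 1" "matrix_inv A ** A = mat 1"
proof -
  obtain B where B: "A ** B = mat 1" using assms by (auto simp: invertible_def)
  then show "A ** matrix_inv A = mat 1" "matrix_inv A ** A = mat 1"
    using matrix_inv_unique[OF B] matrix_left_right_inverse by auto
qed

lemma pd_invertible: 
  fixes A :: "real^'m^'m"
  assumes "A \<in> pd_mats" shows "invertible A"
proof -
  have "v = 0" if "A *v v = 0" for v using pd_matsD(2)[OF assms, of v] that by force
  then show ?thesis by (simp add: invertible_left_inverse matrix_left_invertible_ker)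
qed

lemmas pd_inv = matrix_inv_mult[OF pd_invertible]

lemma sym_matrix_inv: 
  fixes A :: "real^'m^'m"
  assumes "A \<in> sym_mats" "invertible A"
  shows "matrix_inv A \<in> sym_mats"
proof -
  have "A ** transpose (matrix_inv A) = transpose (matrix_inv A ** A)"
    using assms(1) by (simp add: matrix_transpose_mul sym_mats_def)
  then have "A ** transpose (matrix_inv A) = mat 1" by (simp add: matrix_inv_mult assms)
  from matrix_inv_unique[OF this] show ?thesis by (simp add: sym_mats_def)
qed

lemma pd_congruence:
  fixes A M :: "real^'m^'m"
  assumes A: "A \<in> pd_mats" and M: "invertible M"
  shows "transpose M ** A ** M \<in> pd_mats"
proof -
  have "0 < v \<bullet> ((transpose M ** A ** M) *v v)" if "v \<noteq> 0" for v
  proof -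
    have "M *v v \<noteq> 0" using M that
      by (metis inj_matrix_vector_mult injD matrix_vector_mult_0_right)
    from pd_matsD(2)[OF A this] show ?thesis
      by (metis dot_lmul_matrix inner_commute transpose_matrix_vector matrix_vector_mul_assoc)
  qed
  then show ?thesis using transpose_conj_sym[OF pd_matsD(1)[OF A]] by (simp add: pd_mats_def)
qed

lemma pd_congruence_sym:
  fixes A M :: "real^'m^'m"
  assumes "A \<in> pd_mats" "M \<in> sym_mats" "invertible M"
  shows "M ** A ** M \<in> pd_mats"
  using pd_congruence[OF assms(1,3)] assms(2) by (simp add: sym_mats_def)

lemma pd_matrix_inv:
  fixes A :: "real^'m^'m"
  assumes "A \<in> pd_mats" shows "matrix_inv A \<in> pd_mats"
proof -
  have "invertible (matrix_inv A)" using pd_inv[OF assms] by (auto simp: invertible_def)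
  from pd_congruence_sym[OF assms sym_matrix_inv[OF pd_matsD(1)[OF assms] pd_invertible[OF assms]] this]
  show ?thesis by (simp add: pd_inv assms)
qed

lemma diag_conj_trace: "orthogonal_matrix Q \<Longrightarrow> trace (diag_conj Q d) = (\<Sum>i\<in>UNIV. d i)"
  unfolding diag_conj_def
  by (subst trace_mul_sym) (simp add: matrix_mul_assoc orthogonal_matrix_def trace_def)

lemma diag_conj_det: "orthogonal_matrix Q \<Longrightarrow> det (diag_conj Q d) = (\<Prod>i\<in>UNIV. d i)"
proof -
  assume Q: "orthogonal_matrix Q"
  have "det Q * det (transpose Q) = det (Q ** transpose Q)" by (rule det_mul[symmetric])
  then have "det Q * det Q = 1" using Q by (simp add: orthogonal_matrix_def)
  moreover have "det ((\<chi> i j. if i = j then d i else 0) :: real^'a^'a) = (\<Prod>i\<in>UNIV. d i)"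
    by (subst det_diagonal) auto
  ultimately show ?thesis by (simp add: diag_conj_def det_mul algebra_simps)
qed

lemma diag_conj_sym: "diag_conj Q d \<in> sym_mats"
proof -
  have "transpose ((\<chi> i j. if i = j then d i else 0) :: real^'a^'a) = (\<chi> i j. if i = j then d i else 0)"
    by (simp add: transpose_def vec_eq_iff)
  then show ?thesis by (simp add: sym_mats_def diag_conj_def matrix_transpose_mul matrix_mul_assoc)
qed

text \<open>
  In the coordinates given by the columns of \<open>Q\<close> the quadratic form is diagonal.
\<close>

lemma diag_conj_quadratic:
  assumes Q: "orthogonal_matrix (Q::real^'m^'m)"
  shows "v \<bullet> (diag_conj Q d *v v) = (\<Sum>i\<in>UNIV. d i * (v \<bullet> column i Q)\<^sup>2)"
proof -
  let ?D = "(\<chi> i j. if i = j then d i else 0) :: real^'m^'m"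
  have w: "(v v* Q) $ i = v \<bullet> column i Q" for i
    by (simp add: vector_matrix_mult_def column_def inner_vec_def mult.commute)
  have "v \<bullet> (diag_conj Q d *v v) = (v v* Q) \<bullet> (?D *v (v v* Q))"
    by (simp add: diag_conj_def matrix_vector_mul_assoc[symmetric] dot_lmul_matrix)
  also have "\<dots> = (\<Sum>i\<in>UNIV. d i * (v \<bullet> column i Q)\<^sup>2)"
    by (simp add: inner_vec_def w matrix_vector_mult_def mult_delta_left power2_eq_square algebra_simps)
  finally show ?thesis .
qed

lemma orthogonal_matrix_parseval:
  "orthogonal_matrix (Q::real^'m^'m) \<Longrightarrow> (\<Sum>i\<in>UNIV. (v \<bullet> column i Q)\<^sup>2) = v \<bullet> v"
  using diag_conj_quadratic[of Q v "\<lambda>_. 1"] diag_conj_const[of Q 1] by simp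

lemma diag_conj_pd_iff:
  fixes Q :: "real^'m^'m"
  assumes Q: "orthogonal_matrix Q"
  shows "diag_conj Q d \<in> pd_mats \<longleftrightarrow> (\<forall>i. 0 < d i)"
proof
  assume pd: "diag_conj Q d \<in> pd_mats"
  show "\<forall>i. 0 < d i"
  proof
    fix i
    have n: "norm (column i Q) = 1" using Q by (simp add: orthogonal_matrix_orthonormal_columns)
    then have "column i Q \<noteq> 0" by auto
    from pd_matsD(2)[OF pd this] show "0 < d i" using n by (simp add: diag_conj_eigen Q norm_eq_1)
  qed
next
  assume d: "\<forall>i. 0 < d i"
  have "0 < v \<bullet> (diag_conj Q d *v v)" if "v \<noteq> 0" for v
  proof -
    have "(\<Sum>i\<in>UNIV. (v \<bullet> column i Q)\<^sup>2) \<noteq> 0" using that by (simp add: orthogonal_matrix_parseval Q)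
    then obtain i where "v \<bullet> column i Q \<noteq> 0" by (auto simp: sum_nonneg_eq_0_iff)
    then have "0 < d i * (v \<bullet> column i Q)\<^sup>2" using d by simp
    then show ?thesis unfolding diag_conj_quadratic[OF Q]
      using d by (intro sum_pos2[of _ i]) (auto simp: less_imp_le)
  qed
  then show "diag_conj Q d \<in> pd_mats" using diag_conj_sym by (simp add: pd_mats_def)
qed

lemma pd_spectral_decomposition:
  fixes A :: "real^'m^'m"
  assumes A: "A \<in> pd_mats"
  obtains Q d where "orthogonal_matrix Q" "A = diag_conj Q d" "\<And>i. 0 < d i"
  using spectral_decomposition[OF pd_matsD(1)[OF A]] diag_conj_pd_iff A by metis

lemma pd_det_pos: "A \<in> pd_mats \<Longrightarrow> 0 < det A"
  by (metis pd_spectral_decomposition diag_conj_det prod_pos)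

text \<open>
  If \<open>R\<^sup>2 q = d q\<close> and \<open>w = R q - \<surd>d q\<close>, then \<open>R w = - \<surd>d
  w\<close>, which for positive semidefinite \<open>R\<close> and \<open>d > 0\<close> leaves only \<open>w
  = 0\<close>. So \<open>R\<close> agrees with the spectral square root on an eigenbasis.
\<close>

lemma psd_sqrt_unique:
  fixes R :: "real^'m^'m"
  assumes Q: "orthogonal_matrix Q" and d: "\<And>i. 0 < d i" and R: "R \<in> psd_mats" "R ** R = diag_conj Q d"
  shows "R = diag_conj Q (\<lambda>i. sqrt (d i))"
proof -
  have col: "R *v column i Q = sqrt (d i) *\<^sub>R column i Q" for i
  proof -
    define q where "q = column i Q"
    define w where "w = R *v q - sqrt (d i) *\<^sub>R q"
    have "R *v (R *v q) = d i *\<^sub>R q" 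
      by (simp add: matrix_vector_mul_assoc R q_def diag_conj_eigen Q)
    then have "R *v w = - sqrt (d i) *\<^sub>R w"
      using d[of i] by (simp add: w_def matrix_vector_mult_diff_distrib matrix_vector_mult_scaleR scaleR_diff_right)
    then have "w \<bullet> (R *v w) = - sqrt (d i) * (w \<bullet> w)" by simp
    moreover have "0 \<le> w \<bullet> (R *v w)" using R by (simp add: psd_mats_def)
    ultimately have "w \<bullet> w \<le> 0" using d[of i] by (simp add: mult_le_0_iff)
    then have "w = 0" by (metis inner_eq_zero_iff inner_ge_zero order_antisym)
    then show ?thesis by (simp add: w_def q_def)
  qed
  have "R ** Q = diag_conj Q (\<lambda>i. sqrt (d i)) ** Q"
  proof -
    have "(M ** Q) $ i $ j = (M *v column j Q) $ i" for M :: "real^'m^'m" and i j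
      by (simp add: matrix_matrix_mult_def matrix_vector_mult_def column_def)
    then show ?thesis by (simp add: vec_eq_iff col diag_conj_eigen Q)
  qed
  then have "R ** (Q ** transpose Q) = diag_conj Q (\<lambda>i. sqrt (d i)) ** (Q ** transpose Q)"
    by (simp add: matrix_mul_assoc)
  then show ?thesis using Q by (simp add: orthogonal_matrix_def)
qed

lemma mat_sqrt_pd:
  fixes A :: "real^'m^'m"
  assumes A: "A \<in> pd_mats"
  shows "mat_sqrt A \<in> pd_mats" "mat_sqrt A ** mat_sqrt A = A"
proof -
  obtain Q d where Q: "orthogonal_matrix Q" "A = diag_conj Q d" and d: "\<And>i. 0 < d i"
    using pd_spectral_decomposition[OF A] by blast
  let ?S = "diag_conj Q (\<lambda>i. sqrt (d i))"
  have S: "?S \<in> pd_mats" "?S ** ?S = A" using Q d by (auto simp: diag_conj_pd_iff diag_conj_mult less_imp_le)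
  then have "?S \<in> psd_mats" by (auto simp: pd_mats_def psd_mats_def) (metis inner_zero_left less_eq_real_def)
  moreover have "R = ?S" if "R \<in> psd_mats" "R ** R = A" for R
    by (rule psd_sqrt_unique[OF Q(1) _ that(1)]) (use d that(2) Q(2) in simp_all)
  ultimately have "mat_sqrt A = ?S" unfolding mat_sqrt_def
    using S(2) by (intro the_equality) blast+
  then show "mat_sqrt A \<in> pd_mats" "mat_sqrt A ** mat_sqrt A = A" using S by metis+
qed

text \<open>
  On eigenvalues this is \<open>ln d \<le> d - 1\<close>. It is the source of every estimate for the
  log-determinant below.
\<close>

lemma ln_det_le_trace:
  fixes A :: "real^'m^'m"
  assumes A: "A \<in> pd_mats"
  shows "ln (det A) \<le> trace A - CARD('m)"
proof -
  obtain Q d where Q: "orthogonal_matrix Q" "A = diag_conj Q d" and d: "\<And>i. 0 < d i"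
    using pd_spectral_decomposition[OF A] by blast
  have "ln (det A) = (\<Sum>i\<in>UNIV. ln (d i))" using Q d by (simp add: diag_conj_det ln_prod less_imp_neq[symmetric])
  also have "\<dots> \<le> (\<Sum>i\<in>UNIV. d i - 1)" using d by (intro sum_mono ln_le_minus_one) 
  finally show ?thesis using Q by (simp add: diag_conj_trace sum_subtractf)
qed

text \<open>
  With \<open>R = X\<^sup>1\<^sup>/\<^sup>2\<close> the product \<open>X V\<close> is similar to the
  symmetric matrix \<open>R V R\<close>, so it behaves spectrally like a symmetric matrix although it is not
  one.
\<close>

lemma pd_product_similar:
  fixes X V :: "real^'m^'m"
  assumes X: "X \<in> pd_mats" and V: "V \<in> sym_mats"
  obtains R R' Q d where "R \<in> sym_mats" "R ** R' = mat 1" "R' ** R = mat 1" "R ** R = X" "orthogonal_matrix Q"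
    "X ** V = R ** diag_conj Q d ** R'" "V \<in> pd_mats \<longrightarrow> (\<forall>i. 0 < d i)"
proof -
  define R where "R = mat_sqrt X"
  define R' where "R' = matrix_inv R"
  have R: "R \<in> pd_mats" "R ** R = X" using mat_sqrt_pd[OF X] by (auto simp: R_def)
  have R': "R ** R' = mat 1" "R' ** R = mat 1" using pd_inv[OF R(1)] by (auto simp: R'_def)
  have "R ** V ** R \<in> sym_mats" using transpose_conj_sym[OF V, of R] pd_matsD(1)[OF R(1)] by (simp add: sym_mats_def)
  then obtain Q d where Q: "orthogonal_matrix Q" "R ** V ** R = diag_conj Q d"
    using spectral_decomposition by blast
  have "R ** (R ** V ** R) ** R' = X ** V ** (R ** R')" by (simp add: matrix_mul_assoc R(2))
  then have "X ** V = R ** diag_conj Q d ** R'" using Q(2) R' by simp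
  moreover have "\<forall>i. 0 < d i" if "V \<in> pd_mats"
    using pd_congruence_sym[OF that pd_matsD(1)[OF R(1)] pd_invertible[OF R(1)]] Q by (simp add: diag_conj_pd_iff)
  ultimately show thesis using that R R' Q pd_matsD(1) by metis
qed

lemma trace_similar: 
  fixes M :: "real^'m^'m"
  assumes "R' ** R = mat 1"
  shows "trace (R ** M ** R') = trace M"
  by (subst trace_mul_sym) (simp add: matrix_mul_assoc assms)

lemma diag_conj_diff_const: "orthogonal_matrix Q \<Longrightarrow> diag_conj Q d - c *\<^sub>R mat 1 = diag_conj Q (\<lambda>i. d i - c)"
proof -
  assume Q: "orthogonal_matrix Q"
  let ?D = "\<lambda>d. (\<chi> i j. if i = j then d i else 0) :: real^'a^'a"
  have "diag_conj Q d - c *\<^sub>R mat 1 = diag_conj Q d - diag_conj Q (\<lambda>_. c)" by (simp add: diag_conj_const Q)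
  also have "\<dots> = Q ** (?D d - ?D (\<lambda>_. c)) ** transpose Q"
    by (simp add: diag_conj_def matrix_distribs)
  also have "?D d - ?D (\<lambda>_. c) = ?D (\<lambda>i. d i - c)" by (simp add: vec_eq_iff)
  finally show ?thesis by (simp add: diag_conj_def)
qed

text \<open>
  For positive definite \<open>X\<close> and \<open>V\<close> this is \<open>\<Sum>\<^sub>i
  (\<lambda>\<^sub>i - \<mu>)\<^sup>2 / \<lambda>\<^sub>i\<close> for the eigenvalues
  \<open>\<lambda>\<^sub>i\<close> of \<open>X V\<close>, hence measures the distance from \<open>X V =
  \<mu> I\<close>.
\<close>

definition centrality_gap :: "real \<Rightarrow> real^'m^'m \<Rightarrow> real^'m^'m \<Rightarrow> real" where
  "centrality_gap \<mu> X V = trace (X ** V) + \<mu>\<^sup>2 * trace (matrix_inv V ** matrix_inv X) - 2 * \<mu> * CARD('m)"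

text \<open>
  Everything is read off from the eigenvalues \<open>\<lambda>\<^sub>i > 0\<close> of \<open>X V\<close>.
  The fourth claim compares \<open>(\<lambda>\<^sub>i - \<mu>)\<^sup>2\<close> with
  \<open>(\<lambda>\<^sub>i - \<mu>)\<^sup>2 / \<lambda>\<^sub>i\<close> by means of
  \<open>\<lambda>\<^sub>i \<le> \<Sum>\<^sub>j \<lambda>\<^sub>j\<close>; its left-hand side is a
  polynomial in \<open>X\<close> and \<open>V\<close>, so it passes to limits without continuity of the
  matrix inverse.
\<close>

lemma centrality_gap:
  fixes X V :: "real^'m^'m" and \<mu> :: real
  assumes X: "X \<in> pd_mats" and V: "V \<in> pd_mats"
  defines "E \<equiv> X ** V - \<mu> *\<^sub>R mat 1"
  shows "0 \<le> centrality_gap \<mu> X V" "0 \<le> trace (X ** V)" "0 \<le> trace (E ** E)"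
    "trace (E ** E) \<le> trace (X ** V) * centrality_gap \<mu> X V"
    "trace (E ** E) = 0 \<Longrightarrow> X ** V = \<mu> *\<^sub>R mat 1"
proof -
  obtain R R' Q d where "R \<in> sym_mats" and R: "R ** R' = mat 1" "R' ** R = mat 1" and "R ** R = X"
    and Q: "orthogonal_matrix Q" and XV: "X ** V = R ** diag_conj Q d ** R'"
    and d': "V \<in> pd_mats \<longrightarrow> (\<forall>i. 0 < d i)"
    by (rule pd_product_similar[OF X pd_matsD(1)[OF V]])
  from d' V have d: "0 < d i" for i by blast
  have tr: "trace (X ** V) = (\<Sum>i\<in>UNIV. d i)" by (simp add: XV trace_similar R diag_conj_trace Q)
  let ?I = "R ** diag_conj Q (\<lambda>i. inverse (d i)) ** R'"
  have dd: "d i \<noteq> 0" for i using d[of i] by simp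
  have "X ** V ** ?I = R ** diag_conj Q d ** (R' ** R) ** diag_conj Q (\<lambda>i. inverse (d i)) ** R'"
    by (simp add: XV matrix_mul_assoc)
  also have "\<dots> = R ** (diag_conj Q d ** diag_conj Q (\<lambda>i. inverse (d i))) ** R'"
    by (simp add: R matrix_mul_assoc)
  also have "\<dots> = mat 1" by (simp add: diag_conj_mult Q dd diag_conj_const R)
  finally have "matrix_inv (X ** V) = ?I" by (rule matrix_inv_unique)
  moreover have "X ** V ** (matrix_inv V ** matrix_inv X) = X ** (V ** matrix_inv V) ** matrix_inv X"
    by (simp add: matrix_mul_assoc)
  then have "matrix_inv (X ** V) = matrix_inv V ** matrix_inv X"
    by (intro matrix_inv_unique) (simp add: pd_inv X V)
  ultimately have tri: "trace (matrix_inv V ** matrix_inv X) = (\<Sum>i\<in>UNIV. inverse (d i))"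
    by (simp add: trace_similar R diag_conj_trace Q)
  have gap: "centrality_gap \<mu> X V = (\<Sum>i\<in>UNIV. (d i - \<mu>)\<^sup>2 / d i)"
  proof -
    have "(d i - \<mu>)\<^sup>2 / d i = d i + \<mu>\<^sup>2 * inverse (d i) - 2 * \<mu>" for i
      using dd[of i] by (simp add: field_simps power2_eq_square)
    then show ?thesis by (simp add: centrality_gap_def tr tri sum.distrib sum_subtractf sum_distrib_left)
  qed
  have "E = R ** diag_conj Q (\<lambda>i. d i - \<mu>) ** R'"
    unfolding E_def XV diag_conj_diff_const[OF Q, symmetric] by (simp add: matrix_distribs R)
  then have "E ** E = R ** diag_conj Q (\<lambda>i. d i - \<mu>) ** (R' ** R) ** diag_conj Q (\<lambda>i. d i - \<mu>) ** R'"
    by (simp add: matrix_mul_assoc)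
  also have "\<dots> = R ** (diag_conj Q (\<lambda>i. d i - \<mu>) ** diag_conj Q (\<lambda>i. d i - \<mu>)) ** R'"
    by (simp add: R matrix_mul_assoc)
  also have "\<dots> = R ** diag_conj Q (\<lambda>i. (d i - \<mu>)\<^sup>2) ** R'" by (simp add: diag_conj_mult Q power2_eq_square)
  finally have trE: "trace (E ** E) = (\<Sum>i\<in>UNIV. (d i - \<mu>)\<^sup>2)"
    by (simp add: trace_similar R diag_conj_trace Q)
  show "0 \<le> centrality_gap \<mu> X V" unfolding gap using d by (intro sum_nonneg) (simp add: less_imp_le)
  show "0 \<le> trace (X ** V)" unfolding tr using d by (intro sum_nonneg) (simp add: less_imp_le)
  show "0 \<le> trace (E ** E)" unfolding trE by (intro sum_nonneg) simp
  have "(d i - \<mu>)\<^sup>2 \<le> (\<Sum>j\<in>UNIV. d j) * ((d i - \<mu>)\<^sup>2 / d i)" for i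
  proof -
    have "d i \<le> (\<Sum>j\<in>UNIV. d j)" using d by (intro member_le_sum) (auto simp: less_imp_le)
    then have "d i * ((d i - \<mu>)\<^sup>2 / d i) \<le> (\<Sum>j\<in>UNIV. d j) * ((d i - \<mu>)\<^sup>2 / d i)"
      using d[of i] by (intro mult_right_mono) (auto simp: less_imp_le)
    then show ?thesis using dd[of i] by simp
  qed
  then show "trace (E ** E) \<le> trace (X ** V) * centrality_gap \<mu> X V"
    unfolding trE tr gap sum_distrib_left by (rule sum_mono)
  show "X ** V = \<mu> *\<^sub>R mat 1" if "trace (E ** E) = 0"
  proof -
    have "\<forall>i. d i = \<mu>" using that unfolding trE by (auto simp: sum_nonneg_eq_0_iff)
    then have "diag_conj Q d = \<mu> *\<^sub>R mat 1" using diag_conj_const[OF Q, of \<mu>] by (metis (no_types) ext)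
    then show ?thesis by (simp add: XV matrix_distribs R)
  qed
qed

section \<open>Generalized eigenvalues, step bounds and the log-determinant\<close>

lemmas sym_mats_intros = subspace_add[OF sym_mats_subspace] subspace_diff[OF sym_mats_subspace]
  subspace_scale[OF sym_mats_subspace]

lemma diag_conj_eigenvalues:
  fixes Q :: "real^'m^'m"
  assumes Q: "orthogonal_matrix Q"
  shows "{c. \<exists>v. v \<noteq> 0 \<and> diag_conj Q d *v v = c *\<^sub>R v} = range d"
proof (intro equalityI subsetI)
  fix c assume "c \<in> range d"
  then obtain i where c: "c = d i" by blast
  have "norm (column i Q) = 1" using Q by (simp add: orthogonal_matrix_orthonormal_columns)
  then have "column i Q \<noteq> 0" by auto
  then show "c \<in> {c. \<exists>v. v \<noteq> 0 \<and> diag_conj Q d *v v = c *\<^sub>R v}"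
    using diag_conj_eigen[OF Q, of d i] c by blast
next
  fix c assume "c \<in> {c. \<exists>v. v \<noteq> 0 \<and> diag_conj Q d *v v = c *\<^sub>R v}"
  then obtain v where v: "v \<noteq> 0" "diag_conj Q d *v v = c *\<^sub>R v" by blast
  have "(\<Sum>i\<in>UNIV. (v \<bullet> column i Q)\<^sup>2) \<noteq> 0" using v by (simp add: orthogonal_matrix_parseval Q)
  then obtain i where i: "v \<bullet> column i Q \<noteq> 0" by (auto simp: sum_nonneg_eq_0_iff)
  have "c * (v \<bullet> column i Q) = (diag_conj Q d *v v) \<bullet> column i Q" using v by simp
  also have "\<dots> = d i * (v \<bullet> column i Q)"
    by (simp add: sym_mats_inner[OF diag_conj_sym] diag_conj_eigen Q)
  finally show "c \<in> range d" using i by auto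
qed

text \<open>
  \<open>X\<^sup>-\<^sup>1 D\<close> is similar to the symmetric matrix
  \<open>X\<^sup>-\<^sup>1\<^sup>/\<^sup>2 D X\<^sup>-\<^sup>1\<^sup>/\<^sup>2\<close>, so it has finitely
  many real eigenvalues and at least one; the smallest is the minimum of the generalized Rayleigh quotient
  of \<open>D\<close> relative to \<open>X\<close>.
\<close>

lemma lambda_min_rayleigh:
  fixes X D :: "real^'m^'m"
  assumes X: "X \<in> pd_mats" and D: "D \<in> sym_mats"
  defines "l \<equiv> lambda_min (matrix_inv X ** D)"
  shows "l * (v \<bullet> (X *v v)) \<le> v \<bullet> (D *v v)" "\<exists>v. v \<noteq> 0 \<and> v \<bullet> (D *v v) = l * (v \<bullet> (X *v v))"
proof -
  define M where "M = matrix_inv X ** D"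
  obtain R R' Q d where R: "R \<in> sym_mats" "R ** R' = mat 1" "R' ** R = mat 1" "R ** R = matrix_inv X"
    and Q: "orthogonal_matrix Q" and M: "M = R ** diag_conj Q d ** R'"
    and "D \<in> pd_mats \<longrightarrow> (\<forall>i. 0 < d i)"
    unfolding M_def by (rule pd_product_similar[OF pd_matrix_inv[OF X] D])
  have invR: "v = 0" if "R' *v v = 0" for v
    using that by (metis R(2) matrix_vector_mul_assoc matrix_vector_mul_lid matrix_vector_mult_0_right)
  have invR': "v = 0" if "R *v v = 0" for v
    using that by (metis R(3) matrix_vector_mul_assoc matrix_vector_mul_lid matrix_vector_mult_0_right)
  have M': "R' ** M = diag_conj Q d ** R'" "M ** R = R ** diag_conj Q d"
    unfolding M by (simp_all add: matrix_mul_assoc R) (simp add: matrix_mul_assoc[symmetric] R)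
  have set: "{c. \<exists>v. v \<noteq> 0 \<and> M *v v = c *\<^sub>R v} = range d"
  proof -
    have "(\<exists>v. v \<noteq> 0 \<and> M *v v = c *\<^sub>R v) \<longleftrightarrow> (\<exists>v. v \<noteq> 0 \<and> diag_conj Q d *v v = c *\<^sub>R v)" for c
    proof
      assume "\<exists>v. v \<noteq> 0 \<and> M *v v = c *\<^sub>R v"
      then obtain v where v: "v \<noteq> 0" "M *v v = c *\<^sub>R v" by blast
      have "diag_conj Q d *v (R' *v v) = R' *v (M *v v)" by (simp add: matrix_vector_mul_assoc M')
      then show "\<exists>v. v \<noteq> 0 \<and> diag_conj Q d *v v = c *\<^sub>R v"
        using invR[of v] v by (intro exI[of _ "R' *v v"]) (auto simp: matrix_vector_mult_scaleR)
    next
      assume "\<exists>v. v \<noteq> 0 \<and> diag_conj Q d *v v = c *\<^sub>R v"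
      then obtain v where v: "v \<noteq> 0" "diag_conj Q d *v v = c *\<^sub>R v" by blast
      have "M *v (R *v v) = R *v (diag_conj Q d *v v)" by (simp add: matrix_vector_mul_assoc M')
      then show "\<exists>v. v \<noteq> 0 \<and> M *v v = c *\<^sub>R v"
        using invR'[of v] v by (intro exI[of _ "R *v v"]) (auto simp: matrix_vector_mult_scaleR)
    qed
    then show ?thesis using diag_conj_eigenvalues[OF Q, of d] by simp
  qed
  have l: "l = Min (range d)" by (simp add: l_def lambda_min_def set flip: M_def)
  have XM: "X ** M = D" using pd_inv(1)[OF X] by (simp add: M_def matrix_mul_assoc)
  have R'sym: "R' \<in> sym_mats"
    using sym_matrix_inv[OF R(1)] matrix_inv_unique[OF R(2)] R(2) by (metis invertible_right_inverse)
  have X': "X = R' ** R'"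
  proof -
    have "matrix_inv X ** (R' ** R') = R ** (R ** R') ** R'" by (simp add: matrix_mul_assoc R(4))
    then have "matrix_inv X ** (R' ** R') = mat 1" by (simp add: R)
    then have "X ** (matrix_inv X ** (R' ** R')) = X" by simp
    then show ?thesis by (simp add: matrix_mul_assoc pd_inv X)
  qed
  have D': "D = R' ** diag_conj Q d ** R'"
    using XM M'(1) by (metis X' matrix_mul_assoc)
  show "l * (v \<bullet> (X *v v)) \<le> v \<bullet> (D *v v)"
  proof -
    define w where "w = R' *v v"
    have "v \<bullet> (X *v v) = w \<bullet> w"
      by (simp add: X' w_def matrix_vector_mul_assoc[symmetric] sym_mats_inner[OF R'sym])
    then have "l * (v \<bullet> (X *v v)) = (\<Sum>i\<in>UNIV. l * (w \<bullet> column i Q)\<^sup>2)"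
      by (simp add: orthogonal_matrix_parseval[OF Q, symmetric] sum_distrib_left)
    also have "\<dots> \<le> (\<Sum>i\<in>UNIV. d i * (w \<bullet> column i Q)\<^sup>2)"
      by (intro sum_mono mult_right_mono) (auto simp: l)
    also have "\<dots> = w \<bullet> (diag_conj Q d *v w)" by (simp add: diag_conj_quadratic Q)
    also have "\<dots> = v \<bullet> (D *v v)"
      by (simp add: D' w_def matrix_vector_mul_assoc[symmetric] sym_mats_inner[OF R'sym])
    finally show ?thesis .
  qed
  have "l \<in> range d" unfolding l by (rule Min_in) auto
  then obtain v where v: "v \<noteq> 0" "M *v v = l *\<^sub>R v" using set by blast
  have "D *v v = X *v (M *v v)" by (simp add: matrix_vector_mul_assoc XM)
  then have "v \<bullet> (D *v v) = l * (v \<bullet> (X *v v))" using v by (simp add: matrix_vector_mult_scaleR)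
  with v(1) show "\<exists>v. v \<noteq> 0 \<and> v \<bullet> (D *v v) = l * (v \<bullet> (X *v v))" by blast
qed

text \<open>
  A bound on the operator norm, which unlike the Euclidean norm of the type gives \<open>1 / c\<close> for
  \<open>X\<^sup>-\<^sup>1\<close> when \<open>c I \<preceq> X\<close>, without a factor depending on the
  size.
\<close>

definition op_bound :: "real^'m^'m \<Rightarrow> real \<Rightarrow> bool" where
  "op_bound A K \<longleftrightarrow> 0 \<le> K \<and> (\<forall>v. norm (A *v v) \<le> K * norm v)"

definition coercive :: "real \<Rightarrow> real^'m^'m \<Rightarrow> bool" where
  "coercive c A \<longleftrightarrow> (\<forall>v. c * (v \<bullet> v) \<le> v \<bullet> (A *v v))"

lemma coercive_pd: "A \<in> sym_mats \<Longrightarrow> 0 < c \<Longrightarrow> coercive c A \<Longrightarrow> A \<in> pd_mats"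
  unfolding pd_mats_def coercive_def by (auto) (metis inner_gt_zero_iff mult_pos_pos order_less_le_trans)

lemma op_boundD: "op_bound A K \<Longrightarrow> norm (A *v v) \<le> K * norm v" by (simp add: op_bound_def)

lemma op_bound_quadratic: "op_bound A K \<Longrightarrow> \<bar>v \<bullet> (A *v v)\<bar> \<le> K * (v \<bullet> v)"
proof -
  assume A: "op_bound A K"
  have "\<bar>v \<bullet> (A *v v)\<bar> \<le> norm v * norm (A *v v)" by (rule Cauchy_Schwarz_ineq2)
  also have "\<dots> \<le> norm v * (K * norm v)" using A by (intro mult_left_mono) (auto simp: op_bound_def)
  finally show ?thesis by (simp add: power2_norm_eq_inner[symmetric] power2_eq_square mult_ac)
qed

lemma op_bound_mult: "op_bound A K \<Longrightarrow> op_bound B L \<Longrightarrow> op_bound (A ** B) (K * L)"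
  unfolding op_bound_def
proof (intro conjI allI)
  fix v assume A: "0 \<le> K \<and> (\<forall>v. norm (A *v v) \<le> K * norm v)" and B: "0 \<le> L \<and> (\<forall>v. norm (B *v v) \<le> L * norm v)"
  then have "norm (A *v (B *v v)) \<le> K * norm (B *v v)" by blast
  also have "\<dots> \<le> K * (L * norm v)" using A B by (intro mult_left_mono) auto
  finally show "norm ((A ** B) *v v) \<le> K * L * norm v" by (simp add: matrix_vector_mul_assoc mult.assoc)
qed simp

lemma op_bound_add: "op_bound A K \<Longrightarrow> op_bound B L \<Longrightarrow> op_bound (A + B) (K + L)"
  unfolding op_bound_def by (smt (verit) matrix_vector_mult_add_rdistrib norm_triangle_ineq distrib_right)

lemma op_bound_scaleR: "op_bound A K \<Longrightarrow> op_bound (k *\<^sub>R A) (\<bar>k\<bar> * K)"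
  unfolding op_bound_def
  by (auto simp: scaleR_matrix_vector_assoc[symmetric] mult.assoc intro: mult_left_mono)

lemma op_bound_diff: "op_bound A K \<Longrightarrow> op_bound B L \<Longrightarrow> op_bound (A - B) (K + L)"
  unfolding op_bound_def by (smt (verit) matrix_vector_mult_diff_rdistrib norm_triangle_ineq4 distrib_right)

lemma op_bound_mono: "op_bound A K \<Longrightarrow> K \<le> L \<Longrightarrow> op_bound A L"
  unfolding op_bound_def by (meson mult_right_mono norm_ge_zero order_trans)

lemma op_bound_component: "op_bound A K \<Longrightarrow> \<bar>A $ i $ j\<bar> \<le> K"
proof -
  assume A: "op_bound A K"
  have "\<bar>A $ i $ j\<bar> = \<bar>(A *v axis j 1) $ i\<bar>" by (simp add: matrix_vector_mult_basis column_def)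
  also have "\<dots> \<le> norm (A *v axis j 1)" by (rule component_le_norm_cart)
  also have "\<dots> \<le> K" using op_boundD[OF A, of "axis j 1"] by simp
  finally show ?thesis .
qed

lemma op_bound_trace: "op_bound (A::real^'m^'m) K \<Longrightarrow> \<bar>trace A\<bar> \<le> real CARD('m) * K"
proof -
  assume A: "op_bound A K"
  have "\<bar>trace A\<bar> \<le> (\<Sum>i\<in>UNIV. \<bar>A $ i $ i\<bar>)" unfolding trace_def by (rule sum_abs)
  also have "\<dots> \<le> (\<Sum>i\<in>(UNIV::'m set). K)" by (intro sum_mono op_bound_component A)
  finally show ?thesis by simp
qed

lemma op_bound_norm: "op_bound (A::real^'m^'m) (real CARD('m) * real CARD('m) * norm A)"
proof -
  have "\<bar>A $ i $ j\<bar> \<le> norm A" for i j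
    using component_le_norm_cart[of "A $ i" j] Finite_Cartesian_Product.norm_nth_le[of A i] by linarith
  then have "onorm ((*v) A) \<le> real CARD('m) * real CARD('m) * norm A"
    by (rule onorm_le_matrix_component)
  then show ?thesis unfolding op_bound_def
    using onorm[OF matrix_vector_mul_bounded_linear, of A]
    by simp (meson mult_right_mono norm_ge_zero order_trans)
qed

lemma norm_le_op_bound: "op_bound (A::real^'m^'m) K \<Longrightarrow> norm A \<le> real CARD('m) * (real CARD('m) * K)"
proof -
  assume A: "op_bound A K"
  have "norm A \<le> (\<Sum>i\<in>UNIV. norm (A $ i))" unfolding norm_vec_def by (rule L2_set_le_sum) simp
  also have "\<dots> \<le> (\<Sum>i\<in>(UNIV::'m set). \<Sum>j\<in>UNIV. \<bar>A $ i $ j\<bar>)" by (intro sum_mono norm_le_l1_cart)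
  also have "\<dots> \<le> (\<Sum>i\<in>(UNIV::'m set). \<Sum>j\<in>(UNIV::'m set). K)" by (intro sum_mono op_bound_component A)
  finally show ?thesis by simp
qed

lemma op_bound_inverse:
  fixes X :: "real^'m^'m"
  assumes X: "X \<in> pd_mats" and c: "0 < c" "coercive c X"
  shows "op_bound (matrix_inv X) (1 / c)"
  unfolding op_bound_def
proof (intro conjI allI)
  fix v
  define w where "w = matrix_inv X *v v"
  have v: "X *v w = v" by (simp add: w_def matrix_vector_mul_assoc pd_inv X)
  have "c * (w \<bullet> w) \<le> w \<bullet> v" using c v by (metis coercive_def)
  also have "\<dots> \<le> norm w * norm v" by (rule norm_cauchy_schwarz)
  finally have "c * norm w * norm w \<le> norm v * norm w" by (simp add: power2_norm_eq_inner[symmetric] power2_eq_square mult_ac)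
  then have "c * norm w \<le> norm v" by (cases "w = 0") auto
  then show "norm (matrix_inv X *v v) \<le> 1 / c * norm v" using c by (simp add: w_def field_simps)
qed (use c in simp)

text \<open>
  For \<open>t\<close> up to the bound, \<open>X + t D \<succeq> (1 + t \<lambda>) X \<succeq> (1 -
  \<sigma>) X\<close>, where \<open>\<lambda>\<close> is the smallest eigenvalue of \<open>X\<^sup>-\<^sup>1
  D\<close>. The last claim, \<open>- \<lambda> \<le> K / c\<close>, makes the bound uniform along a run.
\<close>

lemma step_bound:
  fixes X D :: "real^'m^'m"
  assumes X: "X \<in> pd_mats" and D: "D \<in> sym_mats" and s: "0 < \<sigma>" "\<sigma> < 1"
  shows "0 < step_bound \<sigma> X D"
    and "0 \<le> t \<Longrightarrow> t \<le> step_bound \<sigma> X D \<Longrightarrow> X + t *\<^sub>R D \<in> pd_mats"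
    and "0 < c \<Longrightarrow> coercive c X \<Longrightarrow> op_bound D K \<Longrightarrow> 0 < K \<Longrightarrow> min 1 (\<sigma> * c / K) \<le> step_bound \<sigma> X D"
proof -
  define l where "l = lambda_min (matrix_inv X ** D)"
  have le: "l * (v \<bullet> (X *v v)) \<le> v \<bullet> (D *v v)" for v
    using lambda_min_rayleigh(1)[OF X D] by (simp add: l_def)
  obtain v where v: "v \<noteq> 0" "v \<bullet> (D *v v) = l * (v \<bullet> (X *v v))"
    using lambda_min_rayleigh(2)[OF X D] by (auto simp: l_def)
  have sb: "step_bound \<sigma> X D = (if l < 0 then - \<sigma> / l else 1)" by (simp add: step_bound_def l_def Let_def)
  show "0 < step_bound \<sigma> X D" using s by (simp add: sb divide_pos_neg)
  show "X + t *\<^sub>R D \<in> pd_mats" if t: "0 \<le> t" "t \<le> step_bound \<sigma> X D"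
  proof -
    have "0 < w \<bullet> ((X + t *\<^sub>R D) *v w)" if w: "w \<noteq> 0" for w
    proof -
      have tl: "0 < 1 + t * l"
      proof (cases "l < 0")
        case True
        then have "t * l \<ge> - \<sigma>" using t by (simp add: sb field_simps)
        then show ?thesis using s by simp
      next
        case False then show ?thesis using t by (simp add: add_pos_nonneg)
      qed
      have "0 < (1 + t * l) * (w \<bullet> (X *v w))" using tl pd_matsD(2)[OF X w] by simp
      also have "\<dots> \<le> w \<bullet> (X *v w) + t * (w \<bullet> (D *v w))"
        using mult_left_mono[OF le[of w] t(1)] by (simp add: algebra_simps)
      finally show ?thesis
        by (simp add: matrix_vector_mult_add_rdistrib inner_add_right scaleR_matrix_vector_assoc[symmetric])
    qed
    moreover have "X + t *\<^sub>R D \<in> sym_mats" using pd_matsD(1)[OF X] D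
      by (simp add: sym_mats_intros)
    ultimately show ?thesis by (simp add: pd_mats_def)
  qed
  show "min 1 (\<sigma> * c / K) \<le> step_bound \<sigma> X D" if c: "0 < c" "coercive c X" "op_bound D K" "0 < K"
  proof (cases "l < 0")
    case True
    have vv: "0 < v \<bullet> v" using v by simp
    have "- l * (c * (v \<bullet> v)) \<le> - l * (v \<bullet> (X *v v))" using c True by (intro mult_left_mono) (auto simp: coercive_def)
    also have "\<dots> \<le> K * (v \<bullet> v)" using op_bound_quadratic[OF c(3), of v] v by simp
    finally have "(- l * c) * (v \<bullet> v) \<le> K * (v \<bullet> v)" by simp
    then have "- l * c \<le> K" using vv by (rule mult_right_le_imp_le)
    then have "c / K \<le> 1 / (- l)" using True c by (simp add: field_simps)
    then have "\<sigma> * (c / K) \<le> \<sigma> * (1 / (- l))" using s by (intro mult_left_mono) auto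
    then show ?thesis using True by (simp add: sb)
  qed (simp add: sb)
qed

text \<open>
  Concavity of \<open>log det\<close>, from \<open>ln_det_le_trace\<close> applied to
  \<open>X\<^sup>-\<^sup>1\<^sup>/\<^sup>2 Y X\<^sup>-\<^sup>1\<^sup>/\<^sup>2\<close>. Used with both
  orders of \<open>X\<close> and \<open>Y\<close> it encloses the increment between the linear terms at the
  two end points, so the determinant need not be differentiated.
\<close>

lemma ln_det_gradient_ineq:
  fixes X Y :: "real^'m^'m"
  assumes X: "X \<in> pd_mats" and Y: "Y \<in> pd_mats"
  shows "ln (det Y) - ln (det X) \<le> trace (matrix_inv X ** (Y - X))"
proof -
  define R where "R = mat_sqrt (matrix_inv X)"
  have R: "R \<in> pd_mats" "R ** R = matrix_inv X" using mat_sqrt_pd[OF pd_matrix_inv[OF X]] by (auto simp: R_def)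
  have S: "R ** Y ** R \<in> pd_mats" using pd_congruence_sym[OF Y pd_matsD(1) pd_invertible] R by blast
  have "det (R ** R) * det X = 1"
    by (metis R(2) det_I det_mul pd_inv(2)[OF X])
  then have "det (R ** Y ** R) = det Y / det X"
    using pd_det_pos[OF X] by (simp add: det_mul field_simps)
  then have "ln (det Y) - ln (det X) = ln (det (R ** Y ** R))"
    using pd_det_pos[OF X] pd_det_pos[OF Y] by (simp add: ln_div)
  also have "\<dots> \<le> trace (R ** Y ** R) - CARD('m)" by (rule ln_det_le_trace[OF S])
  also have "trace (R ** Y ** R) = trace (R ** R ** Y)" by (metis matrix_mul_assoc trace_mul_sym)
  also have "trace (R ** R ** Y) - CARD('m) = trace (matrix_inv X ** (Y - X))"
    by (simp add: R(2) matrix_distribs trace_sub pd_inv X trace_I)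
  finally show ?thesis .
qed

lemma inverse_diff:
  fixes X Y :: "real^'m^'m"
  assumes "X \<in> pd_mats" "Y \<in> pd_mats"
  shows "matrix_inv Y - matrix_inv X = matrix_inv Y ** (X - Y) ** matrix_inv X"
  using assms by (simp add: matrix_distribs pd_inv flip: matrix_mul_assoc)

text \<open>
  The two enclosing linear terms differ by \<open>t\<^sup>2 tr(Y\<^sup>-\<^sup>1 L X\<^sup>-\<^sup>1
  L)\<close> with \<open>Y = X + t L\<close>, and \<open>t K \<le> c / 2\<close> leaves \<open>Y\<close>
  coercive with constant \<open>c / 2\<close>. The error constant depends only on \<open>c\<close>,
  \<open>K\<close> and the size of the matrices.
\<close>

lemma ln_det_expansion:
  fixes X L :: "real^'m^'m" and c K t :: real
  assumes X: "X \<in> sym_mats" "coercive c X" "0 < c" and L: "L \<in> sym_mats" "op_bound L K"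
    and t: "0 \<le> t" "t * K \<le> c / 2"
  shows "X + t *\<^sub>R L \<in> pd_mats"
    and "ln (det (X + t *\<^sub>R L)) - ln (det X) \<le> t * trace (matrix_inv X ** L)"
    and "t * trace (matrix_inv X ** L) - t\<^sup>2 * (2 * real CARD('m) * K\<^sup>2 / c\<^sup>2) \<le> ln (det (X + t *\<^sub>R L)) - ln (det X)"
proof -
  let ?Y = "X + t *\<^sub>R L"
  have Xp: "X \<in> pd_mats" using X by (simp add: coercive_pd)
  have Yc: "coercive (c / 2) ?Y" unfolding coercive_def
  proof
    fix v
    have "t * (v \<bullet> (L *v v)) \<ge> t * (- K * (v \<bullet> v))"
      using op_bound_quadratic[OF L(2), of v] t by (intro mult_left_mono) auto
    moreover have "t * K * (v \<bullet> v) \<le> c / 2 * (v \<bullet> v)" using t by (intro mult_right_mono) auto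
    moreover have "c * (v \<bullet> v) \<le> v \<bullet> (X *v v)" using X by (simp add: coercive_def)
    ultimately show "c / 2 * (v \<bullet> v) \<le> v \<bullet> (?Y *v v)"
      by (simp add: matrix_vector_mult_add_rdistrib inner_add_right scaleR_matrix_vector_assoc[symmetric] algebra_simps)
  qed
  have "?Y \<in> sym_mats" using X L by (simp add: sym_mats_intros)
  then show Yp: "?Y \<in> pd_mats" using Yc X by (intro coercive_pd[of _ "c/2"]) auto
  show "ln (det ?Y) - ln (det X) \<le> t * trace (matrix_inv X ** L)"
    using ln_det_gradient_ineq[OF Xp Yp] by (simp add: matrix_distribs trace_scaleR)
  have lower: "t * trace (matrix_inv ?Y ** L) \<le> ln (det ?Y) - ln (det X)"
  proof -
    have "X - ?Y = (- t) *\<^sub>R L" by simp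
    with ln_det_gradient_ineq[OF Yp Xp] have "ln (det X) - ln (det ?Y) \<le> trace (matrix_inv ?Y ** ((- t) *\<^sub>R L))"
      by simp
    then show ?thesis unfolding matrix_scaleR_right trace_scaleR by simp
  qed
  have "matrix_inv ?Y - matrix_inv X = - t *\<^sub>R (matrix_inv ?Y ** L ** matrix_inv X)"
  proof -
    have "X - ?Y = (- t) *\<^sub>R L" by simp
    then show ?thesis unfolding inverse_diff[OF Xp Yp] by (simp only: matrix_scaleR_right matrix_scaleR_left)
  qed
  then have eq: "matrix_inv ?Y ** L - matrix_inv X ** L = - t *\<^sub>R (matrix_inv ?Y ** L ** matrix_inv X ** L)"
    by (metis matrix_diff_rdistrib matrix_scaleR_left)
  have "op_bound (matrix_inv ?Y ** L ** matrix_inv X ** L) (1 / (c/2) * K * (1 / c) * K)"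
    using X L Yp Xp Yc by (intro op_bound_mult op_bound_inverse) auto
  from op_bound_trace[OF this]
  have "\<bar>trace (matrix_inv ?Y ** L ** matrix_inv X ** L)\<bar> \<le> 2 * real CARD('m) * K\<^sup>2 / c\<^sup>2"
    by (simp add: power2_eq_square mult_ac)
  moreover have "trace (matrix_inv ?Y ** L) - trace (matrix_inv X ** L) = - t * trace (matrix_inv ?Y ** L ** matrix_inv X ** L)"
    by (simp only: trace_sub[symmetric] eq trace_scaleR)
  ultimately have "trace (matrix_inv ?Y ** L) \<ge> trace (matrix_inv X ** L) - t * (2 * real CARD('m) * K\<^sup>2 / c\<^sup>2)"
    using t mult_left_mono[of "trace (matrix_inv ?Y ** L ** matrix_inv X ** L)" "2 * real CARD('m) * K\<^sup>2 / c\<^sup>2" t] by linarith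
  from mult_left_mono[OF this t(1)] lower
  show "t * trace (matrix_inv X ** L) - t\<^sup>2 * (2 * real CARD('m) * K\<^sup>2 / c\<^sup>2) \<le> ln (det ?Y) - ln (det X)"
    by (simp add: algebra_simps power2_eq_square)
qed

section \<open>Uniform positive definiteness and the scaled Newton direction\<close>

lemma pd_subset_psd: "pd_mats \<subseteq> psd_mats"
proof
  fix A :: "real^'m^'m" assume A: "A \<in> pd_mats"
  have "0 \<le> v \<bullet> (A *v v)" for v using pd_matsD(2)[OF A, of v] by (cases "v = 0") auto
  then show "A \<in> psd_mats" using A by (simp add: pd_mats_def psd_mats_def)
qed

lemma psd_det_pd:
  fixes A :: "real^'m^'m"
  assumes A: "A \<in> psd_mats" and d: "det A \<noteq> 0"
  shows "A \<in> pd_mats"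
proof -
  have "0 < v \<bullet> (A *v v)" if v: "v \<noteq> 0" for v
  proof (rule ccontr)
    assume "\<not> 0 < v \<bullet> (A *v v)"
    then have "v \<bullet> (A *v v) = 0" using A by (simp add: psd_mats_def order_antisym)
    then have "w \<bullet> (A *v v) = 0" for w using psd_null[OF subspace_UNIV, of A v w] A by (simp add: psd_mats_def)
    from this[of "A *v v"] have "A *v v = 0" by simp
    then show False using v d
      by (metis invertible_det_nz matrix_inv_mult(2) matrix_vector_mul_assoc matrix_vector_mul_lid matrix_vector_mult_0_right)
  qed
  then show ?thesis using A by (simp add: pd_mats_def psd_mats_def)
qed

lemma continuous_on_matrix_quadratic:
  "continuous_on UNIV (\<lambda>(A::real^'m^'m, v). v \<bullet> (A *v v))"
  unfolding case_prod_unfold inner_vec_def matrix_vector_mult_def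
  by (simp add: inner_real_def) (intro continuous_intros)

lemma continuous_on_det: "continuous_on UNIV (det :: real^'m^'m \<Rightarrow> real)"
  unfolding det_def by (intro continuous_intros)

lemma closed_psd_mats: "closed (psd_mats :: (real^'m^'m) set)"
proof -
  have "closed {A :: real^'m^'m. transpose A = A}"
    unfolding transpose_def by (intro closed_Collect_eq continuous_intros)
  moreover have "closed {A :: real^'m^'m. 0 \<le> v \<bullet> (A *v v)}" for v
  proof -
    have "continuous_on UNIV (\<lambda>A::real^'m^'m. (A, v))" by (intro continuous_intros)
    from continuous_on_compose2[OF continuous_on_matrix_quadratic this]
    have "continuous_on UNIV (\<lambda>A::real^'m^'m. v \<bullet> (A *v v))" by simp
    then show ?thesis by (intro closed_Collect_le continuous_on_const)
  qed
  ultimately have "closed ({A :: real^'m^'m. transpose A = A} \<inter> (\<Inter>v. {A. 0 \<le> v \<bullet> (A *v v)}))"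
    by (intro closed_Int closed_INT) auto
  moreover have "psd_mats = {A :: real^'m^'m. transpose A = A} \<inter> (\<Inter>v. {A. 0 \<le> v \<bullet> (A *v v)})"
    by (auto simp: psd_mats_def sym_mats_def)
  ultimately show ?thesis by simp
qed

text \<open>
  A bounded set of positive semidefinite matrices with determinants at least \<open>c > 0\<close> lies in a
  compact set of the same kind, all of whose members are nonsingular and hence positive definite; the least
  value of \<open>v \<bullet> A v\<close> over this set and the unit sphere is positive.
\<close>

lemma uniformly_coercive:
  fixes S :: "(real^'m^'m) set"
  assumes S: "S \<subseteq> pd_mats" "bounded S" and d: "0 < c" "\<And>A. A \<in> S \<Longrightarrow> c \<le> det A"
  obtains k where "0 < k" "\<And>A. A \<in> S \<Longrightarrow> coercive k A"
proof (cases "S = {}")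
  case True then show ?thesis using that[of 1] by auto
next
  case False
  obtain M where M: "\<forall>A\<in>S. norm A \<le> M" using S(2) unfolding bounded_iff by blast
  define C where "C = (psd_mats \<inter> {A. c \<le> det A}) \<inter> cball (0::real^'m^'m) M"
  have SC: "S \<subseteq> C"
  proof
    fix A assume A: "A \<in> S"
    then have "A \<in> pd_mats" "norm A \<le> M" "c \<le> det A" using S(1) M d(2) by blast+
    then show "A \<in> C" using pd_subset_psd by (auto simp: C_def)
  qed
  have "closed (psd_mats \<inter> {A. c \<le> det (A::real^'m^'m)})"
    by (intro closed_Int closed_psd_mats closed_Collect_le continuous_intros continuous_on_det)
  then have "compact C" unfolding C_def by (rule closed_Int_compact) simp
  then have "compact (C \<times> sphere (0::real^'m) 1)" by (intro compact_Times) auto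
  moreover have "C \<times> sphere (0::real^'m) 1 \<noteq> {}" using False SC by (auto simp: sphere_eq_empty)
  moreover have "continuous_on (C \<times> sphere 0 1) (\<lambda>(A::real^'m^'m, v). v \<bullet> (A *v v))"
    using continuous_on_matrix_quadratic continuous_on_subset by blast
  ultimately have "\<exists>p\<in>C \<times> sphere 0 1. \<forall>q\<in>C \<times> sphere 0 1.
      (\<lambda>(A::real^'m^'m, v). v \<bullet> (A *v v)) p \<le> (\<lambda>(A, v). v \<bullet> (A *v v)) q"
    by (rule continuous_attains_inf)
  then obtain p where p: "p \<in> C \<times> sphere (0::real^'m) 1"
    and le: "\<forall>q\<in>C \<times> sphere (0::real^'m) 1. (\<lambda>(A::real^'m^'m, v). v \<bullet> (A *v v)) p \<le> (\<lambda>(A, v). v \<bullet> (A *v v)) q"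
    by blast
  obtain A v where Av: "p = (A, v)" by (cases p)
  define k where "k = v \<bullet> (A *v v)"
  have "A \<in> pd_mats" using p Av d by (intro psd_det_pd) (auto simp: C_def)
  moreover have "v \<noteq> 0" using p Av by auto
  ultimately have k: "0 < k" unfolding k_def by (rule pd_matsD(2))
  have "coercive k A'" if A': "A' \<in> S" for A'
    unfolding coercive_def
  proof
    fix w
    show "k * (w \<bullet> w) \<le> w \<bullet> (A' *v w)"
    proof (cases "w = 0")
      case False
      then have "(A', w /\<^sub>R norm w) \<in> C \<times> sphere 0 1" using A' SC by auto
      from le[rule_format, OF this] have "k \<le> (w \<bullet> (A' *v w)) / (w \<bullet> w)"
        by (simp add: Av k_def matrix_vector_mult_scaleR power2_norm_eq_inner[symmetric] power2_eq_square divide_inverse mult_ac)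
      then show ?thesis using False by (simp add: field_simps)
    qed simp
  qed
  with k show ?thesis by (rule that)
qed

lemma trace_congruence:
  fixes D X :: "real^'m^'m"
  assumes D: "D \<in> sym_mats"
  shows "trace (D ** X ** D) = (\<Sum>i\<in>UNIV. (D *v axis i 1) \<bullet> (X *v (D *v axis i 1)))"
proof -
  have "(D ** X ** D) $ i $ i = axis i 1 \<bullet> (D *v (X *v (D *v axis i 1)))" for i
  proof -
    have "axis i 1 \<bullet> (D *v (X *v (D *v axis i 1))) = ((D ** X ** D) *v axis i 1) $ i"
      by (simp only: matrix_vector_mul_assoc matrix_mul_assoc) (simp add: inner_axis')
    then show ?thesis by (simp only: matrix_vector_mult_basis column_def) simp
  qed
  then show ?thesis unfolding trace_def by (simp add: sym_mats_inner[OF D])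
qed

text \<open>
  Injectivity on symmetric matrices: if \<open>X D + D X = 0\<close> then \<open>0 = tr(D X D) =
  \<Sum>\<^sub>i (D e\<^sub>i) \<bullet> X (D e\<^sub>i)\<close>, so \<open>D = 0\<close>.
\<close>

lemma jordan_prod_inv_eq:
  fixes X :: "real^'m^'m"
  assumes X: "X \<in> pd_mats" and Z: "Z \<in> sym_mats"
  shows "jordan_prod_inv X (jordan_prod X Z) = Z"
proof -
  have "inj_on (jordan_prod X) sym_mats"
  proof (rule inj_onI)
    fix A B assume A: "A \<in> sym_mats" and B: "B \<in> sym_mats" and eq: "jordan_prod X A = jordan_prod X B"
    define D where "D = A - B"
    have D: "D \<in> sym_mats" using A B by (simp add: D_def sym_mats_intros)
    have "X ** A + A ** X = X ** B + B ** X"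
      using eq unfolding jordan_prod_def by (simp del: scaleR_add_right)
    then have "X ** D + D ** X = 0" by (simp add: D_def matrix_distribs algebra_simps)
    then have 0: "trace (D ** (X ** D + D ** X)) = 0" by (simp add: trace_def)
    have "trace (D ** (D ** X)) = trace (D ** X ** D)" by (rule trace_mul_sym)
    with 0 have "trace (D ** X ** D) = 0" by (simp add: matrix_distribs trace_add matrix_mul_assoc)
    moreover note trace_congruence[OF D, of X]
    moreover have ge: "0 \<le> w \<bullet> (X *v w)" for w using pd_matsD(2)[OF X, of w] by (cases "w = 0") auto
    ultimately have "\<forall>i. (D *v axis i 1) \<bullet> (X *v (D *v axis i 1)) = 0"
      by (simp add: sum_nonneg_eq_0_iff)
    then have "D *v axis i 1 = 0" for i using pd_matsD(2)[OF X, of "D *v axis i 1"] by force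
    then have "D = 0" by (simp add: matrix_vector_mult_basis column_def vec_eq_iff)
    then show "A = B" by (simp add: D_def)
  qed
  then show ?thesis using Z by (simp add: jordan_prod_inv_def)
qed

lemma lin_part_conj:
  "(\<Sum>i\<in>UNIV. (d $ i) *\<^sub>R (A ** F i ** B)) = A ** lin_part F d ** B"
proof -
  have "linear (\<lambda>Z. A ** Z ** B)" by (rule linearI) (simp_all add: matrix_distribs)
  from linear_sum[OF this, of "\<lambda>i. (d $ i) *\<^sub>R F i" UNIV] show ?thesis
    unfolding lin_part_def by (simp add: matrix_distribs)
qed

text \<open>
  With \<open>P = X\<^sup>-\<^sup>1\<^sup>/\<^sup>2\<close> the scaled primal matrix is the identity, so the
  operator to be inverted is trivial.
\<close>

lemma newton_V_hrvw:
  fixes F0 :: "real^'m^'m" and F :: "'n::finite \<Rightarrow> real^'m^'m" and d x :: "real^'n"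
  assumes X: "pencil F0 F x \<in> pd_mats" and F: "\<And>i. F i \<in> sym_mats" and V: "V \<in> sym_mats"
  defines "X \<equiv> pencil F0 F x" and "L \<equiv> lin_part F d"
  shows "newton_V \<mu> F0 F (hrvw_matrix X) x V d = \<mu> *\<^sub>R matrix_inv X - V 
    - (1/2) *\<^sub>R (V ** L ** matrix_inv X + matrix_inv X ** L ** V)"
proof -
  define R where "R = mat_sqrt X"
  define P where "P = matrix_inv R"
  have R: "R \<in> pd_mats" "R ** R = X" using mat_sqrt_pd X by (auto simp: R_def X_def)
  have RP: "R ** P = mat 1" "P ** R = mat 1" using pd_inv[OF R(1)] by (auto simp: P_def)
  have tP: "transpose P = P" using pd_matrix_inv[OF R(1)] pd_matsD(1) by (auto simp: P_def sym_mats_def)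
  have tR: "transpose R = R" using R pd_matsD(1) by (auto simp: sym_mats_def)
  have iP: "matrix_inv P = R" by (rule matrix_inv_unique[OF RP(2)])
  have "X ** (P ** P) = R ** (R ** P) ** P" by (simp add: R(2)[symmetric] matrix_mul_assoc)
  then have iX: "matrix_inv X = P ** P" by (intro matrix_inv_unique) (simp add: RP)
  have "scale_primal P X = P ** R ** (R ** P)" by (simp add: scale_primal_def tP R(2)[symmetric] matrix_mul_assoc)
  then have sX: "scale_primal P X = mat 1" by (simp add: RP)
  have I: "(mat 1 :: real^'m^'m) \<in> pd_mats" by (simp add: pd_mats_def sym_mats_def)
  have trm: "transpose P ** jordan_prod_inv (scale_primal P X) (jordan_prod (scale_dual P V) (scale_primal P (F i))) ** P
    = (1/2) *\<^sub>R (V ** F i ** matrix_inv X + matrix_inv X ** F i ** V)" for i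
  proof -
    define Z where "Z = jordan_prod (scale_dual P V) (scale_primal P (F i))"
    have tV: "transpose V = V" and tF: "transpose (F i) = F i" using V F by (auto simp: sym_mats_def)
    have Z1: "Z = (1/2) *\<^sub>R (R ** V ** (R ** P) ** F i ** P + P ** F i ** (P ** R) ** V ** R)"
      by (simp add: Z_def jordan_prod_def scale_dual_def scale_primal_def iP tR tP matrix_mul_assoc)
    then have Z2: "Z = (1/2) *\<^sub>R (R ** V ** F i ** P + P ** F i ** V ** R)" by (simp add: RP)
    have "Z \<in> sym_mats"
      by (simp add: sym_mats_def Z2 transpose_scalar transpose_add matrix_transpose_mul tR tP tV tF matrix_mul_assoc add.commute)
    from jordan_prod_inv_eq[OF I this] have "jordan_prod_inv (mat 1) Z = Z"
      by (simp add: jordan_prod_def scaleR_2[symmetric])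
    then have "transpose P ** jordan_prod_inv (scale_primal P X) Z ** P
      = (1/2) *\<^sub>R ((P ** R) ** V ** F i ** (P ** P) + (P ** P) ** F i ** V ** (R ** P))"
      by (simp add: sX tP Z2 matrix_distribs matrix_mul_assoc)
    then show ?thesis by (simp add: RP iX Z_def)
  qed
  have hP: "hrvw_matrix X = P" by (simp add: hrvw_matrix_def P_def R_def)
  have "(\<Sum>i\<in>UNIV. (d $ i) *\<^sub>R ((1/2) *\<^sub>R (V ** F i ** matrix_inv X + matrix_inv X ** F i ** V)))
    = (1/2) *\<^sub>R ((\<Sum>i\<in>UNIV. (d $ i) *\<^sub>R (V ** F i ** matrix_inv X)) + (\<Sum>i\<in>UNIV. (d $ i) *\<^sub>R (matrix_inv X ** F i ** V)))"
    by (simp add: scaleR_sum_right sum.distrib scaleR_add_right scaleR_left_commute)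
  then show ?thesis
    unfolding newton_V_def hP X_def[symmetric] trm by (simp add: lin_part_conj L_def)
qed

text \<open>
  With \<open>W V W = X\<close> and \<open>P = W\<^sup>-\<^sup>1\<^sup>/\<^sup>2\<close> the scaled primal
  and dual matrices coincide, so the two operators cancel and only the congruence by \<open>U =
  W\<^sup>-\<^sup>1\<close> remains.
\<close>

lemma newton_V_nt:
  fixes F0 :: "real^'m^'m" and F :: "'n::finite \<Rightarrow> real^'m^'m" and d x :: "real^'n"
  assumes X: "pencil F0 F x \<in> pd_mats" and F: "\<And>i. F i \<in> sym_mats" and V: "V \<in> pd_mats"
  defines "X \<equiv> pencil F0 F x" and "L \<equiv> lin_part F d"
  obtains U where "U \<in> sym_mats" "U ** X ** U = V" "matrix_inv V = matrix_inv U ** matrix_inv X ** matrix_inv U"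
    "U ** matrix_inv U = mat 1" "matrix_inv U ** U = mat 1"
    "newton_V \<mu> F0 F (nt_matrix X V) x V d = \<mu> *\<^sub>R matrix_inv X - V - U ** L ** U"
proof -
  define R where "R = mat_sqrt X"
  have R: "R \<in> pd_mats" "R ** R = X" using mat_sqrt_pd X by (auto simp: R_def X_def)
  have RVR: "R ** V ** R \<in> pd_mats" using pd_congruence_sym[OF V pd_matsD(1) pd_invertible] R by blast
  define S where "S = mat_sqrt (R ** V ** R)"
  have S: "S \<in> pd_mats" "S ** S = R ** V ** R" using mat_sqrt_pd[OF RVR] by (auto simp: S_def)
  define W where "W = R ** matrix_inv S ** R"
  have W: "W \<in> pd_mats" unfolding W_def
    using pd_congruence_sym[OF pd_matrix_inv[OF S(1)] pd_matsD(1) pd_invertible] R by blast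
  define Q where "Q = mat_sqrt W"
  have Q: "Q \<in> pd_mats" "Q ** Q = W" using mat_sqrt_pd[OF W] by (auto simp: Q_def)
  define P where "P = matrix_inv Q"
  have QP: "Q ** P = mat 1" "P ** Q = mat 1" using pd_inv[OF Q(1)] by (auto simp: P_def)
  have iP: "matrix_inv P = Q" by (rule matrix_inv_unique[OF QP(2)])
  have P: "P \<in> pd_mats" unfolding P_def by (rule pd_matrix_inv[OF Q(1)])
  have tP: "transpose P = P" and tQ: "transpose Q = Q" using P Q pd_matsD(1) by (auto simp: sym_mats_def)
  have "W ** V ** W = R ** matrix_inv S ** (R ** V ** R) ** matrix_inv S ** R"
    by (simp add: W_def matrix_mul_assoc)
  also have "\<dots> = R ** (matrix_inv S ** S) ** (S ** matrix_inv S) ** R"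
    by (simp add: S(2)[symmetric] matrix_mul_assoc)
  also have "\<dots> = X" by (simp add: pd_inv S R)
  finally have WVW: "Q ** Q ** V ** Q ** Q = X" by (simp add: Q(2)[symmetric] matrix_mul_assoc)
  have "scale_primal P X = (P ** Q) ** Q ** V ** Q ** (Q ** P)"
    by (simp add: scale_primal_def tP WVW[symmetric] matrix_mul_assoc)
  then have sX: "scale_primal P X = Q ** V ** Q" by (simp add: QP)
  have sV: "scale_dual P V = Q ** V ** Q" by (simp add: scale_dual_def iP tQ)
  have QVQ: "Q ** V ** Q \<in> pd_mats" using pd_congruence_sym[OF V pd_matsD(1) pd_invertible] Q by blast
  define U where "U = P ** P"
  have "U ** W = P ** (P ** Q) ** Q" by (simp add: U_def Q(2)[symmetric] matrix_mul_assoc)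
  then have UW: "U ** W = mat 1" by (simp add: QP)
  then have iU: "matrix_inv U = W" by (rule matrix_inv_unique)
  have WU: "W ** U = mat 1" using UW matrix_left_right_inverse by blast
  have U: "U \<in> sym_mats" by (simp add: U_def sym_mats_def matrix_transpose_mul tP)
  have WVW': "W ** V ** W = X" using WVW by (simp add: Q(2)[symmetric] matrix_mul_assoc)
  have "U ** X ** U = (U ** W) ** V ** (W ** U)" by (simp add: WVW'[symmetric] matrix_mul_assoc)
  then have UXU: "U ** X ** U = V" by (simp add: UW WU)
  have "V ** (W ** matrix_inv X ** W) = U ** X ** (U ** W) ** matrix_inv X ** W"
    by (simp add: UXU[symmetric] matrix_mul_assoc)
  also have "\<dots> = U ** (X ** matrix_inv X) ** W" by (simp add: UW matrix_mul_assoc)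
  also have "\<dots> = mat 1" using X by (simp add: UW X_def pd_inv)
  finally have iV: "matrix_inv V = W ** matrix_inv X ** W" by (rule matrix_inv_unique)
  have trm: "transpose P ** jordan_prod_inv (scale_primal P X) (jordan_prod (scale_dual P V) (scale_primal P (F i))) ** P
    = U ** F i ** U" for i
  proof -
    have "scale_primal P (F i) \<in> sym_mats"
      using F[of i] by (simp add: scale_primal_def sym_mats_def matrix_transpose_mul matrix_mul_assoc)
    from jordan_prod_inv_eq[OF QVQ this] show ?thesis unfolding sX sV
      by (simp add: tP scale_primal_def U_def matrix_mul_assoc)
  qed
  have nP: "nt_matrix X V = P"
    by (simp add: nt_matrix_def Let_def P_def Q_def W_def S_def R_def)
  have "newton_V \<mu> F0 F (nt_matrix X V) x V d = \<mu> *\<^sub>R matrix_inv X - V - U ** L ** U"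
    unfolding newton_V_def nP X_def[symmetric] trm by (simp add: lin_part_conj L_def)
  with U UXU iV iU UW WU show thesis by (intro that) auto
qed

text \<open>
  What the two scalings have in common: the correction \<open>Z\<close> has the same pairings with
  \<open>X\<close> and \<open>V\<^sup>-\<^sup>1\<close>, and the same bound. For the NT direction the bound
  rests on \<open>c |U v|\<^sup>2 \<le> (U v) \<bullet> X (U v) = v \<bullet> V v\<close>.
\<close>

lemma newton_V_structure:
  fixes F0 :: "real^'m^'m" and F :: "'n::finite \<Rightarrow> real^'m^'m" and d x :: "real^'n"
  assumes X: "pencil F0 F x \<in> pd_mats" and F: "\<And>i. F i \<in> sym_mats" and V: "V \<in> pd_mats"
    and P: "P = hrvw_matrix (pencil F0 F x) \<or> P = nt_matrix (pencil F0 F x) V"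
  defines "X \<equiv> pencil F0 F x" and "L \<equiv> lin_part F d"
  obtains Z where "newton_V \<mu> F0 F P x V d = \<mu> *\<^sub>R matrix_inv X - V - Z" "Z \<in> sym_mats"
    "trace (X ** Z) = trace (L ** V)" "trace (matrix_inv V ** Z) = trace (matrix_inv X ** L)"
    "\<forall>c C K. 0 < c \<longrightarrow> coercive c X \<longrightarrow> op_bound V C \<longrightarrow> op_bound L K \<longrightarrow> op_bound Z (C * K / c)"
  using P
proof
  have L: "L \<in> sym_mats" unfolding L_def lin_part_def
    using F by (intro subspace_sum[OF sym_mats_subspace] sym_mats_intros) auto
  have Xp: "X \<in> pd_mats" using X by (simp add: X_def)
  have Vs: "V \<in> sym_mats" by (rule pd_matsD(1)[OF V])
  have iXs: "matrix_inv X \<in> sym_mats" by (rule pd_matsD(1)[OF pd_matrix_inv[OF Xp]])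
  {
    assume "P = hrvw_matrix (pencil F0 F x)"
    define Z where "Z = (1/2) *\<^sub>R (V ** L ** matrix_inv X + matrix_inv X ** L ** V)"
    have "newton_V \<mu> F0 F P x V d = \<mu> *\<^sub>R matrix_inv X - V - Z"
      unfolding \<open>P = _\<close> Z_def X_def L_def by (rule newton_V_hrvw[OF X F Vs])
    moreover have "Z \<in> sym_mats" using Vs L iXs
      by (simp add: Z_def sym_mats_def transpose_scalar transpose_add matrix_transpose_mul matrix_mul_assoc add.commute)
    moreover have "trace (X ** Z) = trace (L ** V)"
    proof -
      have "trace (X ** (V ** L ** matrix_inv X)) = trace (V ** L ** (matrix_inv X ** X))"
        by (subst trace_mul_sym) (simp add: matrix_mul_assoc)
      then have "trace (X ** (V ** L ** matrix_inv X)) = trace (L ** V)"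
        by (simp add: pd_inv Xp trace_mul_sym[of V L])
      moreover have "X ** (matrix_inv X ** L ** V) = L ** V" by (simp add: matrix_mul_assoc pd_inv Xp)
      ultimately show ?thesis by (simp add: Z_def matrix_distribs trace_scaleR trace_add)
    qed
    moreover have "trace (matrix_inv V ** Z) = trace (matrix_inv X ** L)"
    proof -
      have "trace (matrix_inv V ** (matrix_inv X ** L ** V)) = trace (matrix_inv X ** L ** (V ** matrix_inv V))"
        by (subst trace_mul_sym) (simp add: matrix_mul_assoc)
      then have "trace (matrix_inv V ** (matrix_inv X ** L ** V)) = trace (matrix_inv X ** L)"
        by (simp add: pd_inv V)
      moreover have "matrix_inv V ** (V ** L ** matrix_inv X) = L ** matrix_inv X" by (simp add: matrix_mul_assoc pd_inv V)
      ultimately show ?thesis by (simp add: Z_def matrix_distribs trace_scaleR trace_add trace_mul_sym[of L "matrix_inv X"])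
    qed
    moreover have "op_bound Z (C * K / c)" if "0 < c" "coercive c X" "op_bound V C" "op_bound L K" for c C K
    proof -
      have i: "op_bound (matrix_inv X) (1 / c)" using op_bound_inverse Xp that by blast
      have "op_bound Z (\<bar>1/2\<bar> * (C * K * (1 / c) + 1 / c * K * C))"
        unfolding Z_def using that i by (intro op_bound_scaleR op_bound_add op_bound_mult)
      then show ?thesis by (simp add: mult_ac)
    qed
    ultimately show thesis by (intro that) blast+
  next
    assume P: "P = nt_matrix (pencil F0 F x) V"
    obtain U where U: "U \<in> sym_mats" "U ** X ** U = V" "matrix_inv V = matrix_inv U ** matrix_inv X ** matrix_inv U"
      "U ** matrix_inv U = mat 1" "matrix_inv U ** U = mat 1"
      "newton_V \<mu> F0 F P x V d = \<mu> *\<^sub>R matrix_inv X - V - U ** L ** U"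
      unfolding P X_def L_def by (rule newton_V_nt[OF X F V])
    have "U ** L ** U \<in> sym_mats" using transpose_conj_sym[OF L, of U] U(1) by (simp add: sym_mats_def)
    moreover have "trace (X ** (U ** L ** U)) = trace (L ** V)"
      by (metis U(2) matrix_mul_assoc trace_mul_sym)
    moreover have "trace (matrix_inv V ** (U ** L ** U)) = trace (matrix_inv X ** L)"
    proof -
      have "matrix_inv V ** (U ** L ** U) = matrix_inv U ** matrix_inv X ** (matrix_inv U ** U) ** L ** U"
        by (simp add: U(3) matrix_mul_assoc)
      also have "\<dots> = matrix_inv U ** (matrix_inv X ** L ** U)" by (simp add: U(5) matrix_mul_assoc)
      finally have "trace (matrix_inv V ** (U ** L ** U)) = trace (matrix_inv X ** L ** U ** matrix_inv U)"
        by (simp add: trace_mul_sym[of "matrix_inv U" "matrix_inv X ** L ** U"])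
      then show ?thesis by (simp add: U(4) flip: matrix_mul_assoc)
    qed
    moreover have "op_bound (U ** L ** U) (C * K / c)" if b: "0 < c" "coercive c X" "op_bound V C" "op_bound L K" for c C K
    proof -
      have C: "0 \<le> C" using b by (simp add: op_bound_def)
      have "op_bound U (sqrt (C / c))" unfolding op_bound_def
      proof (intro conjI allI)
        fix v
        have "c * ((U *v v) \<bullet> (U *v v)) \<le> (U *v v) \<bullet> (X *v (U *v v))" using b by (simp add: coercive_def)
        also have "\<dots> = v \<bullet> (V *v v)" by (simp add: U(2)[symmetric] matrix_vector_mul_assoc[symmetric] sym_mats_inner[OF U(1)])
        also have "\<dots> \<le> C * (v \<bullet> v)" using op_bound_quadratic[OF b(3), of v] by linarith
        finally have "(norm (U *v v))\<^sup>2 \<le> (C / c) * (norm v)\<^sup>2" using b by (simp add: power2_norm_eq_inner field_simps)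
        then have "sqrt ((norm (U *v v))\<^sup>2) \<le> sqrt ((C / c) * (norm v)\<^sup>2)" by (rule real_sqrt_le_mono)
        then show "norm (U *v v) \<le> sqrt (C / c) * norm v" by (simp add: real_sqrt_mult real_sqrt_divide)
      qed (use C b in simp)
      then have "op_bound (U ** L ** U) (sqrt (C / c) * K * sqrt (C / c))" using b by (intro op_bound_mult)
      moreover have "sqrt (C / c) * K * sqrt (C / c) = C * K / c"
      proof -
        have "sqrt (C / c) * sqrt (C / c) = C / c" using C b by simp
        then show ?thesis by (metis mult.commute mult.left_commute times_divide_eq_right)
      qed
      ultimately show ?thesis by simp
    qed
    ultimately show thesis using U(6) by (intro that[of "U ** L ** U"]) blast+
  }
qed

section \<open>The primal-dual term and its slope\<close>

text \<open>
  Writing \<open>V = R\<^sup>2\<close>, both traces are sums over \<open>R e\<^sub>i\<close> of quadratic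
  forms. It turns a bound on \<open>tr(X V)\<close> into one on \<open>V\<close>.
\<close>

lemma trace_coercive_product:
  fixes X V :: "real^'m^'m"
  assumes X: "coercive c X" and V: "V \<in> pd_mats"
  shows "c * trace V \<le> trace (X ** V)"
proof -
  define R where "R = mat_sqrt V"
  have R: "R \<in> pd_mats" "R ** R = V" using mat_sqrt_pd[OF V] by (auto simp: R_def)
  have "c * trace V = (\<Sum>i\<in>UNIV. c * ((R *v axis i 1) \<bullet> (R *v axis i 1)))"
    using trace_congruence[OF pd_matsD(1)[OF R(1)], of "mat 1"] by (simp add: R sum_distrib_left)
  also have "\<dots> \<le> (\<Sum>i\<in>UNIV. (R *v axis i 1) \<bullet> (X *v (R *v axis i 1)))"
    using X by (intro sum_mono) (simp add: coercive_def)
  also have "\<dots> = trace (R ** (X ** R))" using trace_congruence[OF pd_matsD(1)[OF R(1)], of X] by (simp add: matrix_mul_assoc)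
  also have "\<dots> = trace (X ** R ** R)" by (rule trace_mul_sym)
  also have "\<dots> = trace (X ** V)" by (simp add: R(2) flip: matrix_mul_assoc)
  finally show ?thesis .
qed

text \<open>
  The eigenvalues lie between zero and \<open>\<eta>\<close>, so those of \<open>A\<^sup>2\<close> are at
  most \<open>\<eta>\<^sup>2\<close>.
\<close>

lemma op_bound_of_psd:
  fixes A :: "real^'m^'m"
  assumes A: "A \<in> sym_mats" and 0: "\<And>v. 0 \<le> v \<bullet> (A *v v)" and e: "\<And>v. v \<bullet> (A *v v) \<le> \<eta> * (v \<bullet> v)" "0 \<le> \<eta>"
  shows "op_bound A \<eta>"
proof -
  obtain Q d where Q: "orthogonal_matrix Q" "A = diag_conj Q d" by (rule spectral_decomposition[OF A])
  have d: "0 \<le> d i" "d i \<le> \<eta>" for i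
  proof -
    have n: "column i Q \<bullet> column i Q = 1" using Q(1) by (simp add: orthogonal_matrix_orthonormal_columns norm_eq_1)
    show "0 \<le> d i" "d i \<le> \<eta>" using 0[of "column i Q"] e(1)[of "column i Q"] n
      by (simp_all add: Q(2) diag_conj_eigen[OF Q(1)])
  qed
  have "norm (A *v v) \<le> \<eta> * norm v" for v
  proof -
    have "(norm (A *v v))\<^sup>2 = v \<bullet> ((A ** A) *v v)"
      by (simp add: power2_norm_eq_inner sym_mats_inner[OF A] matrix_vector_mul_assoc)
    also have "\<dots> = (\<Sum>i\<in>UNIV. d i * d i * (v \<bullet> column i Q)\<^sup>2)"
      by (simp add: Q(2) diag_conj_mult Q(1) diag_conj_quadratic)
    also have "\<dots> \<le> (\<Sum>i\<in>UNIV. \<eta> * \<eta> * (v \<bullet> column i Q)\<^sup>2)"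
      using d e(2) by (intro sum_mono mult_right_mono mult_mono) auto
    also have "\<dots> = (\<eta> * norm v)\<^sup>2"
      by (simp add: sum_distrib_left[symmetric] orthogonal_matrix_parseval Q(1) power_mult_distrib power2_norm_eq_inner) (simp add: power2_eq_square)
    finally show ?thesis by (rule power2_le_imp_le) (simp add: e)
  qed
  then show ?thesis using e(2) by (simp add: op_bound_def)
qed

lemma pd_quadratic_le_trace:
  fixes A :: "real^'m^'m"
  assumes A: "A \<in> pd_mats"
  shows "v \<bullet> (A *v v) \<le> trace A * (v \<bullet> v)" "0 \<le> trace A"
proof -
  obtain Q d where Q: "orthogonal_matrix Q" "A = diag_conj Q d" and d: "\<And>i. 0 < d i"
    using pd_spectral_decomposition[OF A] by blast
  show "0 \<le> trace A" using d by (simp add: Q diag_conj_trace sum_nonneg less_imp_le)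
  have "d i \<le> trace A" for i using d unfolding Q(2) diag_conj_trace[OF Q(1)]
    by (intro member_le_sum) (auto simp: less_imp_le)
  then have "v \<bullet> (A *v v) \<le> (\<Sum>i\<in>UNIV. trace A * (v \<bullet> column i Q)\<^sup>2)"
    unfolding Q(2) diag_conj_quadratic[OF Q(1)] by (intro sum_mono mult_right_mono) (auto simp: Q(2))
  then show "v \<bullet> (A *v v) \<le> trace A * (v \<bullet> v)"
    by (simp add: sum_distrib_left[symmetric] orthogonal_matrix_parseval Q(1))
qed

lemma pd_op_bound_trace:
  fixes A :: "real^'m^'m"
  assumes A: "A \<in> pd_mats"
  shows "op_bound A (trace A)"
proof (rule op_bound_of_psd)
  show "0 \<le> v \<bullet> (A *v v)" for v using pd_matsD(2)[OF A, of v] by (cases "v = 0") auto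
qed (use pd_quadratic_le_trace[OF A] pd_matsD(1)[OF A] in auto)

lemma pd_coercive:
  fixes A :: "real^'m^'m"
  assumes A: "A \<in> pd_mats" obtains c where "0 < c" "coercive c A"
  by (rule uniformly_coercive[of "{A}" "det A"]) (use A pd_det_pos in auto)

text \<open>
  On eigenvalues: \<open>\<mu> ln d = \<mu> ln (d / 2\<mu>) + \<mu> ln 2\<mu> \<le> d / 2 - \<mu> + \<mu> ln
  2\<mu>\<close>. Only half of the trace is spent, so \<open>\<psi>\<close> still dominates the other half
  of \<open>tr(X V)\<close>.
\<close>

lemma ln_det_product_le:
  fixes X V :: "real^'m^'m"
  assumes X: "X \<in> pd_mats" and V: "V \<in> pd_mats" and \<mu>: "0 < \<mu>"
  shows "\<mu> * ln (det (X ** V)) \<le> trace (X ** V) / 2 - real CARD('m) * \<mu> * (1 - ln (2 * \<mu>))"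
proof -
  obtain R R' Q d where "R \<in> sym_mats" and R: "R ** R' = mat 1" "R' ** R = mat 1" and "R ** R = X"
    and Q: "orthogonal_matrix Q" and XV: "X ** V = R ** diag_conj Q d ** R'"
    and d': "V \<in> pd_mats \<longrightarrow> (\<forall>i. 0 < d i)"
    by (rule pd_product_similar[OF X pd_matsD(1)[OF V]])
  from d' V have d: "0 < d i" for i by blast
  have "det R * det R' = 1" by (metis R(1) det_I det_mul)
  then have "det (X ** V) = (\<Prod>i\<in>UNIV. d i)" by (simp add: XV det_mul diag_conj_det Q algebra_simps)
  then have "\<mu> * ln (det (X ** V)) = (\<Sum>i\<in>UNIV. \<mu> * ln (d i))" 
    using d by (simp add: ln_prod less_imp_neq[symmetric] sum_distrib_left)
  also have "\<dots> \<le> (\<Sum>i\<in>UNIV. d i / 2 - \<mu> * (1 - ln (2 * \<mu>)))"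
  proof (rule sum_mono)
    fix i
    have "ln (d i / (2 * \<mu>)) \<le> d i / (2 * \<mu>) - 1" using d \<mu> by (intro ln_le_minus_one) simp
    then have "ln (d i) - ln (2 * \<mu>) \<le> d i / (2 * \<mu>) - 1" using d[of i] \<mu> by (simp add: ln_div)
    then have "\<mu> * (ln (d i) - ln (2 * \<mu>)) \<le> \<mu> * (d i / (2 * \<mu>) - 1)" using \<mu> by (intro mult_left_mono) auto
    then show "\<mu> * ln (d i) \<le> d i / 2 - \<mu> * (1 - ln (2 * \<mu>))" using \<mu> by (simp add: algebra_simps)
  qed
  also have "\<dots> = trace (X ** V) / 2 - real CARD('m) * \<mu> * (1 - ln (2 * \<mu>))"
    by (simp add: XV trace_similar R diag_conj_trace Q sum_subtractf sum_divide_distrib)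
  finally show ?thesis .
qed

lemma pencil_add_scaled: "pencil F0 F (x + t *\<^sub>R d) = pencil F0 F x + t *\<^sub>R lin_part F d"
  by (simp add: pencil_def lin_part_def scaleR_sum_right scaleR_add_left sum.distrib algebra_simps)

lemma linear_lin_part: "linear (lin_part F)"
  by (rule linearI) (simp_all add: lin_part_def scaleR_add_left sum.distrib scaleR_sum_right)

lemma lin_part_sym: "(\<And>i. F i \<in> sym_mats) \<Longrightarrow> lin_part F d \<in> sym_mats"
  unfolding lin_part_def by (intro subspace_sum[OF sym_mats_subspace] sym_mats_intros)

lemma lin_part_op_bound:
  fixes F :: "'n::finite \<Rightarrow> real^'m^'m"
  obtains \<kappa> where "0 < \<kappa>" "\<And>d. op_bound (lin_part F d) (\<kappa> * norm d)"
proof -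
  have "bounded_linear (lin_part F)" using linear_lin_part linear_conv_bounded_linear by blast
  then obtain K where K: "0 < K" "\<And>d. norm (lin_part F d) \<le> norm d * K"
    using bounded_linear.pos_bounded by blast
  have "op_bound (lin_part F d) (real CARD('m) * real CARD('m) * K * norm d)" for d
    using K(2)[of d] by (intro op_bound_mono[OF op_bound_norm]) (simp add: mult_ac)
  then show thesis using that[of "real CARD('m) * real CARD('m) * K"] K(1) by simp
qed

lemma xi_inner: "xi F0 F x \<bullet> d = trace (matrix_inv (pencil F0 F x) ** lin_part F d)"
proof -
  let ?Y = "matrix_inv (pencil F0 F x)"
  have "linear (\<lambda>Z. trace (?Y ** Z))" by (rule linearI) (simp_all add: matrix_distribs trace_add trace_scaleR)
  from linear_sum[OF this, of "\<lambda>i. (d $ i) *\<^sub>R F i" UNIV]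
  have "trace (?Y ** lin_part F d) = (\<Sum>i\<in>UNIV. trace (?Y ** ((d $ i) *\<^sub>R F i)))" by (simp add: lin_part_def)
  also have "\<dots> = (\<Sum>i\<in>UNIV. d $ i * trace (?Y ** F i))" by (simp add: matrix_distribs trace_scaleR)
  finally show ?thesis by (simp add: xi_def inner_vec_def mat_inner_def trace_mul_sym[of _ ?Y] mult.commute)
qed

definition psi_slope :: "real \<Rightarrow> real^'m^'m \<Rightarrow> real^'m^'m \<Rightarrow> real^'m^'m \<Rightarrow> real^'m^'m \<Rightarrow> real" where
  "psi_slope \<mu> X V L D = trace (L ** V) + trace (X ** D) - \<mu> * trace (matrix_inv X ** L) - \<mu> * trace (matrix_inv V ** D)"

lemma psi_eq:
  assumes "pencil F0 F x \<in> pd_mats" "V \<in> pd_mats"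
  shows "psi \<mu> F0 F (x, V) = trace (pencil F0 F x ** V) - \<mu> * (ln (det (pencil F0 F x)) + ln (det V))"
  using assms pd_det_pos[OF assms(1)] pd_det_pos[OF assms(2)] by (simp add: psi_def mat_inner_def det_mul ln_mult)

text \<open>
  The trace part is a polynomial of degree two in \<open>t\<close>; the two log-determinants are covered by
  \<open>ln_det_expansion\<close>. Again the error constant depends on the data through \<open>c\<close> and
  \<open>K\<close> only.
\<close>

lemma psi_expansion:
  fixes F0 V D :: "real^'m^'m" and F :: "'n::finite \<Rightarrow> real^'m^'m" and x d :: "real^'n" and c K t \<mu> :: real
  assumes F: "F0 \<in> sym_mats" "\<And>i. F i \<in> sym_mats" and V: "V \<in> sym_mats" and D: "D \<in> sym_mats"
    and c: "0 < c" "coercive c (pencil F0 F x)" "coercive c V"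
    and K: "op_bound (lin_part F d) K" "op_bound D K" and \<mu>: "0 \<le> \<mu>" and t: "0 \<le> t" "t * K \<le> c / 2"
  shows "\<bar>psi \<mu> F0 F (x + t *\<^sub>R d, V + t *\<^sub>R D) - psi \<mu> F0 F (x, V) - t * psi_slope \<mu> (pencil F0 F x) V (lin_part F d) D\<bar>
    \<le> t\<^sup>2 * (real CARD('m) * K\<^sup>2 + 2 * \<mu> * (2 * real CARD('m) * K\<^sup>2 / c\<^sup>2))"
proof -
  define X where "X = pencil F0 F x"
  define L where "L = lin_part F d"
  have Ls: "L \<in> sym_mats" unfolding L_def using F by (intro lin_part_sym)
  have Xs: "X \<in> sym_mats" unfolding X_def pencil_def using F by (intro sym_mats_intros lin_part_sym)
  have pd: "X \<in> pd_mats" "V \<in> pd_mats" using coercive_pd Xs V c by (auto simp: X_def)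
  let ?E = "2 * real CARD('m) * K\<^sup>2 / c\<^sup>2"
  note LX = ln_det_expansion[OF Xs _ c(1) Ls _ t, folded X_def L_def, OF c(2)[folded X_def] K(1)[folded L_def]]
  note LV = ln_det_expansion[OF V c(3) c(1) D K(2) t]
  have p0: "psi \<mu> F0 F (x, V) = trace (X ** V) - \<mu> * (ln (det X) + ln (det V))"
    using psi_eq pd by (simp add: X_def)
  have p1: "psi \<mu> F0 F (x + t *\<^sub>R d, V + t *\<^sub>R D)
    = trace ((X + t *\<^sub>R L) ** (V + t *\<^sub>R D)) - \<mu> * (ln (det (X + t *\<^sub>R L)) + ln (det (V + t *\<^sub>R D)))"
    using psi_eq[of F0 F "x + t *\<^sub>R d" "V + t *\<^sub>R D"] LX(1) LV(1) by (simp add: pencil_add_scaled X_def L_def)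
  have tr: "trace ((X + t *\<^sub>R L) ** (V + t *\<^sub>R D)) = trace (X ** V) + t * (trace (L ** V) + trace (X ** D)) + t\<^sup>2 * trace (L ** D)"
    by (simp add: matrix_distribs trace_add trace_scaleR power2_eq_square algebra_simps)
  have "\<bar>trace (L ** D)\<bar> \<le> real CARD('m) * (K * K)"
    using K by (intro op_bound_trace op_bound_mult) (auto simp: L_def)
  then have t1: "\<bar>t\<^sup>2 * trace (L ** D)\<bar> \<le> t\<^sup>2 * (real CARD('m) * K\<^sup>2)"
    by (simp add: abs_mult power2_eq_square mult_left_mono)
  define a where "a = ln (det (X + t *\<^sub>R L)) - ln (det X) - t * trace (matrix_inv X ** L)"
  define b where "b = ln (det (V + t *\<^sub>R D)) - ln (det V) - t * trace (matrix_inv V ** D)"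
  have ab: "\<bar>a\<bar> \<le> t\<^sup>2 * ?E" "\<bar>b\<bar> \<le> t\<^sup>2 * ?E" unfolding a_def b_def using LX(2,3) LV(2,3) by linarith+
  have "\<bar>a + b\<bar> \<le> t\<^sup>2 * ?E + t\<^sup>2 * ?E"
    using abs_triangle_ineq[of a b] add_mono[OF ab] by (rule order_trans)
  then have "\<bar>\<mu> * (a + b)\<bar> \<le> \<mu> * (t\<^sup>2 * ?E + t\<^sup>2 * ?E)"
    unfolding abs_mult abs_of_nonneg[OF \<mu>] using \<mu> by (rule mult_left_mono)
  moreover have "psi \<mu> F0 F (x + t *\<^sub>R d, V + t *\<^sub>R D) - psi \<mu> F0 F (x, V) - t * psi_slope \<mu> X V L D
    = t\<^sup>2 * trace (L ** D) - \<mu> * (a + b)"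
    unfolding p0 p1 tr psi_slope_def a_def b_def by (simp add: algebra_simps)
  moreover have "\<mu> * (t\<^sup>2 * ?E + t\<^sup>2 * ?E) = t\<^sup>2 * (2 * \<mu> * ?E)" by (simp add: algebra_simps)
  ultimately show ?thesis using t1 unfolding X_def[symmetric] L_def[symmetric] distrib_left by linarith
qed

lemma dir_deriv_psi:
  fixes F0 V D :: "real^'m^'m" and F :: "'n::finite \<Rightarrow> real^'m^'m" and x d :: "real^'n" and \<mu> :: real
  assumes F: "F0 \<in> sym_mats" "\<And>i. F i \<in> sym_mats" and X: "pencil F0 F x \<in> pd_mats"
    and V: "V \<in> pd_mats" and D: "D \<in> sym_mats" and \<mu>: "0 \<le> \<mu>"
  shows "dir_deriv (psi \<mu> F0 F) (x, V) (d, D) = psi_slope \<mu> (pencil F0 F x) V (lin_part F d) D"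
proof -
  obtain c1 where c1: "0 < c1" "coercive c1 (pencil F0 F x)" by (rule pd_coercive[OF X])
  obtain c2 where c2: "0 < c2" "coercive c2 V" by (rule pd_coercive[OF V])
  define c where "c = min c1 c2"
  have mono: "coercive c A" if "coercive c' A" "c \<le> c'" for c' and A :: "real^'m^'m"
    using that unfolding coercive_def by (meson inner_ge_zero mult_right_mono order_trans)
  have c: "0 < c" "coercive c (pencil F0 F x)" "coercive c V"
    using c1 c2 by (auto simp: c_def intro: mono[unfolded c_def])
  define m where "m = real CARD('m) * real CARD('m)"
  define K where "K = m * norm (lin_part F d) + m * norm D + 1"
  have m: "0 \<le> m" by (simp add: m_def)
  have Kp: "0 < K" unfolding K_def using m by (smt (verit) mult_nonneg_nonneg norm_ge_zero)
  have K: "op_bound (lin_part F d) K" "op_bound D K"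
  proof -
    have "0 \<le> m * norm (lin_part F d)" "0 \<le> m * norm D" using m by simp_all
    then have "m * norm (lin_part F d) \<le> K" "m * norm D \<le> K" unfolding K_def by linarith+
    then show "op_bound (lin_part F d) K" "op_bound D K"
      unfolding m_def by (auto intro: op_bound_mono[OF op_bound_norm])
  qed
  define E where "E = real CARD('m) * K\<^sup>2 + 2 * \<mu> * (2 * real CARD('m) * K\<^sup>2 / c\<^sup>2)"
  let ?p = "\<lambda>t. (psi \<mu> F0 F ((x, V) + t *\<^sub>R (d, D)) - psi \<mu> F0 F (x, V)) / t"
  let ?s = "psi_slope \<mu> (pencil F0 F x) V (lin_part F d) D"
  have "(?p \<longlongrightarrow> ?s) (at_right 0)"
  proof (rule LIM_zero_cancel, rule Lim_null_comparison)
    show "((\<lambda>t. t * E) \<longlongrightarrow> 0) (at_right 0)" by (auto intro!: tendsto_eq_intros)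
    have "\<forall>\<^sub>F t in at_right (0::real). t \<in> {0<..<c / (2 * K)}"
      using c Kp by (intro eventually_at_right_real) simp
    then show "\<forall>\<^sub>F t in at_right 0. norm (?p t - ?s) \<le> t * E"
    proof eventually_elim
      case (elim t)
      then have t: "0 < t" "t * K \<le> c / 2" using Kp by (auto simp: field_simps)
      have "\<bar>psi \<mu> F0 F (x + t *\<^sub>R d, V + t *\<^sub>R D) - psi \<mu> F0 F (x, V) - t * ?s\<bar> \<le> t\<^sup>2 * E"
        unfolding E_def using t by (intro psi_expansion F pd_matsD(1)[OF V] D c K \<mu>) auto
      then have "\<bar>psi \<mu> F0 F (x + t *\<^sub>R d, V + t *\<^sub>R D) - psi \<mu> F0 F (x, V) - t * ?s\<bar> / t \<le> t * E"
        using t by (simp add: field_simps power2_eq_square)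
      moreover have "?p t - ?s = (psi \<mu> F0 F (x + t *\<^sub>R d, V + t *\<^sub>R D) - psi \<mu> F0 F (x, V) - t * ?s) / t"
        using t by (simp add: field_simps)
      ultimately show ?case using t by simp
    qed
  qed
  then show ?thesis unfolding dir_deriv_def by (intro tendsto_Lim) auto
qed

text \<open>
  The terms containing the primal direction cancel because of the two trace identities of
  \<open>newton_V_structure\<close>; what remains depends on \<open>X\<close> and \<open>V\<close> alone.
\<close>

lemma psi_slope_newton:
  fixes F0 V :: "real^'m^'m" and F :: "'n::finite \<Rightarrow> real^'m^'m" and x d :: "real^'n" and \<mu> :: real
  assumes X: "pencil F0 F x \<in> pd_mats" and F: "\<And>i. F i \<in> sym_mats" and V: "V \<in> pd_mats"
    and P: "P = hrvw_matrix (pencil F0 F x) \<or> P = nt_matrix (pencil F0 F x) V"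
  shows "psi_slope \<mu> (pencil F0 F x) V (lin_part F d) (newton_V \<mu> F0 F P x V d) = - centrality_gap \<mu> (pencil F0 F x) V"
    and "newton_V \<mu> F0 F P x V d \<in> sym_mats"
proof -
  define X' where "X' = pencil F0 F x"
  define L where "L = lin_part F d"
  obtain Z where Z: "newton_V \<mu> F0 F P x V d = \<mu> *\<^sub>R matrix_inv X' - V - Z" "Z \<in> sym_mats"
    "trace (X' ** Z) = trace (L ** V)" "trace (matrix_inv V ** Z) = trace (matrix_inv X' ** L)"
    "\<forall>c C K. 0 < c \<longrightarrow> coercive c X' \<longrightarrow> op_bound V C \<longrightarrow> op_bound L K \<longrightarrow> op_bound Z (C * K / c)"
    unfolding X'_def L_def by (rule newton_V_structure[OF X F V P])
  show "newton_V \<mu> F0 F P x V d \<in> sym_mats" unfolding Z(1)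
    using Z(2) pd_matsD(1)[OF V] pd_matsD(1)[OF pd_matrix_inv[OF X]] by (intro sym_mats_intros) (auto simp: X'_def)
  show "psi_slope \<mu> (pencil F0 F x) V (lin_part F d) (newton_V \<mu> F0 F P x V d) = - centrality_gap \<mu> (pencil F0 F x) V"
    unfolding X'_def[symmetric] L_def[symmetric] Z(1) psi_slope_def centrality_gap_def matrix_distribs trace_sub trace_scaleR Z(3,4)
    using X V by (simp add: X'_def pd_inv trace_I power2_eq_square algebra_simps)
qed

section \<open>Signed measures on a compact metric space\<close>

lemma borel_subsets_iff:
  fixes T :: "'t::metric_space set"
  assumes "compact T"
  shows "A \<in> borel_subsets T \<longleftrightarrow> A \<in> sets borel \<and> A \<subseteq> T"
  using assms unfolding borel_subsets_def
  by (subst sets_restrict_space_iff) (auto intro: borel_closed compact_imp_closed)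

lemma sigma_algebra_borel_subsets: "sigma_algebra T (borel_subsets T)"
  unfolding borel_subsets_def using sets.sigma_algebra_axioms[of "restrict_space borel T"]
  by (simp add: space_restrict_space)

lemma openin_borel_subsets:
  fixes T :: "'t::metric_space set"
  assumes T: "compact T" and U: "openin (top_of_set T) U"
  shows "U \<in> borel_subsets T"
proof -
  obtain O' where "open O'" "U = T \<inter> O'" using U by (auto simp: openin_open)
  moreover have "T \<in> sets borel" using T by (intro borel_closed compact_imp_closed)
  ultimately show ?thesis using T by (simp add: borel_subsets_iff sets.Int)
qed

lemma compact_borel_subsets:
  fixes T :: "'t::metric_space set"
  assumes T: "compact T" and K: "compact K" "K \<subseteq> T"
  shows "K \<in> borel_subsets T"
  using assms by (auto simp: borel_subsets_iff intro: borel_closed compact_imp_closed)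

lemma borel_subsets_intros:
  fixes T :: "'t::metric_space set"
  assumes "compact T" "A \<in> borel_subsets T"
  shows "{} \<in> borel_subsets T" "T \<in> borel_subsets T"
    "B \<in> borel_subsets T \<Longrightarrow> A \<union> B \<in> borel_subsets T"
    "B \<in> borel_subsets T \<Longrightarrow> A - B \<in> borel_subsets T"
    "B \<in> borel_subsets T \<Longrightarrow> A \<inter> B \<in> borel_subsets T"
  using assms by (auto simp: borel_subsets_iff intro: borel_closed compact_imp_closed)

lemma empty_borel_subsets: "{} \<in> borel_subsets T"
  by (simp add: borel_subsets_def)

locale compact_signed =
  fixes T :: "'t::metric_space set" and y :: "'t set \<Rightarrow> real"
  assumes compact: "compact T" and signed: "y \<in> signed_measures T"
begin

lemma empty: "y {} = 0" using signed by (simp add: signed_measures_def)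

lemma sums: "range A \<subseteq> borel_subsets T \<Longrightarrow> disjoint_family A \<Longrightarrow> (\<lambda>i::nat. y (A i)) sums y (\<Union>i. A i)"
  using signed by (simp add: signed_measures_def)

lemma regular:
  assumes "A \<in> borel_subsets T" "0 < e"
  obtains K U where "compact K" "openin (top_of_set T) U" "K \<subseteq> A" "A \<subseteq> U"
    "\<forall>B\<in>borel_subsets T. B \<subseteq> U - K \<longrightarrow> \<bar>y B\<bar> < e"
  using signed assms unfolding signed_measures_def mem_Collect_eq by meson

lemma add:
  assumes A: "A \<in> borel_subsets T" and B: "B \<in> borel_subsets T" and d: "A \<inter> B = {}"
  shows "y (A \<union> B) = y A + y B"
proof -
  have "(\<lambda>i. y (binaryset A B i)) sums y (\<Union>i. binaryset A B i)"
    using A B d empty_borel_subsets[of T]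
    by (intro sums) (auto simp: range_binaryset_eq disjoint_family_on_def binaryset_def)
  moreover have "(\<lambda>i. y (binaryset A B i)) sums (y A + y B)" by (rule binaryset_sums) (rule empty)
  ultimately show ?thesis by (simp add: UN_binaryset_eq sums_unique2)
qed

lemma diff:
  assumes "A \<in> borel_subsets T" "B \<in> borel_subsets T" "B \<subseteq> A"
  shows "y (A - B) = y A - y B"
  using add[of B "A - B"] assms borel_subsets_intros[OF compact, of A] by (simp add: Un_absorb1)

text \<open>
  By regularity every point has a relatively open neighbourhood on which, apart from the mass of the point
  itself, all values of \<open>y\<close> are below one in modulus; finitely many of these neighbourhoods
  cover the compact set.
\<close>

lemma bounded_values: obtains M where "\<And>A. A \<in> borel_subsets T \<Longrightarrow> \<bar>y A\<bar> \<le> M"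
proof -
  define good where "good U \<longleftrightarrow> U \<in> borel_subsets T \<and> (\<exists>M. \<forall>B\<in>borel_subsets T. B \<subseteq> U \<longrightarrow> \<bar>y B\<bar> \<le> M)" for U
  have nb: "\<exists>U. openin (top_of_set T) U \<and> \<tau> \<in> U \<and> good U" if \<tau>: "\<tau> \<in> T" for \<tau>
  proof -
    have s: "{\<tau>} \<in> borel_subsets T" using \<tau> by (intro compact_borel_subsets compact) auto
    obtain K U where KU: "compact K" "openin (top_of_set T) U" "K \<subseteq> {\<tau>}" "{\<tau>} \<subseteq> U"
      "\<forall>B\<in>borel_subsets T. B \<subseteq> U - K \<longrightarrow> \<bar>y B\<bar> < 1"
      by (rule regular[OF s zero_less_one])
    have "\<bar>y B\<bar> \<le> 1 + \<bar>y {\<tau>}\<bar>" if B: "B \<in> borel_subsets T" "B \<subseteq> U" for B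
    proof -
      have 1: "B \<inter> {\<tau>} \<in> borel_subsets T" "B - {\<tau>} \<in> borel_subsets T" 
        using borel_subsets_intros[OF compact B(1)] s by auto
      have "y B = y ((B \<inter> {\<tau>}) \<union> (B - {\<tau>}))" by (simp add: Int_Diff_Un)
      also have "\<dots> = y (B \<inter> {\<tau>}) + y (B - {\<tau>})" using 1 by (intro add) auto
      finally have "y B = y (B \<inter> {\<tau>}) + y (B - {\<tau>})" .
      moreover have "\<bar>y (B - {\<tau>})\<bar> < 1" using B KU(3) 1 KU(5) by auto
      moreover have "\<bar>y (B \<inter> {\<tau>})\<bar> \<le> \<bar>y {\<tau>}\<bar>" by (cases "\<tau> \<in> B") (auto simp: empty)
      ultimately show ?thesis by linarith
    qed
    then have "good U" unfolding good_def using openin_borel_subsets[OF compact KU(2)] by blast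
    with KU show ?thesis by blast
  qed
  have un: "good (U \<union> U')" if U: "good U" "good U'" for U U'
  proof -
    obtain M M' where M: "\<And>B. B \<in> borel_subsets T \<Longrightarrow> B \<subseteq> U \<Longrightarrow> \<bar>y B\<bar> \<le> M" 
      "\<And>B. B \<in> borel_subsets T \<Longrightarrow> B \<subseteq> U' \<Longrightarrow> \<bar>y B\<bar> \<le> M'" 
      and b: "U \<in> borel_subsets T" "U' \<in> borel_subsets T" using U unfolding good_def by blast
    have "\<bar>y B\<bar> \<le> M + M'" if B: "B \<in> borel_subsets T" "B \<subseteq> U \<union> U'" for B
    proof -
      have 1: "B \<inter> U \<in> borel_subsets T" "B - U \<in> borel_subsets T" 
        using borel_subsets_intros[OF compact B(1)] b by auto
      have "y B = y ((B \<inter> U) \<union> (B - U))" by (simp add: Int_Diff_Un)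
      also have "\<dots> = y (B \<inter> U) + y (B - U)" using 1 by (intro add) auto
      finally show ?thesis using M(1)[OF 1(1)] M(2)[OF 1(2)] B(2) by fastforce
    qed
    then show ?thesis using b borel_subsets_intros[OF compact b(1)] unfolding good_def by blast
  qed
  define C where "C = {U. openin (top_of_set T) U \<and> good U}"
  have "T \<subseteq> \<Union> C" using nb by (auto simp: C_def)
  then obtain D where D: "D \<subseteq> C" "finite D" "T \<subseteq> \<Union> D"
    using compact unfolding compact_eq_openin_cover C_def by (metis (no_types, lifting) mem_Collect_eq)
  have "good (\<Union> D)" using D(2,1)
  proof (induction D rule: finite_induct)
    case empty
    show ?case unfolding good_def using empty_borel_subsets[of T] by (auto simp: local.empty)
  next
    case (insert U D)
    then show ?case using un[of U "\<Union> D"] by (auto simp: C_def)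
  qed
  then obtain M where "\<And>B. B \<in> borel_subsets T \<Longrightarrow> B \<subseteq> \<Union> D \<Longrightarrow> \<bar>y B\<bar> \<le> M" unfolding good_def by blast
  then show thesis using D(3) borel_subsets_iff[OF compact] by (intro that[of M]) blast
qed

text \<open>
  The upper variation, that is, the set function from which \<open>pos_part\<close> is built.
\<close>

definition var :: "'t set \<Rightarrow> real" where
  "var A = (SUP B\<in>{B \<in> borel_subsets T. B \<subseteq> A}. y B)"

lemma var_upper: "B \<in> borel_subsets T \<Longrightarrow> B \<subseteq> A \<Longrightarrow> y B \<le> var A"
proof -
  assume B: "B \<in> borel_subsets T" "B \<subseteq> A"
  obtain M where "\<And>A. A \<in> borel_subsets T \<Longrightarrow> \<bar>y A\<bar> \<le> M" using bounded_values by blast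
  then have "bdd_above (y ` {B \<in> borel_subsets T. B \<subseteq> A})" unfolding bdd_above_def by (auto intro!: exI[of _ M] dest: abs_le_D1)
  then show ?thesis unfolding var_def using B by (intro cSUP_upper) auto
qed

lemma var_least: "(\<And>B. B \<in> borel_subsets T \<Longrightarrow> B \<subseteq> A \<Longrightarrow> y B \<le> c) \<Longrightarrow> var A \<le> c"
  unfolding var_def using empty_borel_subsets[of T] by (intro cSUP_least) auto

lemma var_nonneg: "0 \<le> var A"
  using var_upper[of "{}" A] empty_borel_subsets[of T] by (simp add: empty)

lemma var_mono: "A \<subseteq> B \<Longrightarrow> var A \<le> var B"
  by (intro var_least var_upper) auto

lemma var_superadd:
  assumes "A \<inter> B = {}"
  shows "var A + var B \<le> var (A \<union> B)"
proof -
  have "var B \<le> var (A \<union> B) - y A'" if A': "A' \<in> borel_subsets T" "A' \<subseteq> A" for A'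
  proof (rule var_least)
    fix B' assume B': "B' \<in> borel_subsets T" "B' \<subseteq> B"
    have "y A' + y B' = y (A' \<union> B')" using A' B' assms by (intro add[symmetric]) auto
    also have "\<dots> \<le> var (A \<union> B)" using A' B' borel_subsets_intros[OF compact A'(1)] by (intro var_upper) auto
    finally show "y B' \<le> var (A \<union> B) - y A'" by simp
  qed
  then have "var A \<le> var (A \<union> B) - var B" by (intro var_least) (simp add: algebra_simps)
  then show ?thesis by simp
qed

text \<open>
  Superadditivity gives the lower estimate for partial sums; for the upper one a subset of the union is cut
  along the \<open>A\<^sub>i\<close>.
\<close>

lemma var_sums:
  assumes A: "range A \<subseteq> borel_subsets T" "disjoint_family A"
  shows "(\<lambda>i::nat. var (A i)) sums var (\<Union>i. A i)"
proof -
  have part: "(\<Sum>i<n. var (A i)) \<le> var (\<Union>i<n. A i)" for n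
  proof (induction n)
    case 0 then show ?case using var_nonneg by simp
  next
    case (Suc n)
    have "A i \<inter> A n = {}" if "i < n" for i using A(2) that by (simp add: disjoint_family_on_def)
    then have "(\<Union>i<n. A i) \<inter> A n = {}" by blast
    from var_superadd[OF this] Suc show ?case by (simp add: lessThan_Suc Un_commute)
  qed
  have bd: "(\<Sum>i<n. var (A i)) \<le> var (\<Union>i. A i)" for n
    by (rule order_trans[OF part var_mono]) blast
  have summ: "summable (\<lambda>i. var (A i))" using bd var_nonneg by (intro summableI_nonneg_bounded) 
  have "suminf (\<lambda>i. var (A i)) \<le> var (\<Union>i. A i)" using bd summ by (intro suminf_le_const)
  moreover have "var (\<Union>i. A i) \<le> suminf (\<lambda>i. var (A i))"
  proof (rule var_least)
    fix B assume B: "B \<in> borel_subsets T" "B \<subseteq> (\<Union>i. A i)"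
    have "(\<lambda>i. y (B \<inter> A i)) sums y (\<Union>i. B \<inter> A i)"
      using A B borel_subsets_intros(5)[OF compact B(1)] by (intro sums) (auto simp: disjoint_family_on_def)
    moreover have "(\<Union>i. B \<inter> A i) = B" using B(2) by blast
    ultimately have s: "(\<lambda>i. y (B \<inter> A i)) sums y B" by simp
    then have "y B = suminf (\<lambda>i. y (B \<inter> A i))" by (rule sums_unique)
    also have "\<dots> \<le> suminf (\<lambda>i. var (A i))"
      using A B borel_subsets_intros(5)[OF compact B(1)] s summ by (intro suminf_le var_upper) (auto simp: sums_iff)
    finally show "y B \<le> suminf (\<lambda>i. var (A i))" .
  qed
  ultimately show ?thesis using summ by (simp add: sums_iff)
qed

lemma pos_part_eq: "pos_part T y = measure_of T (borel_subsets T) (\<lambda>A. ennreal (var A))"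
  by (simp add: pos_part_def var_def)

lemma sets_pos_part: "sets (pos_part T y) = borel_subsets T"
  and space_pos_part: "space (pos_part T y) = T"
proof -
  interpret sigma_algebra T "borel_subsets T" by (rule sigma_algebra_borel_subsets)
  show "sets (pos_part T y) = borel_subsets T" "space (pos_part T y) = T"
    unfolding pos_part_eq by (simp_all add: space_measure_of_conv)
qed

lemma emeasure_pos_part: "A \<in> borel_subsets T \<Longrightarrow> emeasure (pos_part T y) A = ennreal (var A)"
  unfolding pos_part_eq
proof (rule emeasure_measure_of_sigma[OF sigma_algebra_borel_subsets])
  have "var {} = 0" using var_least[of "{}" 0] var_nonneg[of "{}"] by (auto simp: empty)
  then show "positive (borel_subsets T) (\<lambda>A. ennreal (var A))" by (simp add: positive_def)
  show "countably_additive (borel_subsets T) (\<lambda>A. ennreal (var A))"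
    unfolding countably_additive_def
  proof (intro allI impI)
    fix A :: "nat \<Rightarrow> 't set" assume A: "range A \<subseteq> borel_subsets T" "disjoint_family A"
    from var_sums[OF this] show "(\<Sum>i. ennreal (var (A i))) = ennreal (var (\<Union>i. A i))"
      using var_nonneg by (simp add: suminf_ennreal2 sums_iff)
  qed
qed

lemma measure_pos_part: "A \<in> borel_subsets T \<Longrightarrow> measure (pos_part T y) A = var A"
  using var_nonneg by (simp add: measure_def emeasure_pos_part)

lemma finite_measure_pos_part: "finite_measure (pos_part T y)"
proof
  have "T \<in> borel_subsets T" by (intro compact_borel_subsets compact) auto
  then show "emeasure (pos_part T y) (space (pos_part T y)) \<noteq> \<infinity>"
    by (simp add: space_pos_part emeasure_pos_part)
qed

lemma integrable_indicator_pos_part: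
  "A \<in> borel_subsets T \<Longrightarrow> integrable (pos_part T y) (indicat_real A)"
  by (intro integrable_real_indicator) (simp_all add: sets_pos_part emeasure_pos_part)

lemma integrable_pos_part:
  fixes \<phi> :: "'t \<Rightarrow> 'b::{banach, second_countable_topology}"
  assumes \<phi>: "continuous_on T \<phi>"
  shows "integrable (pos_part T y) \<phi>"
proof -
  interpret finite_measure "pos_part T y" by (rule finite_measure_pos_part)
  have "\<phi> \<in> borel_measurable (restrict_space borel T)"
    by (rule borel_measurable_continuous_on_restrict[OF \<phi>])
  moreover have "sets (pos_part T y) = sets (restrict_space borel T)"
    by (simp add: sets_pos_part borel_subsets_def)
  ultimately have m: "\<phi> \<in> borel_measurable (pos_part T y)"
    using measurable_cong_sets by blast
  obtain C where "\<And>\<tau>. \<tau> \<in> T \<Longrightarrow> norm (\<phi> \<tau>) \<le> C"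
    using compact_imp_bounded[OF compact_continuous_image[OF \<phi> compact]] by (auto simp: bounded_iff)
  then show ?thesis
    by (intro integrable_const_bound[OF _ m, of C]) (auto simp: space_pos_part)
qed

lemma uminus: "compact_signed T (\<lambda>A. - y A)"
proof
  show "compact T" by (rule compact)
  have "\<forall>A :: nat \<Rightarrow> 't set. range A \<subseteq> borel_subsets T \<longrightarrow> disjoint_family A \<longrightarrow>
        (\<lambda>i. - y (A i)) sums - y (\<Union>i. A i)" using sums by (auto intro: sums_minus)
  then show "(\<lambda>A. - y A) \<in> signed_measures T" using signed by (simp add: signed_measures_def)
qed

text \<open>
  Complementation \<open>B \<mapsto> A - B\<close> exchanges the subsets competing for the upper and the
  lower variation of \<open>A\<close>.
\<close>

lemma jordan:
  assumes A: "A \<in> borel_subsets T"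
  shows "y A = measure (pos_part T y) A - measure (neg_part T y) A"
proof -
  interpret m: compact_signed T "\<lambda>A. - y A" by (rule uminus)
  have "m.var A \<le> var A - y A"
  proof (rule m.var_least)
    fix B assume B: "B \<in> borel_subsets T" "B \<subseteq> A"
    have "y (A - B) \<le> var A" using B borel_subsets_intros[OF compact A] by (intro var_upper) auto
    then show "- y B \<le> var A - y A" using diff[OF A B] by simp
  qed
  moreover have "var A \<le> m.var A + y A"
  proof (rule var_least)
    fix B assume B: "B \<in> borel_subsets T" "B \<subseteq> A"
    have "- y (A - B) \<le> m.var A" using B borel_subsets_intros[OF compact A] by (intro m.var_upper) auto
    then show "y B \<le> m.var A + y A" using diff[OF A B] by simp
  qed
  ultimately show ?thesis by (simp add: neg_part_def measure_pos_part m.measure_pos_part A)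
qed

lemma integrable_neg_part:
  fixes \<phi> :: "'t \<Rightarrow> 'b::{banach, second_countable_topology}"
  shows "continuous_on T \<phi> \<Longrightarrow> integrable (neg_part T y) \<phi>"
  unfolding neg_part_def by (rule compact_signed.integrable_pos_part[OF uminus])

lemma signed_integral_linear:
  fixes \<phi> :: "'t \<Rightarrow> 'b::{banach, second_countable_topology}" 
    and l :: "'b \<Rightarrow> 'c::{banach, second_countable_topology}"
  assumes "continuous_on T \<phi>" "bounded_linear l"
  shows "signed_integral T y (\<lambda>\<tau>. l (\<phi> \<tau>)) = l (signed_integral T y \<phi>)"
  using integral_bounded_linear[OF assms(2) integrable_pos_part[OF assms(1)]]
    integral_bounded_linear[OF assms(2) integrable_neg_part[OF assms(1)]]
  by (simp add: signed_integral_def linear_diff[OF bounded_linear.linear[OF assms(2)]])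

lemma signed_integral_diff:
  fixes \<phi> :: "'t \<Rightarrow> 'b::{banach, second_countable_topology}"
  assumes "continuous_on T \<phi>" "continuous_on T \<phi>'"
  shows "signed_integral T y (\<lambda>\<tau>. \<phi> \<tau> - \<phi>' \<tau>) = signed_integral T y \<phi> - signed_integral T y \<phi>'"
  using assms by (simp add: signed_integral_def integrable_pos_part integrable_neg_part)

lemma signed_integral_add:
  fixes \<phi> :: "'t \<Rightarrow> 'b::{banach, second_countable_topology}"
  assumes "continuous_on T \<phi>" "continuous_on T \<phi>'"
  shows "signed_integral T y (\<lambda>\<tau>. \<phi> \<tau> + \<phi>' \<tau>) = signed_integral T y \<phi> + signed_integral T y \<phi>'"
  using assms by (simp add: signed_integral_def integrable_pos_part integrable_neg_part)

text \<open>
  Enclose \<open>A\<close> by \<open>K \<subseteq> A \<subseteq> U\<close> with little variation on \<open>U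
  - K\<close> and test with a Urysohn function that is one on \<open>K\<close> and zero off
  \<open>U\<close>: its integral exceeds \<open>y K\<close> by at most the variation on \<open>U -
  K\<close>, and \<open>y K\<close> is close to \<open>y A\<close>.
\<close>

lemma nonneg_of_positive_functional:
  assumes pos: "\<And>\<phi> :: 't \<Rightarrow> real. continuous_on T \<phi> \<Longrightarrow> (\<And>\<tau>. \<tau> \<in> T \<Longrightarrow> 0 \<le> \<phi> \<tau>) \<Longrightarrow> 0 \<le> signed_integral T y \<phi>"
  shows "y \<in> nonneg_measures T"
proof -
  have "0 \<le> y A" if A: "A \<in> borel_subsets T" for A
  proof (rule field_le_epsilon)
    fix e :: real assume e: "0 < e"
    interpret m: compact_signed T "\<lambda>A. - y A" by (rule uminus)
    obtain K U where KU: "compact K" "openin (top_of_set T) U" "K \<subseteq> A" "A \<subseteq> U"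
      and small: "\<forall>B\<in>borel_subsets T. B \<subseteq> U - K \<longrightarrow> \<bar>y B\<bar> < e/2"
      by (rule regular[OF A, of "e/2"]) (use e in auto)
    have UT: "U \<subseteq> T" using KU(2) openin_imp_subset by blast
    have Ub: "U \<in> borel_subsets T" by (rule openin_borel_subsets[OF compact KU(2)])
    have Kb: "K \<in> borel_subsets T" using KU UT by (intro compact_borel_subsets[OF compact]) auto
    have UKb: "U - K \<in> borel_subsets T" using borel_subsets_intros[OF compact Ub] Kb by auto
    have "closedin (top_of_set T) K" using KU UT by (auto intro!: closed_subset compact_imp_closed)
    moreover have "closedin (top_of_set T) (T - U)" using KU(2) by (auto intro: closedin_diff)
    moreover have "disjnt (T - U) K" using KU by (auto simp: disjnt_def)
    moreover have "normal_space (top_of_set T)"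
      by (intro metrizable_imp_normal_space metrizable_space_subtopology metrizable_space_euclidean)
    ultimately obtain \<phi> where \<phi>: "continuous_map (top_of_set T) (top_of_set {0..1::real}) \<phi>" 
      "\<phi> ` (T - U) \<subseteq> {0}" "\<phi> ` K \<subseteq> {1}"
      by (rule_tac Urysohn_lemma[of "top_of_set T" "T - U" K 0 1]) auto
    have c: "continuous_on T \<phi>" and r: "\<And>\<tau>. \<tau> \<in> T \<Longrightarrow> 0 \<le> \<phi> \<tau> \<and> \<phi> \<tau> \<le> 1"
      using \<phi>(1) by (auto simp: continuous_map_in_subtopology image_subset_iff Pi_iff)
    have "integral\<^sup>L (pos_part T y) \<phi> \<le> integral\<^sup>L (pos_part T y) (indicat_real U)"
      using r \<phi>(2)
      by (intro integral_mono[OF integrable_pos_part[OF c] integrable_indicator_pos_part[OF Ub]])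
        (auto simp: space_pos_part indicator_def)
    also have "\<dots> = var U" using Ub UT by (simp add: measure_pos_part space_pos_part Int_absorb2 sets_pos_part)
    finally have 1: "integral\<^sup>L (pos_part T y) \<phi> \<le> var U" .
    have "integral\<^sup>L (neg_part T y) (indicat_real K) \<le> integral\<^sup>L (neg_part T y) \<phi>"
      unfolding neg_part_def using r \<phi>(3)
      by (intro integral_mono[OF m.integrable_indicator_pos_part[OF Kb] m.integrable_pos_part[OF c]])
        (auto simp: m.space_pos_part indicator_def)
    moreover have "integral\<^sup>L (neg_part T y) (indicat_real K) = m.var K" 
      using KU UT Kb by (simp add: neg_part_def m.measure_pos_part m.space_pos_part Int_absorb2)
    ultimately have 2: "m.var K \<le> integral\<^sup>L (neg_part T y) \<phi>" by simp
    have "0 \<le> integral\<^sup>L (pos_part T y) \<phi> - integral\<^sup>L (neg_part T y) \<phi>"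
      using pos[OF c] r by (simp add: signed_integral_def)
    with 1 2 have 3: "m.var K \<le> var U" by simp
    have "var U \<le> var K + e/2"
    proof (rule var_least)
      fix B assume B: "B \<in> borel_subsets T" "B \<subseteq> U"
      have b: "B \<inter> K \<in> borel_subsets T" "B - K \<in> borel_subsets T" using borel_subsets_intros[OF compact B(1)] Kb by auto
      have "y B = y ((B \<inter> K) \<union> (B - K))" by (simp add: Int_Diff_Un)
      also have "\<dots> = y (B \<inter> K) + y (B - K)" using b by (intro add) auto
      also have "\<dots> \<le> var K + e/2"
      proof (rule add_mono)
        show "y (B \<inter> K) \<le> var K" using b by (intro var_upper) auto
        have "B - K \<subseteq> U - K" using B by blast
        with small b have "\<bar>y (B - K)\<bar> < e/2" by blast
        then show "y (B - K) \<le> e/2" by linarith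
      qed
      finally show "y B \<le> var K + e/2" .
    qed
    moreover have "y K = var K - m.var K"
      using jordan[OF Kb] by (simp add: neg_part_def measure_pos_part m.measure_pos_part Kb)
    ultimately have "- (e/2) \<le> y K" using 3 by simp
    moreover have "y A = y K + y (A - K)" using diff[OF A Kb KU(3)] by simp
    moreover have "\<bar>y (A - K)\<bar> < e/2" using small[rule_format, of "A - K"] KU borel_subsets_intros[OF compact A] Kb by auto
    ultimately show "0 \<le> y A + e" by simp
  qed
  then show ?thesis using signed by (simp add: nonneg_measures_def)
qed

end

section \<open>Nonnegative measures\<close>

lemma nonneg_measuresD: "y \<in> nonneg_measures T \<Longrightarrow> compact T \<Longrightarrow> compact_signed T y"
  by (simp add: compact_signed_def nonneg_measures_def)

lemma nonneg_measures_mono: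
  assumes yn: "y \<in> nonneg_measures T" "compact T" and AB: "A \<in> borel_subsets T" "B \<in> borel_subsets T" "A \<subseteq> B"
  shows "y A \<le> y B"
proof -
  interpret compact_signed T y using yn by (rule nonneg_measuresD)
  have "B - A \<in> borel_subsets T" using borel_subsets_intros[OF yn(2) AB(2)] AB by blast
  then have "0 \<le> y (B - A)" using yn by (simp add: nonneg_measures_def)
  then show ?thesis using diff[OF AB(2,1,3)] by simp
qed

lemma tv_norm_nonneg:
  assumes yn: "y \<in> nonneg_measures T" "compact T"
  shows "tv_norm T y = y T"
proof -
  have T: "T \<in> borel_subsets T" "{} \<in> borel_subsets T" using yn(2) by (auto intro: compact_borel_subsets empty_borel_subsets)
  have "(SUP A\<in>borel_subsets T. y A) = y T"
    using T yn(2) by (intro cSup_eq_maximum) (auto intro!: nonneg_measures_mono[OF yn] simp: borel_subsets_iff)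
  moreover have "(INF A\<in>borel_subsets T. y A) = 0"
  proof (rule cInf_eq_minimum)
    show "0 \<in> y ` borel_subsets T" using T(2) yn by (force simp: nonneg_measures_def signed_measures_def)
  qed (use yn in \<open>auto simp: nonneg_measures_def\<close>)
  ultimately show ?thesis by (simp add: tv_norm_def)
qed

text \<open>
  The upper variation of \<open>- y\<close> is attained at the empty set, so the negative part is the zero
  measure.
\<close>

lemma signed_integral_nonneg:
  fixes \<phi> :: "'t::metric_space \<Rightarrow> 'b::{banach, second_countable_topology}"
  assumes yn: "y \<in> nonneg_measures T" "compact T"
  shows "signed_integral T y \<phi> = integral\<^sup>L (pos_part T y) \<phi>" "measure (pos_part T y) T = y T"
proof -
  interpret compact_signed T y using yn by (rule nonneg_measuresD)
  interpret m: compact_signed T "\<lambda>A. - y A" by (rule uminus)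
  have T: "T \<in> borel_subsets T" using yn(2) by (auto intro: compact_borel_subsets)
  have "var T = y T" using T yn(2) by (intro antisym var_upper var_least) (auto intro!: nonneg_measures_mono[OF yn] simp: borel_subsets_iff)
  then show "measure (pos_part T y) T = y T" by (simp add: measure_pos_part T)
  have "m.var T = 0" using yn m.var_nonneg[of T] by (intro antisym m.var_least) (auto simp: nonneg_measures_def)
  then have "emeasure (neg_part T y) T = 0" by (simp add: neg_part_def m.emeasure_pos_part T)
  then have "AE x in neg_part T y. \<phi> x = 0"
    using T by (intro AE_I[of _ _ T]) (auto simp: neg_part_def m.space_pos_part m.sets_pos_part)
  then show "signed_integral T y \<phi> = integral\<^sup>L (pos_part T y) \<phi>"
    by (simp add: signed_integral_def integral_eq_zero_AE)
qed

lemma norm_signed_integral_le: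
  fixes \<phi> :: "'t::metric_space \<Rightarrow> 'b::{banach, second_countable_topology}"
  assumes yn: "y \<in> nonneg_measures T" "compact T" and \<phi>: "continuous_on T \<phi>" "\<And>\<tau>. \<tau> \<in> T \<Longrightarrow> norm (\<phi> \<tau>) \<le> C"
  shows "norm (signed_integral T y \<phi>) \<le> C * tv_norm T y"
proof -
  interpret compact_signed T y using yn by (rule nonneg_measuresD)
  interpret finite_measure "pos_part T y" by (rule finite_measure_pos_part)
  have "norm (integral\<^sup>L (pos_part T y) \<phi>) \<le> integral\<^sup>L (pos_part T y) (\<lambda>x. norm (\<phi> x))"
    by (rule integral_norm_bound)
  also have "\<dots> \<le> integral\<^sup>L (pos_part T y) (\<lambda>_. C)"
    using \<phi> by (intro integral_mono integrable_pos_part continuous_intros) (auto simp: space_pos_part)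
  also have "\<dots> = C * tv_norm T y"
    by (simp add: space_pos_part signed_integral_nonneg(2)[OF yn] tv_norm_nonneg[OF yn])
  finally show ?thesis by (simp add: signed_integral_nonneg[OF yn])
qed

lemma signed_integral_le:
  fixes \<phi> :: "'t::metric_space \<Rightarrow> real"
  assumes yn: "y \<in> nonneg_measures T" "compact T" and \<phi>: "continuous_on T \<phi>" "\<And>\<tau>. \<tau> \<in> T \<Longrightarrow> \<phi> \<tau> \<le> C"
  shows "signed_integral T y \<phi> \<le> C * tv_norm T y"
proof -
  interpret compact_signed T y using yn by (rule nonneg_measuresD)
  interpret finite_measure "pos_part T y" by (rule finite_measure_pos_part)
  have "integral\<^sup>L (pos_part T y) \<phi> \<le> integral\<^sup>L (pos_part T y) (\<lambda>_. C)"
    using \<phi> by (intro integral_mono integrable_pos_part continuous_intros) (auto simp: space_pos_part)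
  also have "\<dots> = C * tv_norm T y"
    by (simp add: space_pos_part signed_integral_nonneg(2)[OF yn] tv_norm_nonneg[OF yn])
  finally show ?thesis by (simp add: signed_integral_nonneg[OF yn])
qed

text \<open>
  Regularity is exact here: with the finite support \<open>S\<close> take the compact set \<open>S \<inter>
  A\<close> and the open set obtained by removing \<open>S - A\<close>.
\<close>

lemma finitely_supported_nonneg:
  fixes T :: "'t::metric_space set"
  assumes T: "compact T" and y: "finitely_supported T y"
  shows "y \<in> nonneg_measures T"
proof -
  obtain S c where S: "finite S" "S \<subseteq> T" and c: "\<And>\<tau>. \<tau> \<in> S \<Longrightarrow> 0 \<le> c \<tau>"
    and y: "y = (\<lambda>A. \<Sum>\<tau>\<in>S. c \<tau> * dirac T \<tau> A)" using y by (auto simp: finitely_supported_def)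
  have "(\<lambda>i. dirac T \<tau> (A i)) sums dirac T \<tau> (\<Union>i. A i)"
    if A: "range A \<subseteq> borel_subsets T" "disjoint_family A" for A :: "nat \<Rightarrow> 't set" and \<tau>
  proof (cases "\<exists>k. \<tau> \<in> A k")
    case True
    then obtain k where k: "\<tau> \<in> A k" by blast
    have "\<tau> \<notin> A i" if "i \<noteq> k" for i using A(2) k that by (auto simp: disjoint_family_on_def)
    then have "(\<lambda>i. dirac T \<tau> (A i)) = (\<lambda>i. if i = k then 1 else 0)" using k A(1) by (auto simp: dirac_def fun_eq_iff)
    moreover have "(\<Union>i. A i) \<in> borel_subsets T"
      using A(1) sigma_algebra.countable_UN[OF sigma_algebra_borel_subsets, of A UNIV] by simp
    then have "dirac T \<tau> (\<Union>i. A i) = 1" using k by (auto simp: dirac_def)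
    ultimately show ?thesis using sums_single[of k "\<lambda>_. 1::real"] by simp
  next
    case False
    then have "(\<lambda>i. dirac T \<tau> (A i)) = (\<lambda>i. 0)" "dirac T \<tau> (\<Union>i. A i) = 0" by (auto simp: dirac_def)
    then show ?thesis by simp
  qed
  then have sums: "(\<lambda>i. y (A i)) sums y (\<Union>i. A i)"
    if "range A \<subseteq> borel_subsets T" "disjoint_family A" for A :: "nat \<Rightarrow> 't set"
    unfolding y using that by (intro sums_sum sums_mult) auto
  have reg: "\<exists>K U. compact K \<and> openin (top_of_set T) U \<and> K \<subseteq> A \<and> A \<subseteq> U \<and>
      (\<forall>B\<in>borel_subsets T. B \<subseteq> U - K \<longrightarrow> \<bar>y B\<bar> < e)" if A: "A \<in> borel_subsets T" "0 < e" for A e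
  proof (intro exI conjI ballI impI)
    show "compact (S \<inter> A)" using S by (intro finite_imp_compact) auto
    have "openin (top_of_set T) (T \<inter> (- (S - A)))" using S
      by (intro openin_open_Int open_Compl finite_imp_closed finite_Diff)
    moreover have "T - (S - A) = T \<inter> (- (S - A))" by blast
    ultimately show "openin (top_of_set T) (T - (S - A))" by simp
    show "A \<subseteq> T - (S - A)" using A T by (auto simp: borel_subsets_iff)
    fix B assume B: "B \<in> borel_subsets T" "B \<subseteq> T - (S - A) - S \<inter> A"
    then have "y B = 0" unfolding y by (intro sum.neutral) (auto simp: dirac_def)
    then show "\<bar>y B\<bar> < e" using A by simp
  qed auto
  have nb: "A \<notin> borel_subsets T \<Longrightarrow> y A = 0" for A unfolding y by (simp add: dirac_def)
  have "y {} = 0" unfolding y by (simp add: dirac_def)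
  moreover have "0 \<le> y A" for A unfolding y using c by (intro sum_nonneg) (simp add: dirac_def)
  ultimately show ?thesis using sums reg nb by (auto simp: nonneg_measures_def signed_measures_def)
qed

section \<open>Gradients of smooth convex families\<close>

text \<open>
  The representing vector of the derivative is unique, so the definite description in \<open>grad\<close>
  denotes it.
\<close>

lemma has_derivative_grad:
  fixes f :: "'a::euclidean_space \<Rightarrow> real"
  assumes "f differentiable (at x)"
  shows "(f has_derivative (\<lambda>d. d \<bullet> grad f x)) (at x)"
proof -
  obtain f' where f': "(f has_derivative f') (at x)" using assms by (auto simp: differentiable_def)
  then have lin: "linear f'" by (rule has_derivative_linear)
  define D where "D = (\<Sum>b\<in>Basis. f' b *\<^sub>R b)"
  have "f' d = d \<bullet> D" for d
  proof -
    have "f' d = f' (\<Sum>b\<in>Basis. (d \<bullet> b) *\<^sub>R b)" by (simp add: euclidean_representation)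
    also have "\<dots> = (\<Sum>b\<in>Basis. (d \<bullet> b) * f' b)" by (simp add: linear_sum[OF lin] linear_scale[OF lin])
    finally show ?thesis by (simp add: D_def inner_sum_right mult.commute)
  qed
  then have "f' = (\<lambda>d. d \<bullet> D)" by blast
  then have D: "GDERIV f x :> D" using f' by (simp add: gderiv_def)
  have "grad f x = D" unfolding grad_def
  proof (rule the_equality)
    show "GDERIV f x :> D" by (rule D)
    fix E assume "GDERIV f x :> E"
    then have "(\<lambda>d. d \<bullet> E) = (\<lambda>d. d \<bullet> D)" using D unfolding gderiv_def by (rule has_derivative_unique)
    then have "d \<bullet> E = d \<bullet> D" for d by metis
    then show "E = D" by (metis inner_commute vector_eq_ldot)
  qed
  then show ?thesis using D by (simp add: gderiv_def)
qed

lemma has_real_derivative_along_line: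
  fixes f :: "'a::euclidean_space \<Rightarrow> real"
  assumes "\<And>x. f differentiable (at x)"
  shows "((\<lambda>t. f (x + t *\<^sub>R d)) has_real_derivative (grad f (x + t *\<^sub>R d) \<bullet> d)) (at t within A)"
proof -
  have "((\<lambda>t. x + t *\<^sub>R d) has_derivative (\<lambda>s. s *\<^sub>R d)) (at t within A)"
    by (auto intro!: derivative_eq_intros)
  moreover have "(f has_derivative (\<lambda>e. e \<bullet> grad f (x + t *\<^sub>R d))) (at (x + t *\<^sub>R d))"
    using assms by (rule has_derivative_grad)
  ultimately have "((\<lambda>t. f (x + t *\<^sub>R d)) has_derivative (\<lambda>s. (s *\<^sub>R d) \<bullet> grad f (x + t *\<^sub>R d))) (at t within A)"
    by (rule has_derivative_compose)
  then show ?thesis by (simp add: has_field_derivative_def inner_commute mult_commute_abs)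
qed

lemma mean_value_along_line:
  fixes f :: "'a::euclidean_space \<Rightarrow> real"
  assumes f: "\<And>x. f differentiable (at x)" and t: "0 \<le> t"
  obtains s where "0 \<le> s" "s \<le> t" "f (x + t *\<^sub>R d) - f x = t * (grad f (x + s *\<^sub>R d) \<bullet> d)"
proof (cases "t = 0")
  case False
  then have t: "0 < t" using t by simp
  from MVT2[OF t has_real_derivative_along_line[OF f]]
  obtain s where "0 < s" "s < t" "f (x + t *\<^sub>R d) - f (x + 0 *\<^sub>R d) = (t - 0) * (grad f (x + s *\<^sub>R d) \<bullet> d)" by blast
  then show thesis using that[of s] by simp
qed (use that[of 0] in simp)

lemma convex_gradient_ineq:
  fixes f :: "'a::euclidean_space \<Rightarrow> real"
  assumes f: "\<And>x. f differentiable (at x)" and c: "convex_on UNIV f"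
  shows "f x + grad f x \<bullet> d \<le> f (x + d)"
proof -
  have "convex_on UNIV (\<lambda>t. f (x + t *\<^sub>R d))"
  proof (rule convex_onI)
    fix t a b :: real assume t: "0 < t" "t < 1"
    have "x + ((1 - t) *\<^sub>R a + t *\<^sub>R b) *\<^sub>R d = (1 - t) *\<^sub>R (x + a *\<^sub>R d) + t *\<^sub>R (x + b *\<^sub>R d)"
      by (simp add: algebra_simps)
    then show "f (x + ((1 - t) *\<^sub>R a + t *\<^sub>R b) *\<^sub>R d) \<le> (1 - t) * f (x + a *\<^sub>R d) + t * f (x + b *\<^sub>R d)"
      using convex_onD[OF c, of t "x + a *\<^sub>R d" "x + b *\<^sub>R d"] t by simp
  qed simp
  from convex_on_imp_above_tangent[OF this _ _ _ has_real_derivative_along_line[OF f, of x d 0], of 1]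
  show ?thesis by simp
qed

text \<open>
  The gradient inequality at the end point bounds the increment from above; comparing the two gradients then
  replaces the mean value theorem, uniformly in a parameter.
\<close>

lemma convex_descent_ineq:
  fixes f :: "'a::euclidean_space \<Rightarrow> real"
  assumes f: "\<And>x. f differentiable (at x)" and c: "convex_on UNIV f"
  shows "f (x + d) \<le> f x + grad f (x + d) \<bullet> d"
  using convex_gradient_ineq[OF assms, of "x + d" "- d"] by simp

text \<open>
  By convexity \<open>\<nabla>g(x, \<tau>) \<bullet> e\<close> is at most the difference quotient of step
  \<open>t > 0\<close>, which for fixed \<open>t\<close> is continuous in \<open>(x, \<tau>)\<close> and for
  small \<open>t\<close> close to the derivative. This gives upper semicontinuity of \<open>\<nabla>g
  \<bullet> e\<close>, and replacing \<open>e\<close> by \<open>- e\<close> gives lower semicontinuity.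
\<close>

lemma continuous_on_grad_parametric:
  fixes g :: "'a::euclidean_space \<Rightarrow> 't::metric_space \<Rightarrow> real"
  assumes g: "continuous_on (UNIV \<times> T) (\<lambda>(x, \<tau>). g x \<tau>)"
    and d: "\<And>\<tau> x. \<tau> \<in> T \<Longrightarrow> (\<lambda>x. g x \<tau>) differentiable (at x)"
    and c: "\<And>\<tau>. \<tau> \<in> T \<Longrightarrow> convex_on UNIV (\<lambda>x. g x \<tau>)"
  shows "continuous_on (UNIV \<times> T) (\<lambda>(x, \<tau>). grad (\<lambda>u. g u \<tau>) x)"
proof -
  let ?D = "\<lambda>p e. grad (\<lambda>u. g u (snd p)) (fst p) \<bullet> e"
  have upper: "\<forall>\<^sub>F q in at p within UNIV \<times> T. ?D q e < ?D p e + \<epsilon>"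
    if p: "p \<in> UNIV \<times> T" and \<epsilon>: "0 < \<epsilon>" for p e and \<epsilon> :: real
  proof -
    obtain x \<tau> where px: "p = (x, \<tau>)" "\<tau> \<in> T" using p by auto
    have "((\<lambda>t. g (x + t *\<^sub>R e) \<tau>) has_real_derivative ?D p e) (at 0)"
      using has_real_derivative_along_line[OF d[OF px(2)], of x e 0 UNIV] px by simp
    then have "((\<lambda>t. (g (x + t *\<^sub>R e) \<tau> - g x \<tau>) / t) \<longlongrightarrow> ?D p e) (at 0)"
      by (simp add: DERIV_def)
    then have "((\<lambda>t. (g (x + t *\<^sub>R e) \<tau> - g x \<tau>) / t) \<longlongrightarrow> ?D p e) (at_right 0)"
      by (rule filterlim_mono[OF _ order_refl]) (simp add: at_within_le_at)
    then have "\<forall>\<^sub>F t in at_right 0. (g (x + t *\<^sub>R e) \<tau> - g x \<tau>) / t < ?D p e + \<epsilon>"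
      using \<epsilon> by (intro order_tendstoD(2)) auto
    moreover have "\<forall>\<^sub>F t in at_right (0::real). 0 < t" by (simp add: eventually_at_right_less)
    ultimately have "\<forall>\<^sub>F t in at_right 0. 0 < t \<and> (g (x + t *\<^sub>R e) \<tau> - g x \<tau>) / t < ?D p e + \<epsilon>"
      by eventually_elim simp
    then obtain t where t: "0 < t" "(g (x + t *\<^sub>R e) \<tau> - g x \<tau>) / t < ?D p e + \<epsilon>"
      using eventually_happens'[OF trivial_limit_at_right_real] by blast
    have "continuous_on (UNIV \<times> T) (\<lambda>q. (\<lambda>(x, \<tau>). g x \<tau>) (fst q + t *\<^sub>R e, snd q))"
      by (rule continuous_on_compose2[OF g]) (auto intro!: continuous_intros)
    moreover have "continuous_on (UNIV \<times> T) (\<lambda>q. g (fst q) (snd q))"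
      using g by (simp add: case_prod_unfold)
    ultimately have "continuous_on (UNIV \<times> T) (\<lambda>q. (g (fst q + t *\<^sub>R e) (snd q) - g (fst q) (snd q)) / t)"
      using t by (intro continuous_intros) auto
    then have "((\<lambda>q. (g (fst q + t *\<^sub>R e) (snd q) - g (fst q) (snd q)) / t) \<longlongrightarrow>
        (g (fst p + t *\<^sub>R e) (snd p) - g (fst p) (snd p)) / t) (at p within UNIV \<times> T)"
      using p by (auto simp: continuous_on)
    then have "\<forall>\<^sub>F q in at p within UNIV \<times> T. (g (fst q + t *\<^sub>R e) (snd q) - g (fst q) (snd q)) / t < ?D p e + \<epsilon>"
      by (rule order_tendstoD(2)) (use t px in simp)
    moreover have "\<forall>\<^sub>F q in at p within UNIV \<times> T. q \<in> UNIV \<times> T"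
      by (simp add: eventually_at_filter)
    ultimately show ?thesis
    proof eventually_elim
      case (elim q)
      then have "snd q \<in> T" by auto
      from convex_gradient_ineq[OF d[OF this] c[OF this], of "fst q" "t *\<^sub>R e"]
      have "t * ?D q e \<le> g (fst q + t *\<^sub>R e) (snd q) - g (fst q) (snd q)" by simp
      then have "?D q e \<le> (g (fst q + t *\<^sub>R e) (snd q) - g (fst q) (snd q)) / t" using t by (simp add: field_simps)
      with elim(1) show ?case by simp
    qed
  qed
  have "continuous_on (UNIV \<times> T) (\<lambda>q. ?D q e)" for e
    unfolding continuous_on
  proof
    fix p :: "'a \<times> 't" assume p: "p \<in> UNIV \<times> T"
    show "((\<lambda>q. ?D q e) \<longlongrightarrow> ?D p e) (at p within UNIV \<times> T)"
    proof (rule order_tendstoI)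
      fix a assume "?D p e < a"
      then show "\<forall>\<^sub>F q in at p within UNIV \<times> T. ?D q e < a" using upper[OF p, of "a - ?D p e" e] by simp
    next
      fix a assume a: "a < ?D p e"
      have "\<forall>\<^sub>F q in at p within UNIV \<times> T. ?D q (- e) < ?D p (- e) + (?D p e - a)"
        using a by (intro upper[OF p]) simp
      then show "\<forall>\<^sub>F q in at p within UNIV \<times> T. a < ?D q e" by eventually_elim simp
    qed
  qed
  then have "continuous_on (UNIV \<times> T) (\<lambda>q. grad (\<lambda>u. g u (snd q)) (fst q))"
    by (subst continuous_on_componentwise) blast
  then show ?thesis by (simp add: case_prod_unfold)
qed

section \<open>Runs of the algorithm\<close>

lemma max_pos_part_bounds:
  fixes \<phi> :: "'t::metric_space \<Rightarrow> real"
  assumes T: "compact T" "T \<noteq> {}" and \<phi>: "continuous_on T \<phi>"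
  shows "\<tau> \<in> T \<Longrightarrow> \<phi> \<tau> \<le> max_pos_part T \<phi>" "0 \<le> max_pos_part T \<phi>"
proof -
  have "continuous_on T (\<lambda>\<tau>. max (\<phi> \<tau>) 0)" by (intro continuous_intros \<phi>)
  then have bdd: "bdd_above ((\<lambda>\<tau>. max (\<phi> \<tau>) 0) ` T)"
    using T(1) by (intro bounded_imp_bdd_above compact_imp_bounded compact_continuous_image)
  then have le: "max (\<phi> \<tau>) 0 \<le> max_pos_part T \<phi>" if "\<tau> \<in> T" for \<tau>
    unfolding max_pos_part_def using that by (intro cSUP_upper)
  then show "\<tau> \<in> T \<Longrightarrow> \<phi> \<tau> \<le> max_pos_part T \<phi>" by force
  obtain \<tau> where "\<tau> \<in> T" using T by blast
  with le show "0 \<le> max_pos_part T \<phi>" by force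
qed

lemma max_pos_part_le:
  assumes "T \<noteq> {}" "0 \<le> C" "\<And>\<tau>. \<tau> \<in> T \<Longrightarrow> \<phi> \<tau> \<le> C"
  shows "max_pos_part T \<phi> \<le> C"
  unfolding max_pos_part_def using assms by (intro cSUP_least) auto

lemma uniform_modulus:
  fixes u :: "'a::euclidean_space \<Rightarrow> 't::metric_space \<Rightarrow> 'b::metric_space"
  assumes T: "compact T" and u: "continuous_on (UNIV \<times> T) (\<lambda>(x, \<tau>). u x \<tau>)" and e: "0 < e"
  obtains \<delta> where "0 < \<delta>" "\<forall>x x'. \<forall>\<tau>\<in>T. norm x \<le> M \<longrightarrow> norm x' \<le> M \<longrightarrow> dist x' x < \<delta> \<longrightarrow> dist (u x' \<tau>) (u x \<tau>) < e"
proof -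
  have "compact (cball (0::'a) M \<times> T)" using T by (intro compact_Times compact_cball)
  moreover have "continuous_on (cball 0 M \<times> T) (\<lambda>(x, \<tau>). u x \<tau>)" using u by (rule continuous_on_subset) auto
  ultimately have "uniformly_continuous_on (cball 0 M \<times> T) (\<lambda>(x, \<tau>). u x \<tau>)" by (intro compact_uniformly_continuous)
  then obtain \<delta> where \<delta>: "0 < \<delta>" "\<forall>p\<in>cball 0 M \<times> T. \<forall>q\<in>cball 0 M \<times> T. dist q p < \<delta> \<longrightarrow> dist (case q of (x, \<tau>) \<Rightarrow> u x \<tau>) (case p of (x, \<tau>) \<Rightarrow> u x \<tau>) < e"
    using e unfolding uniformly_continuous_on_def by blast
  show thesis
  proof (rule that[OF \<delta>(1)], intro allI ballI impI)
    fix x x' :: 'a and \<tau> assume "norm x \<le> M" "norm x' \<le> M" "dist x' x < \<delta>" and "\<tau> \<in> T"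
    then show "dist (u x' \<tau>) (u x \<tau>) < e"
      using \<delta>(2)[rule_format, of "(x, \<tau>)" "(x', \<tau>)"] by (simp add: dist_Pair_Pair)
  qed
qed

lemma uniform_modulus_single:
  fixes u :: "'a::euclidean_space \<Rightarrow> 'b::metric_space"
  assumes u: "continuous_on UNIV u" and e: "0 < e"
  obtains \<delta> where "0 < \<delta>" "\<forall>x x'. norm x \<le> M \<longrightarrow> norm x' \<le> M \<longrightarrow> dist x' x < \<delta> \<longrightarrow> dist (u x') (u x) < e"
proof -
  \<comment> \<open>A one-point parameter space reduces this to the previous lemma.\<close>
  have "continuous_on (UNIV \<times> {0::real}) (\<lambda>p. u (fst p))"
    by (rule continuous_on_compose2[OF u]) (auto intro!: continuous_intros)
  then have c: "continuous_on (UNIV \<times> {0::real}) (\<lambda>(x, \<tau>). u x)" by (simp add: case_prod_unfold)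
  have k: "compact {0::real}" by simp
  obtain \<delta> where "0 < \<delta>" "\<forall>x x'. \<forall>\<tau>\<in>{0::real}. norm x \<le> M \<longrightarrow> norm x' \<le> M \<longrightarrow> dist x' x < \<delta> \<longrightarrow> dist (u x') (u x) < e"
    by (rule uniform_modulus[OF k c e])
  then show thesis using that by auto
qed

text \<open>
  A bounded monotone sequence is a Cauchy sequence, and a late jump would have to be smaller than
  \<open>\<delta>\<close>.
\<close>

lemma eventually_const_of_jumps:
  fixes \<rho> :: "nat \<Rightarrow> real"
  assumes b: "bounded (range \<rho>)" and \<delta>: "0 < \<delta>" and s: "\<And>r. \<rho> (Suc r) = \<rho> r \<or> \<rho> r + \<delta> \<le> \<rho> (Suc r)"
  obtains N where "\<forall>r\<ge>N. \<rho> r = \<rho> N"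
proof -
  have inc: "\<rho> r \<le> \<rho> (Suc r)" for r using s[of r] \<delta> by linarith
  then have "incseq \<rho>" by (rule incseq_SucI)
  moreover obtain C where "\<And>r. \<rho> r \<le> C" using b unfolding bounded_iff by (auto dest: abs_le_D1)
  ultimately obtain L where "\<rho> \<longlonglongrightarrow> L" by (metis incseq_convergent)
  then have "Cauchy \<rho>" by (rule LIMSEQ_imp_Cauchy)
  then obtain N where N: "\<And>m n. m \<ge> N \<Longrightarrow> n \<ge> N \<Longrightarrow> dist (\<rho> m) (\<rho> n) < \<delta>"
    using \<delta> unfolding Cauchy_def by blast
  have suc: "\<rho> (Suc r) = \<rho> r" if "N \<le> r" for r
    using s[of r] N[of "Suc r" r] that by (auto simp: dist_real_def)
  have "\<rho> r = \<rho> N" if "N \<le> r" for r using that by (induction rule: dec_induct) (auto simp: suc)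
  then show thesis using that by blast
qed

locale bounded_run =
  fixes T :: "'t::metric_space set"
    and \<mu> :: real
    and f :: "real^'n \<Rightarrow> real"
    and g :: "real^'n \<Rightarrow> 't \<Rightarrow> real"
    and F0 :: "real^'m^'m"
    and F :: "'n \<Rightarrow> real^'m^'m"
    and G :: "real^'n^'s"
    and h :: "real^'s"
    and \<alpha> \<beta>1 \<beta>2 \<sigma> \<delta> \<nu> \<eta>1 \<eta>2 :: real
    and x dx :: "nat \<Rightarrow> real^'n"
    and y :: "nat \<Rightarrow> 't set \<Rightarrow> real"
    and z :: "nat \<Rightarrow> real^'s"
    and V P dV :: "nat \<Rightarrow> real^'m^'m"
    and B :: "nat \<Rightarrow> real^'n^'n"
    and \<rho> \<gamma> s :: "nat \<Rightarrow> real"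
  assumes data: "problem_data T \<mu> f g F0 F G h"
    and run: "algorithm_run T \<mu> f g F0 F G h \<alpha> \<beta>1 \<beta>2 \<sigma> \<delta> \<nu> x y z V P B dx dV \<rho> \<gamma> s"
    and A1: "\<forall>r. P r = hrvw_matrix (pencil F0 F (x r)) \<or> P r = nt_matrix (pencil F0 F (x r)) (V r)"
    and A2: "bounded (range \<rho>)"
    and A3: "bounded (range x)"
    and A4: "G *v x 0 = h"
    and B_consts: "0 < \<eta>1" "\<eta>1 < \<eta>2"
    and B: "\<forall>r. \<eta>2 *\<^sub>R mat 1 - B r \<in> psd_mats \<and> B r - \<eta>1 *\<^sub>R mat 1 \<in> psd_mats"
begin

abbreviation Dg :: "real^'n \<Rightarrow> 't \<Rightarrow> real^'n" where "Dg u \<tau> \<equiv> grad (\<lambda>v. g v \<tau>) u"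
abbreviation X :: "nat \<Rightarrow> real^'m^'m" where "X r \<equiv> pencil F0 F (x r)"
abbreviation L :: "nat \<Rightarrow> real^'m^'m" where "L r \<equiv> lin_part F (dx r)"
abbreviation gap :: "nat \<Rightarrow> real" where "gap r \<equiv> centrality_gap \<mu> (X r) (V r)"
abbreviation merit_function :: "real \<Rightarrow> real^'n \<Rightarrow> real^'m^'m \<Rightarrow> real" ("\<Phi>") where
  "\<Phi> \<equiv> merit T \<mu> f g F0 F G h \<nu>"
text \<open>
  The decrease predicted by the line search model, with the slope of \<open>\<psi>\<close> already replaced
  by the centrality gap.
\<close>

definition Q :: "nat \<Rightarrow> real" where "Q r = dx r \<bullet> (B r *v dx r) + \<nu> * gap r"

lemma T: "compact T" "T \<noteq> {}" and \<mu>: "0 < \<mu>"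
  and f_diff: "f differentiable (at u)" and f_cont: "continuous_on UNIV (grad f)"
  and g_cont: "continuous_on (UNIV \<times> T) (\<lambda>(x, \<tau>). g x \<tau>)"
  and g_conv: "\<tau> \<in> T \<Longrightarrow> convex_on UNIV (\<lambda>x. g x \<tau>)"
  and g_diff: "\<tau> \<in> T \<Longrightarrow> (\<lambda>x. g x \<tau>) differentiable (at u)"
  and F0: "F0 \<in> sym_mats" and F: "F i \<in> sym_mats"
  using data unfolding problem_data_def continuously_differentiable_def by auto

lemma params: "0 < \<alpha>" "\<alpha> < 1" "0 < \<beta>1" "\<beta>1 < 1" "0 < \<beta>2" "\<beta>2 < 1" "0 < \<sigma>" "\<sigma> < 1"
    "0 < \<delta>" "0 < \<nu>" "0 < \<rho> 0" "0 < \<gamma> 0"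
  and init: "X 0 \<in> pd_mats" "V 0 \<in> pd_mats" "finitely_supported T (y 0)"
  and B_pd: "B r \<in> pd_mats"
  and step: "step_solution T \<mu> f g F0 F G h (B r) (\<gamma> r) (x r) (dx r) (y (Suc r)) (z (Suc r))"
  and dV: "dV r = newton_V \<mu> F0 F (P r) (x r) (V r) (dx r)"
  and \<rho>_Suc: "\<rho> (Suc r) = (if \<rho> r > max (tv_norm T (y (Suc r))) (infnorm (z (Suc r))) then \<rho> r
      else \<delta> + max (tv_norm T (y (Suc r))) (infnorm (z (Suc r))))"
  and x_Suc: "x (Suc r) = x r + s r *\<^sub>R dx r"
  and V_Suc: "V (Suc r) = V r + s r *\<^sub>R dV r"
  and \<gamma>_Suc: "\<gamma> (Suc r) = \<beta>2 * \<gamma> r"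
  using run unfolding algorithm_run_def Let_def by auto

definition sbar :: "nat \<Rightarrow> real" where
  "sbar r = min (min (step_bound \<sigma> (X r) (L r)) (step_bound \<sigma> (V r) (dV r))) 1"

abbreviation armijo :: "nat \<Rightarrow> real \<Rightarrow> bool" where
  "armijo r t \<equiv> sufficient_decrease T \<mu> f g F0 F G h \<alpha> \<nu> (\<rho> (Suc r)) (\<gamma> r) (B r)
     (x r) (V r) (dx r) (dV r) t"

lemma line_search:
  obtains l where "armijo r (sbar r * \<beta>1 ^ l)" "\<And>k. k < l \<Longrightarrow> \<not> armijo r (sbar r * \<beta>1 ^ k)"
    "s r = sbar r * \<beta>1 ^ l"
  using run unfolding algorithm_run_def Let_def sbar_def by meson

lemma pencil_sym: "pencil F0 F u \<in> sym_mats"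
  unfolding pencil_def using F0 F by (intro sym_mats_intros lin_part_sym)

lemma L_sym: "L r \<in> sym_mats" using F by (rule lin_part_sym)

lemma dV_sym:
  assumes "X r \<in> pd_mats" "V r \<in> pd_mats"
  shows "dV r \<in> sym_mats"
  unfolding dV using A1 by (intro psi_slope_newton(2) assms F) auto

text \<open>
  The invariant behind positive definiteness of all iterates: it presupposes positive definiteness of the
  current pair only.
\<close>

lemma step_size:
  assumes "X r \<in> pd_mats" "V r \<in> pd_mats"
  shows "0 < sbar r" "sbar r \<le> 1" "0 < s r" "s r \<le> sbar r" "s r \<le> 1"
    "0 \<le> t \<Longrightarrow> t \<le> sbar r \<Longrightarrow> X r + t *\<^sub>R L r \<in> pd_mats"
    "0 \<le> t \<Longrightarrow> t \<le> sbar r \<Longrightarrow> V r + t *\<^sub>R dV r \<in> pd_mats"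
proof -
  note sX = step_bound[OF assms(1) L_sym[of r] params(7,8)]
  note sV = step_bound[OF assms(2) dV_sym[OF assms] params(7,8)]
  show sb: "0 < sbar r" "sbar r \<le> 1" unfolding sbar_def using sX(1) sV(1) by auto
  obtain l where l: "s r = sbar r * \<beta>1 ^ l" using line_search by blast
  have "0 < \<beta>1 ^ l" "\<beta>1 ^ l \<le> 1" using params by (auto intro: power_le_one)
  then show "0 < s r" "s r \<le> sbar r" using sb l by (auto simp: mult_le_cancel_left2)
  then show "s r \<le> 1" using sb by simp
  show "X r + t *\<^sub>R L r \<in> pd_mats" "V r + t *\<^sub>R dV r \<in> pd_mats" if "0 \<le> t" "t \<le> sbar r"
    using that by (auto intro!: sX(2) sV(2) simp: sbar_def)
qed

lemma iterates_pd: "X r \<in> pd_mats" "V r \<in> pd_mats"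
proof -
  have "X r \<in> pd_mats \<and> V r \<in> pd_mats"
  proof (induction r)
    case 0 then show ?case using init by simp
  next
    case (Suc r)
    then have "X r \<in> pd_mats" "V r \<in> pd_mats" by auto
    from step_size[OF this] have "X r + s r *\<^sub>R L r \<in> pd_mats" "V r + s r *\<^sub>R dV r \<in> pd_mats" by auto
    then show ?case by (simp add: x_Suc V_Suc pencil_add_scaled)
  qed
  then show "X r \<in> pd_mats" "V r \<in> pd_mats" by auto
qed

lemmas steps = step_size[OF iterates_pd]

lemma y_nonneg: "y r \<in> nonneg_measures T"
proof (cases r)
  case 0 then show ?thesis using init(3) T(1) by (simp add: finitely_supported_nonneg)
next
  case (Suc k)
  then show ?thesis using step[of k] T(1)
    by (simp add: step_solution_def Let_def finitely_supported_nonneg)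
qed

lemma step_eq: "grad f (x r) + B r *v dx r - \<mu> *\<^sub>R xi F0 F (x r)
        + signed_integral T (y (Suc r)) (Dg (x r)) + transpose G *v z (Suc r) = 0"
  and step_compl: "signed_integral T (y (Suc r)) (\<lambda>\<tau>. g (x r) \<tau> + Dg (x r) \<tau> \<bullet> dx r) = 0"
  and step_lin: "G *v (x r + dx r) = h"
  and step_feas: "max_pos_part T (\<lambda>\<tau>. g (x r) \<tau> + Dg (x r) \<tau> \<bullet> dx r) \<le> \<gamma> r"
  using step[of r] by (simp_all add: step_solution_def Let_def)

lemma feasible_eq: "G *v x r = h"
proof (induction r)
  case 0 then show ?case by (rule A4)
next
  case (Suc r)
  have "G *v dx r = 0" using step_lin[of r] Suc by (simp add: matrix_vector_right_distrib)
  then show ?case by (simp add: x_Suc matrix_vector_right_distrib Suc matrix_vector_mult_scaleR)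
qed

lemma G_dx: "G *v dx r = 0"
  using step_lin[of r] feasible_eq[of r] by (simp add: matrix_vector_right_distrib)

lemma \<gamma>_eq: "\<gamma> r = \<gamma> 0 * \<beta>2 ^ r" by (induction r) (simp_all add: \<gamma>_Suc)

lemma \<gamma>_nonneg: "0 \<le> \<gamma> r" using params by (subst \<gamma>_eq) simp

lemma \<gamma>_summable: "summable \<gamma>"
proof -
  have "summable (\<lambda>r. \<gamma> 0 * \<beta>2 ^ r)" using params by (intro summable_mult summable_geometric) auto
  moreover have "(\<lambda>r. \<gamma> 0 * \<beta>2 ^ r) = \<gamma>" by (rule ext) (rule \<gamma>_eq[symmetric])
  ultimately show ?thesis by simp
qed

lemma multiplier_bound: "tv_norm T (y (Suc r)) \<le> \<rho> (Suc r)" "infnorm (z (Suc r)) \<le> \<rho> (Suc r)"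
  using \<rho>_Suc[of r] params by (auto split: if_splits)

lemma \<rho>_pos: "0 < \<rho> r"
proof (induction r)
  case 0 then show ?case using params by simp
next
  case (Suc r)
  have "0 \<le> infnorm (z (Suc r))" by (rule infnorm_pos_le)
  then have "0 \<le> max (tv_norm T (y (Suc r))) (infnorm (z (Suc r)))" by simp
  then show ?case using \<rho>_Suc[of r] params Suc by (simp split: if_splits)
qed

lemma \<rho>_eventually: obtains N where "\<forall>r\<ge>N. \<rho> r = \<rho> N"
proof (rule eventually_const_of_jumps[OF A2 params(9)])
  show "\<rho> (Suc r) = \<rho> r \<or> \<rho> r + \<delta> \<le> \<rho> (Suc r)" for r using \<rho>_Suc[of r] by auto
qed (rule that)

lemma gap_nonneg: "0 \<le> gap r" using centrality_gap(1) iterates_pd by blast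

lemma dir_deriv_eq: "dir_deriv (psi \<mu> F0 F) (x r, V r) (dx r, dV r) = - gap r"
proof -
  have "dir_deriv (psi \<mu> F0 F) (x r, V r) (dx r, dV r) = psi_slope \<mu> (X r) (V r) (L r) (dV r)"
    using iterates_pd dV_sym F0 F \<mu> by (intro dir_deriv_psi) auto
  also have "\<dots> = - gap r" unfolding dV using A1 by (intro psi_slope_newton(1) iterates_pd F) auto
  finally show ?thesis .
qed

lemma B_quadratic: "\<eta>1 * (v \<bullet> v) \<le> v \<bullet> (B r *v v)" "op_bound (B r) \<eta>2"
proof -
  have b: "0 \<le> v \<bullet> ((\<eta>2 *\<^sub>R mat 1 - B r) *v v)" "0 \<le> v \<bullet> ((B r - \<eta>1 *\<^sub>R mat 1) *v v)" for v
    using B by (auto simp: psd_mats_def)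
  then have c: "\<eta>1 * (v \<bullet> v) \<le> v \<bullet> (B r *v v)" "v \<bullet> (B r *v v) \<le> \<eta>2 * (v \<bullet> v)" for v
    using b[of v] by (simp_all add: matrix_vector_mult_diff_rdistrib inner_diff_right scaleR_matrix_vector_assoc[symmetric])
  then show "\<eta>1 * (v \<bullet> v) \<le> v \<bullet> (B r *v v)" by blast
  show "op_bound (B r) \<eta>2"
  proof (rule op_bound_of_psd)
    show "0 \<le> v \<bullet> (B r *v v)" for v
      using pd_matsD(2)[OF B_pd, of v r] by (cases "v = 0") auto
  qed (use c pd_matsD(1)[OF B_pd] B_consts in auto)
qed

lemma Q_bounds: "\<eta>1 * (norm (dx r))\<^sup>2 \<le> Q r" "\<nu> * gap r \<le> Q r" "0 \<le> Q r"
proof -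
  have "\<eta>1 * (norm (dx r))\<^sup>2 \<le> dx r \<bullet> (B r *v dx r)" using B_quadratic(1) by (simp add: power2_norm_eq_inner)
  moreover have "0 \<le> \<eta>1 * (norm (dx r))\<^sup>2" using B_consts by simp
  moreover have "0 \<le> \<nu> * gap r" using gap_nonneg params by simp
  ultimately show "\<eta>1 * (norm (dx r))\<^sup>2 \<le> Q r" "\<nu> * gap r \<le> Q r" "0 \<le> Q r" unfolding Q_def by linarith+
qed

lemma armijo_iff: "armijo r t \<longleftrightarrow>
    \<Phi> (\<rho> (Suc r)) (x r + t *\<^sub>R dx r) (V r + t *\<^sub>R dV r)
     \<le> \<Phi> (\<rho> (Suc r)) (x r) (V r) - \<alpha> * t * Q r + \<rho> (Suc r) * t * \<gamma> r"
  by (simp add: sufficient_decrease_def dir_deriv_eq Q_def)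

lemma step_decrease:
  "\<Phi> (\<rho> (Suc r)) (x (Suc r)) (V (Suc r))
     \<le> \<Phi> (\<rho> (Suc r)) (x r) (V r) - \<alpha> * s r * Q r + \<rho> (Suc r) * s r * \<gamma> r"
proof -
  obtain l where "armijo r (sbar r * \<beta>1 ^ l)" "s r = sbar r * \<beta>1 ^ l" using line_search by blast
  then show ?thesis using armijo_iff[of r "s r"] by (simp add: x_Suc V_Suc)
qed

lemma merit_eq:
  assumes "G *v u = h"
  shows "\<Phi> p u W = f u - \<mu> * ln (det (pencil F0 F u)) + p * max_pos_part T (g u) + \<nu> * psi \<mu> F0 F (u, W)"
  using assms by (simp add: merit_def chi_def)

lemma f_continuous: "continuous_on A f"
  by (intro continuous_at_imp_continuous_on ballI differentiable_imp_continuous_within f_diff)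

lemma g_continuous: "continuous_on T (g u)"
proof -
  have "continuous_on T (\<lambda>\<tau>. (\<lambda>(x, \<tau>). g x \<tau>) (u, \<tau>))"
    by (rule continuous_on_compose2[OF g_cont]) (auto intro!: continuous_intros)
  then show ?thesis by simp
qed

lemma Dg_cont: "continuous_on (UNIV \<times> T) (\<lambda>(x, \<tau>). Dg x \<tau>)"
  by (rule continuous_on_grad_parametric[OF g_cont g_diff g_conv])

lemma Dg_continuous: "continuous_on T (Dg u)"
proof -
  have "continuous_on T (\<lambda>\<tau>. (\<lambda>(x, \<tau>). Dg x \<tau>) (u, \<tau>))"
    by (rule continuous_on_compose2[OF Dg_cont]) (auto intro!: continuous_intros)
  then show ?thesis by simp
qed

lemma x_bounded: obtains M where "0 < M" "\<And>r. norm (x r) \<le> M"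
  using A3 unfolding bounded_pos by auto

lemma bounded_on_ball:
  fixes u :: "real^'n \<Rightarrow> 'b::real_normed_vector"
  assumes "continuous_on UNIV u"
  obtains C where "0 < C" "\<And>v. norm v \<le> M \<Longrightarrow> norm (u v) \<le> C"
proof -
  have "compact (u ` cball 0 M)" using assms by (intro compact_continuous_image continuous_on_subset[OF assms]) auto
  then have "bounded (u ` cball 0 M)" by (rule compact_imp_bounded)
  then show thesis using that unfolding bounded_pos by auto
qed

lemma pencil_continuous: "continuous_on A (pencil F0 F)"
proof -
  have "bounded_linear (lin_part F)" using linear_lin_part linear_conv_bounded_linear by blast
  then have "continuous_on A (lin_part F)" by (rule linear_continuous_on)
  then have "continuous_on A (\<lambda>u. F0 + lin_part F u)" by (intro continuous_intros)
  then show ?thesis by (simp add: pencil_def[abs_def])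
qed

text \<open>
  Summing the accepted decreases after the penalty parameter has become constant; the steps are at most one,
  so the error terms are at most \<open>\<rho> \<gamma>\<^sub>k\<close>.
\<close>

lemma step_telescope:
  assumes N: "\<forall>r\<ge>N. \<rho> r = \<rho> N"
  shows "\<Phi> (\<rho> N) (x (N + n)) (V (N + n)) + \<alpha> * (\<Sum>k<n. s (N + k) * Q (N + k))
    \<le> \<Phi> (\<rho> N) (x N) (V N) + \<rho> N * (\<Sum>k<n. \<gamma> (N + k))"
proof (induction n)
  case (Suc n)
  have "\<rho> (Suc (N + n)) = \<rho> N" by (rule N[rule_format]) simp
  then have "\<Phi> (\<rho> N) (x (N + Suc n)) (V (N + Suc n))
     \<le> \<Phi> (\<rho> N) (x (N + n)) (V (N + n)) - \<alpha> * s (N + n) * Q (N + n) + \<rho> N * s (N + n) * \<gamma> (N + n)"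
    using step_decrease[of "N + n"] by simp
  moreover have "\<rho> N * s (N + n) * \<gamma> (N + n) \<le> \<rho> N * \<gamma> (N + n)"
    using mult_right_mono[OF steps(5)[of "N + n"] \<gamma>_nonneg[of "N + n"]] \<rho>_pos[of N] by simp
  ultimately show ?case using Suc by (simp add: algebra_simps)
qed simp

lemma merit_upper:
  assumes N: "\<forall>r\<ge>N. \<rho> r = \<rho> N"
  obtains C where "\<And>n. \<Phi> (\<rho> N) (x (N + n)) (V (N + n)) + \<alpha> * (\<Sum>k<n. s (N + k) * Q (N + k)) \<le> C"
proof -
  have sg: "summable (\<lambda>k. \<gamma> (N + k))" using \<gamma>_summable by (simp add: summable_iff_shift add.commute)
  have "(\<Sum>k<n. \<gamma> (N + k)) \<le> (\<Sum>k. \<gamma> (N + k))" for n using \<gamma>_nonneg sg by (intro sum_le_suminf) auto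
  then have "\<rho> N * (\<Sum>k<n. \<gamma> (N + k)) \<le> \<rho> N * (\<Sum>k. \<gamma> (N + k))" for n using \<rho>_pos[of N] by simp
  then show thesis
    using step_telescope[OF N]
    by (intro that[of "\<Phi> (\<rho> N) (x N) (V N) + \<rho> N * (\<Sum>k. \<gamma> (N + k))"])
      (meson add_left_mono order_trans)
qed

end

section \<open>Uniform bounds along a run\<close>

lemma coercive_mono: "coercive c A \<Longrightarrow> c' \<le> c \<Longrightarrow> coercive c' A"
  unfolding coercive_def by (meson inner_ge_zero mult_right_mono order_trans)

context bounded_run
begin

lemma merit_summand_bounds:
  obtains Cf tX k where "\<forall>r. - f (x r) \<le> Cf \<and> ln (det (X r)) \<le> tX \<and> 0 \<le> trace (X r ** V r) \<and>
    trace (X r ** V r) / 2 + k \<le> psi \<mu> F0 F (x r, V r)"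
proof -
  obtain M where M: "0 < M" "\<And>r. norm (x r) \<le> M" using x_bounded by blast
  obtain Cf where Cf: "\<And>v. norm v \<le> M \<Longrightarrow> norm (f v) \<le> Cf" using bounded_on_ball[OF f_continuous, of M] by blast
  obtain CX where CX: "\<And>v. norm v \<le> M \<Longrightarrow> norm (pencil F0 F v) \<le> CX"
    using bounded_on_ball[OF pencil_continuous, of M] by blast
  define m where "m = real CARD('m)"
  have "- f (x r) \<le> Cf" for r using Cf[OF M(2)[of r]] by (simp add: abs_le_iff)
  moreover have "ln (det (X r)) \<le> m * (m * m * CX)" for r
  proof -
    have "op_bound (X r) (m * m * CX)" unfolding m_def
      by (rule op_bound_mono[OF op_bound_norm]) (use CX[OF M(2)[of r]] in \<open>auto intro: mult_left_mono\<close>)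
    from op_bound_trace[OF this] have "trace (X r) \<le> m * (m * m * CX)" by (simp add: m_def)
    then show ?thesis using ln_det_le_trace[OF iterates_pd(1)[of r]] by simp
  qed
  moreover have "trace (X r ** V r) / 2 + m * \<mu> * (1 - ln (2 * \<mu>)) \<le> psi \<mu> F0 F (x r, V r)" for r
    using ln_det_product_le[OF iterates_pd(1)[of r] iterates_pd(2)[of r] \<mu>]
    by (simp add: psi_def mat_inner_def m_def)
  moreover have "0 \<le> trace (X r ** V r)" for r using centrality_gap(2) iterates_pd by blast
  ultimately show thesis using that by blast
qed

lemma merit_ge:
  "f (x r) - \<mu> * ln (det (X r)) + \<nu> * psi \<mu> F0 F (x r, V r) \<le> \<Phi> (\<rho> N) (x r) (V r)"
proof -
  have "0 \<le> \<rho> N * max_pos_part T (g (x r))"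
    using \<rho>_pos[of N] max_pos_part_bounds(2)[OF T g_continuous] by (simp add: less_imp_le)
  then show ?thesis unfolding merit_eq[OF feasible_eq] by linarith
qed

text \<open>
  Every summand of the merit function is bounded below, so the upper bound on their sum controls them one
  after the other: first \<open>log det F(x\<^sub>r)\<close> from below, then \<open>\<psi>\<close> from
  above, hence \<open>tr(F(x\<^sub>r) V\<^sub>r)\<close> from above and \<open>log det V\<^sub>r\<close>
  from below. Compactness (\<open>uniformly_coercive\<close>) converts the determinant bounds into
  coercivity.
\<close>

lemma primal_dual_bounds:
  assumes N: "\<forall>r\<ge>N. \<rho> r = \<rho> N"
  obtains c K where "0 < c" "\<forall>r\<ge>N. coercive c (X r) \<and> coercive c (V r) \<and> op_bound (V r) K \<and> trace (X r ** V r) \<le> K"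
proof -
  obtain C where C: "\<And>n. \<Phi> (\<rho> N) (x (N + n)) (V (N + n)) + \<alpha> * (\<Sum>k<n. s (N + k) * Q (N + k)) \<le> C"
    using merit_upper[OF N] by blast
  obtain Cf tX k where bounds: "\<forall>r. - f (x r) \<le> Cf \<and> ln (det (X r)) \<le> tX \<and> 0 \<le> trace (X r ** V r) \<and>
    trace (X r ** V r) / 2 + k \<le> psi \<mu> F0 F (x r, V r)" by (rule merit_summand_bounds)
  then have f: "- f (x r) \<le> Cf" and trX: "ln (det (X r)) \<le> tX" and tr_nonneg: "0 \<le> trace (X r ** V r)"
    and psi_low: "trace (X r ** V r) / 2 + k \<le> psi \<mu> F0 F (x r, V r)" for r by blast+
  have merit: "f (x r) - \<mu> * ln (det (X r)) + \<nu> * psi \<mu> F0 F (x r, V r) \<le> C" if "r \<ge> N" for r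
  proof -
    have "0 \<le> \<alpha> * (\<Sum>k<r - N. s (N + k) * Q (N + k))"
      using params steps(3) Q_bounds(3) by (intro mult_nonneg_nonneg sum_nonneg) (auto simp: less_imp_le)
    then show ?thesis using C[of "r - N"] merit_ge[of r N] that by simp
  qed
  define a where "a = - (C + Cf - \<nu> * k) / \<mu>"
  define C2 where "C2 = (C + Cf + \<mu> * tX) / \<nu>"
  define b where "b = - C2 / \<mu> - tX"
  have lnX: "a \<le> ln (det (X r))" and psi_up: "psi \<mu> F0 F (x r, V r) \<le> C2" if "r \<ge> N" for r
  proof -
    have "k \<le> psi \<mu> F0 F (x r, V r)" using psi_low[of r] tr_nonneg[of r] by linarith
    then have "\<nu> * k \<le> \<nu> * psi \<mu> F0 F (x r, V r)" using params by (simp add: mult_left_mono)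
    with merit[OF that] f[of r] have "- \<mu> * ln (det (X r)) \<le> C + Cf - \<nu> * k" by linarith
    then show "a \<le> ln (det (X r))" unfolding a_def using \<mu> by (simp add: field_simps)
    have "\<mu> * ln (det (X r)) \<le> \<mu> * tX" using trX \<mu> by (simp add: mult_left_mono)
    with merit[OF that] f[of r] have "\<nu> * psi \<mu> F0 F (x r, V r) \<le> C + Cf + \<mu> * tX" by linarith
    then show "psi \<mu> F0 F (x r, V r) \<le> C2" unfolding C2_def using params by (simp add: field_simps)
  qed
  define K where "K = 2 * (C2 - k)"
  have trXV: "trace (X r ** V r) \<le> K" if "r \<ge> N" for r
    using psi_low[of r] psi_up[OF that] by (simp add: K_def)
  have lnV: "b \<le> ln (det (V r))" if "r \<ge> N" for r
  proof -
    have "trace (X r ** V r) - \<mu> * (ln (det (X r)) + ln (det (V r))) \<le> C2"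
      using psi_up[OF that] psi_eq[OF iterates_pd(1)[of r] iterates_pd(2)[of r]] by simp
    then have "- \<mu> * (ln (det (X r)) + ln (det (V r))) \<le> C2" using tr_nonneg[of r] by simp
    then have "- (ln (det (X r)) + ln (det (V r))) \<le> C2 / \<mu>" using \<mu> by (simp add: field_simps)
    then show ?thesis using trX[of r] unfolding b_def by simp
  qed
  have det_ge: "exp e \<le> det A" if "A \<in> pd_mats" "e \<le> ln (det A)" for e and A :: "real^'m^'m"
    using that pd_det_pos by (metis exp_ln exp_le_cancel_iff)
  obtain c1 where c1: "0 < c1" "\<And>r. r \<ge> N \<Longrightarrow> coercive c1 (X r)"
  proof (rule uniformly_coercive[of "{X r | r. r \<ge> N}" "exp a"])
    have "bounded (pencil F0 F ` closure (range x))"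
      using A3 by (intro compact_imp_bounded compact_continuous_image pencil_continuous) (simp add: compact_closure)
    then show "bounded {X r |r. N \<le> r}"
      by (rule bounded_subset) (use closure_subset[of "range x"] in auto)
  qed (use iterates_pd(1) det_ge lnX in auto)
  define tV where "tV = K / c1"
  have opV: "op_bound (V r) tV" if "r \<ge> N" for r
  proof -
    have "c1 * trace (V r) \<le> K"
      using trace_coercive_product[OF c1(2)[OF that] iterates_pd(2)[of r]] trXV[OF that] by simp
    then have "trace (V r) \<le> tV" unfolding tV_def using c1 by (simp add: field_simps)
    then show ?thesis using op_bound_mono[OF pd_op_bound_trace[OF iterates_pd(2)[of r]]] by simp
  qed
  obtain c2 where c2: "0 < c2" "\<And>r. r \<ge> N \<Longrightarrow> coercive c2 (V r)"
  proof (rule uniformly_coercive[of "{V r | r. r \<ge> N}" "exp b"])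
    show "bounded {V r |r. N \<le> r}" unfolding bounded_iff using norm_le_op_bound[OF opV] by blast
  qed (use iterates_pd(2) det_ge lnV in auto)
  show thesis
  proof (rule that[of "min c1 c2" "max tV K"])
    show "0 < min c1 c2" using c1 c2 by simp
    show "\<forall>r\<ge>N. coercive (min c1 c2) (X r) \<and> coercive (min c1 c2) (V r) \<and> op_bound (V r) (max tV K) \<and> trace (X r ** V r) \<le> max tV K"
    proof (intro allI impI conjI)
      fix r assume r: "N \<le> r"
      show "coercive (min c1 c2) (X r)" by (rule coercive_mono[OF c1(2)[OF r]]) simp
      show "coercive (min c1 c2) (V r)" by (rule coercive_mono[OF c2(2)[OF r]]) simp
      show "op_bound (V r) (max tV K)" by (rule op_bound_mono[OF opV[OF r]]) simp
      show "trace (X r ** V r) \<le> max tV K" using trXV[OF r] by simp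
    qed
  qed
qed

lemma z_bounded:
  obtains C where "\<And>r. norm (z (Suc r)) \<le> C"
proof -
  obtain R where R: "\<And>r. \<rho> r \<le> R" using A2 unfolding bounded_iff by (auto dest: abs_le_D1)
  have "norm (z (Suc r)) \<le> sqrt DIM(real^'s) * R" for r
  proof -
    have "norm (z (Suc r)) \<le> sqrt DIM(real^'s) * infnorm (z (Suc r))" by (rule norm_le_infnorm)
    also have "\<dots> \<le> sqrt DIM(real^'s) * R"
      using multiplier_bound(2)[of r] R[of "Suc r"] by (intro mult_left_mono) auto
    finally show ?thesis .
  qed
  then show thesis by (rule that)
qed

lemma Dg_bounded:
  obtains C where "0 < C" "\<And>v \<tau>. norm v \<le> M \<Longrightarrow> \<tau> \<in> T \<Longrightarrow> norm (Dg v \<tau>) \<le> C"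
proof -
  have "compact (cball (0::real^'n) M \<times> T)" using T(1) by (intro compact_Times compact_cball)
  moreover have "continuous_on (cball 0 M \<times> T) (\<lambda>(x, \<tau>). Dg x \<tau>)" using Dg_cont by (rule continuous_on_subset) auto
  ultimately have "bounded ((\<lambda>(x, \<tau>). Dg x \<tau>) ` (cball 0 M \<times> T))" by (intro compact_imp_bounded compact_continuous_image)
  then obtain C where "0 < C" "\<forall>w\<in>(\<lambda>(x, \<tau>). Dg x \<tau>) ` (cball 0 M \<times> T). norm w \<le> C" unfolding bounded_pos by blast
  then show thesis by (intro that[of C]) auto
qed

text \<open>
  The resolvent identity bounds differences of inverses on the set where \<open>F\<close> is uniformly
  coercive.
\<close>

lemma xi_lipschitz:
  assumes c: "0 < c"
  obtains C where "0 \<le> C" "\<forall>u v. coercive c (pencil F0 F u) \<longrightarrow> coercive c (pencil F0 F v) \<longrightarrow>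
      norm (xi F0 F u - xi F0 F v) \<le> C * norm (u - v)"
    "\<forall>u. coercive c (pencil F0 F u) \<longrightarrow> norm (xi F0 F u) \<le> C"
proof -
  define m where "m = real CARD('m)"
  obtain \<kappa> where \<kappa>: "0 < \<kappa>" "\<And>d. op_bound (lin_part F d) (\<kappa> * norm d)" using lin_part_op_bound by blast
  define C where "C = (\<Sum>i\<in>UNIV. m * (m * m * norm (F i) * (1 / c * \<kappa> * (1 / c)))) + (\<Sum>i\<in>UNIV. m * (m * m * norm (F i) * (1 / c)))"
  have pd: "pencil F0 F u \<in> pd_mats" if "coercive c (pencil F0 F u)" for u
    using pencil_sym c that by (rule coercive_pd)
  have p: "0 \<le> (\<Sum>i\<in>UNIV. m * (m * m * norm (F i) * (1 / c * \<kappa> * (1 / c))))"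
    "0 \<le> (\<Sum>i\<in>UNIV. m * (m * m * norm (F i) * (1 / c)))"
    using c \<kappa> by (auto intro!: sum_nonneg simp: m_def)
  have C: "0 \<le> C" using p unfolding C_def by linarith
  have lip: "norm (xi F0 F u - xi F0 F v) \<le> C * norm (u - v)"
    if u: "coercive c (pencil F0 F u)" and v: "coercive c (pencil F0 F v)" for u v
  proof -
    have "pencil F0 F v - pencil F0 F u = lin_part F (v - u)"
      using pencil_add_scaled[of F0 F u 1 "v - u"] by simp
    with inverse_diff[OF pd[OF v] pd[OF u]]
    have eq: "matrix_inv (pencil F0 F u) - matrix_inv (pencil F0 F v) = matrix_inv (pencil F0 F u) ** lin_part F (v - u) ** matrix_inv (pencil F0 F v)"
      by simp
    have "\<bar>(xi F0 F u - xi F0 F v) $ i\<bar> \<le> m * (m * m * norm (F i) * (1 / c * \<kappa> * (1 / c))) * norm (u - v)" for i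
    proof -
      have "(xi F0 F u - xi F0 F v) $ i = trace (F i ** (matrix_inv (pencil F0 F u) - matrix_inv (pencil F0 F v)))"
        by (simp add: xi_def mat_inner_def matrix_diff_ldistrib trace_sub)
      moreover have "op_bound (F i ** (matrix_inv (pencil F0 F u) - matrix_inv (pencil F0 F v)))
          (m * m * norm (F i) * (1 / c * (\<kappa> * norm (v - u)) * (1 / c)))"
        unfolding eq m_def by (intro op_bound_mult op_bound_norm op_bound_inverse pd u v c \<kappa>)
      ultimately show ?thesis using op_bound_trace[of "F i ** (matrix_inv (pencil F0 F u) - matrix_inv (pencil F0 F v))"]
        by (fastforce simp: m_def norm_minus_commute mult_ac)
    qed
    then have "norm (xi F0 F u - xi F0 F v) \<le> (\<Sum>i\<in>UNIV. m * (m * m * norm (F i) * (1 / c * \<kappa> * (1 / c))) * norm (u - v))"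
      by (intro order_trans[OF norm_le_l1_cart] sum_mono)
    also have "\<dots> = (\<Sum>i\<in>UNIV. m * (m * m * norm (F i) * (1 / c * \<kappa> * (1 / c)))) * norm (u - v)"
      by (rule sum_distrib_right[symmetric])
    also have "\<dots> \<le> C * norm (u - v)" unfolding C_def using p by (intro mult_right_mono) auto
    finally show ?thesis .
  qed
  have bd: "norm (xi F0 F u) \<le> C" if u: "coercive c (pencil F0 F u)" for u
  proof -
    have "\<bar>xi F0 F u $ i\<bar> \<le> m * (m * m * norm (F i) * (1 / c))" for i
    proof -
      have "op_bound (F i ** matrix_inv (pencil F0 F u)) (m * m * norm (F i) * (1 / c))"
        unfolding m_def by (intro op_bound_mult op_bound_norm op_bound_inverse pd u c)
      from op_bound_trace[OF this] show ?thesis by (simp add: xi_def mat_inner_def m_def)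
    qed
    then have "norm (xi F0 F u) \<le> (\<Sum>i\<in>UNIV. m * (m * m * norm (F i) * (1 / c)))"
      by (intro order_trans[OF norm_le_l1_cart] sum_mono)
    then show ?thesis using p unfolding C_def by linarith
  qed
  from C lip bd show thesis by (intro that) blast+
qed

text \<open>
  Collects the constants on which the error terms of the line search depend, from an index on after which
  the penalty parameter is constant.
\<close>

definition uniform_bounds :: "nat \<Rightarrow> real \<Rightarrow> real \<Rightarrow> bool" where
  "uniform_bounds N c K \<longleftrightarrow> 0 < c \<and> 0 < K \<and> (\<forall>r\<ge>N. \<rho> r = \<rho> N \<and> coercive c (X r) \<and> coercive c (V r) \<and>
     op_bound (V r) K \<and> trace (X r ** V r) \<le> K \<and> norm (dx r) \<le> K \<and> op_bound (L r) K \<and> op_bound (dV r) K)"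

text \<open>
  The primal direction is bounded because \<open>B\<^sub>r dx\<^sub>r\<close> equals an expression in
  bounded quantities and \<open>B\<^sub>r \<succeq> \<eta>\<^sub>1 I\<close>; the bound on the direction in
  \<open>V\<close> follows from \<open>newton_V_structure\<close>.
\<close>

lemma uniform_bounds: obtains N c K where "uniform_bounds N c K"
proof -
  obtain N where N: "\<forall>r\<ge>N. \<rho> r = \<rho> N" by (rule \<rho>_eventually)
  obtain c K where c: "0 < c"
    and cK: "\<forall>r\<ge>N. coercive c (X r) \<and> coercive c (V r) \<and> op_bound (V r) K \<and> trace (X r ** V r) \<le> K"
    by (rule primal_dual_bounds[OF N])
  obtain M where M: "0 < M" "\<And>r. norm (x r) \<le> M" using x_bounded by blast
  obtain Cf where Cf: "\<And>v. norm v \<le> M \<Longrightarrow> norm (grad f v) \<le> Cf" using bounded_on_ball[OF f_cont, of M] by blast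
  obtain Cg where Cg: "0 < Cg" "\<And>v \<tau>. norm v \<le> M \<Longrightarrow> \<tau> \<in> T \<Longrightarrow> norm (Dg v \<tau>) \<le> Cg" using Dg_bounded[of M] by blast
  obtain Cz where Cz: "\<And>r. norm (z (Suc r)) \<le> Cz" using z_bounded by blast
  obtain C\<xi> where "0 \<le> C\<xi>" and "\<forall>u v. coercive c (pencil F0 F u) \<longrightarrow> coercive c (pencil F0 F v) \<longrightarrow>
      norm (xi F0 F u - xi F0 F v) \<le> C\<xi> * norm (u - v)"
    and C\<xi>: "\<forall>u. coercive c (pencil F0 F u) \<longrightarrow> norm (xi F0 F u) \<le> C\<xi>"
    by (rule xi_lipschitz[OF c])
  obtain CG where CG: "0 < CG" "\<And>w. norm (transpose G *v w) \<le> norm w * CG"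
    using bounded_linear.pos_bounded[OF matrix_vector_mul_bounded_linear[of "transpose G"]] by blast
  obtain \<kappa> where \<kappa>: "0 < \<kappa>" "\<And>d. op_bound (lin_part F d) (\<kappa> * norm d)" using lin_part_op_bound by blast
  define D where "D = (Cf + \<mu> * C\<xi> + Cg * \<rho> N + Cz * CG) / \<eta>1"
  have dx: "norm (dx r) \<le> D" if r: "r \<ge> N" for r
  proof -
    have \<rho>S: "\<rho> (Suc r) = \<rho> N" by (rule N[rule_format]) (use r in simp)
    have 1: "norm (grad f (x r)) \<le> Cf" using Cf M(2) by blast
    have 2: "norm (\<mu> *\<^sub>R xi F0 F (x r)) \<le> \<mu> * C\<xi>" using C\<xi>[rule_format, of "x r"] cK r \<mu> by (simp add: mult_left_mono)
    have "norm (signed_integral T (y (Suc r)) (Dg (x r))) \<le> Cg * tv_norm T (y (Suc r))"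
      using Cg(2)[OF M(2)[of r]] by (intro norm_signed_integral_le y_nonneg T Dg_continuous)
    also have "\<dots> \<le> Cg * \<rho> N" using multiplier_bound(1)[of r] Cg(1) by (simp add: \<rho>S mult_left_mono)
    finally have 3: "norm (signed_integral T (y (Suc r)) (Dg (x r))) \<le> Cg * \<rho> N" .
    have "norm (transpose G *v z (Suc r)) \<le> norm (z (Suc r)) * CG" by (rule CG(2))
    also have "\<dots> \<le> Cz * CG" using Cz CG(1) by (intro mult_right_mono) auto
    finally have 4: "norm (transpose G *v z (Suc r)) \<le> Cz * CG" .
    have "B r *v dx r = - (grad f (x r) - \<mu> *\<^sub>R xi F0 F (x r) + signed_integral T (y (Suc r)) (Dg (x r)) + transpose G *v z (Suc r))"
      using step_eq[of r] by (simp add: algebra_simps eq_neg_iff_add_eq_0 del: transpose_matrix_vector)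
    then have "norm (B r *v dx r) = norm (grad f (x r) - \<mu> *\<^sub>R xi F0 F (x r) + signed_integral T (y (Suc r)) (Dg (x r)) + transpose G *v z (Suc r))"
      by (simp only: norm_minus_cancel)
    moreover have tri: "norm (a - b + c + d) \<le> norm a + norm b + norm c + norm d" for a b c d :: "real^'n"
      using norm_triangle_ineq[of "a - b + c" d] norm_triangle_ineq[of "a - b" c] norm_triangle_ineq4[of a b] by linarith
    ultimately have "norm (B r *v dx r) \<le> Cf + \<mu> * C\<xi> + Cg * \<rho> N + Cz * CG"
      using 1 2 3 4 tri[of "grad f (x r)" "\<mu> *\<^sub>R xi F0 F (x r)" "signed_integral T (y (Suc r)) (Dg (x r))" "transpose G *v z (Suc r)"]
      by linarith
    moreover have "\<eta>1 * norm (dx r) \<le> norm (B r *v dx r)"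
    proof -
      have "\<eta>1 * (dx r \<bullet> dx r) \<le> norm (dx r) * norm (B r *v dx r)"
        using B_quadratic(1)[of "dx r" r] norm_cauchy_schwarz[of "dx r" "B r *v dx r"] by linarith
      then have "norm (dx r) * (\<eta>1 * norm (dx r)) \<le> norm (dx r) * norm (B r *v dx r)"
        by (simp add: power2_norm_eq_inner[symmetric] power2_eq_square mult_ac)
      then show ?thesis by (cases "dx r = 0") auto
    qed
    ultimately show ?thesis unfolding D_def using B_consts by (simp add: field_simps)
  qed
  have Lb: "op_bound (L r) (\<kappa> * D)" if "r \<ge> N" for r
    using dx[OF that] \<kappa>(1) by (intro op_bound_mono[OF \<kappa>(2)]) simp
  define KV where "KV = \<bar>\<mu>\<bar> * (1 / c) + K + K * (\<kappa> * D) / c"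
  have Vb: "op_bound (dV r) KV" if r: "r \<ge> N" for r
  proof -
    obtain Z where Z: "newton_V \<mu> F0 F (P r) (x r) (V r) (dx r) = \<mu> *\<^sub>R matrix_inv (X r) - V r - Z" and "Z \<in> sym_mats"
      and "trace (X r ** Z) = trace (L r ** V r)" "trace (matrix_inv (V r) ** Z) = trace (matrix_inv (X r) ** L r)"
      and Zb: "\<forall>c C K. 0 < c \<longrightarrow> coercive c (X r) \<longrightarrow> op_bound (V r) C \<longrightarrow> op_bound (L r) K \<longrightarrow> op_bound Z (C * K / c)"
      by (rule newton_V_structure[OF iterates_pd(1) F iterates_pd(2) A1[rule_format, of r]])
    show ?thesis unfolding dV Z KV_def
      using cK r c Lb[OF r] by (intro op_bound_diff op_bound_scaleR op_bound_inverse iterates_pd Zb[rule_format]) auto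
  qed
  show thesis
  proof (rule that)
    let ?K = "max 1 (max K (max D (max (\<kappa> * D) KV)))"
    show "uniform_bounds N c ?K"
      unfolding uniform_bounds_def
    proof (intro conjI allI impI)
      fix r assume r: "N \<le> r"
      show "\<rho> r = \<rho> N" using N r by blast
      show "coercive c (X r)" "coercive c (V r)" using cK r by auto
      show "op_bound (V r) ?K" using cK r by (auto intro: op_bound_mono)
      show "trace (X r ** V r) \<le> ?K" using cK r by auto
      show "norm (dx r) \<le> ?K" using dx[OF r] by auto
      show "op_bound (L r) ?K" by (rule op_bound_mono[OF Lb[OF r]]) simp
      show "op_bound (dV r) ?K" by (rule op_bound_mono[OF Vb[OF r]]) simp
    qed (use c in auto)
  qed
qed

end

section \<open>The line search and the vanishing of the predicted decrease\<close>

context bounded_run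
begin

lemma uniform_boundsD:
  assumes U: "uniform_bounds N c K" and r: "r \<ge> N"
  shows "\<rho> r = \<rho> N" "coercive c (X r)" "coercive c (V r)" "op_bound (V r) K" "trace (X r ** V r) \<le> K"
    "norm (dx r) \<le> K" "op_bound (L r) K" "op_bound (dV r) K"
  using assms unfolding uniform_bounds_def by blast+

text \<open>
  Pair the step equation with \<open>dx\<^sub>r\<close>. The equality multiplier drops out since \<open>G
  dx\<^sub>r = 0\<close>, and by complementarity the integral of \<open>\<nabla>g \<bullet>
  dx\<^sub>r\<close> is minus that of \<open>g\<close>, which the penalty term absorbs once the penalty
  parameter dominates the mass of the multiplier.
\<close>

lemma descent_direction:
  assumes \<rho>: "tv_norm T (y (Suc r)) \<le> p"
  shows "grad f (x r) \<bullet> dx r - \<mu> * (xi F0 F (x r) \<bullet> dx r) \<le> - (dx r \<bullet> (B r *v dx r)) + p * max_pos_part T (g (x r))"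
proof -
  let ?I = "signed_integral T (y (Suc r)) (Dg (x r))"
  interpret compact_signed T "y (Suc r)" by (rule nonneg_measuresD[OF y_nonneg T(1)])
  have bl: "bounded_linear (\<lambda>v. v \<bullet> dx r)" by (rule bounded_linear_inner_left)
  have c: "continuous_on T (\<lambda>\<tau>. Dg (x r) \<tau> \<bullet> dx r)" by (intro continuous_intros Dg_continuous)
  have "?I \<bullet> dx r = signed_integral T (y (Suc r)) (\<lambda>\<tau>. Dg (x r) \<tau> \<bullet> dx r)"
    using signed_integral_linear[OF Dg_continuous bl] by simp
  moreover have "signed_integral T (y (Suc r)) (g (x r)) + signed_integral T (y (Suc r)) (\<lambda>\<tau>. Dg (x r) \<tau> \<bullet> dx r) = 0"
    using signed_integral_add[OF g_continuous c] step_compl by metis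
  ultimately have I: "?I \<bullet> dx r = - signed_integral T (y (Suc r)) (g (x r))" by linarith
  have "signed_integral T (y (Suc r)) (g (x r)) \<le> max_pos_part T (g (x r)) * tv_norm T (y (Suc r))"
    using max_pos_part_bounds(1)[OF T g_continuous]
    by (intro signed_integral_le y_nonneg T g_continuous)
  also have "\<dots> \<le> max_pos_part T (g (x r)) * p"
    using \<rho> max_pos_part_bounds(2)[OF T g_continuous] by (intro mult_left_mono)
  finally have int: "signed_integral T (y (Suc r)) (g (x r)) \<le> p * max_pos_part T (g (x r))" by (simp add: mult.commute)
  have Gz: "(transpose G *v z (Suc r)) \<bullet> dx r = 0"
    by (simp add: dot_lmul_matrix G_dx)
  have "(grad f (x r) + B r *v dx r - \<mu> *\<^sub>R xi F0 F (x r) + ?I + transpose G *v z (Suc r)) \<bullet> dx r = 0"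
    unfolding step_eq by simp
  then have "grad f (x r) \<bullet> dx r + dx r \<bullet> (B r *v dx r) - \<mu> * (xi F0 F (x r) \<bullet> dx r) + ?I \<bullet> dx r = 0"
    using Gz by (simp add: inner_add_left inner_diff_left inner_commute[of "B r *v dx r"] del: transpose_matrix_vector)
  with I int show ?thesis by linarith
qed

text \<open>
  By convexity the new constraint value is at most the convex combination of the old one and its
  linearization at the full step, which is at most \<open>\<gamma>\<^sub>r\<close>, plus the change of
  gradient.
\<close>

lemma max_pos_part_step:
  assumes t: "0 \<le> t" "t \<le> 1" and e: "0 \<le> e"
    and near: "\<And>\<tau>. \<tau> \<in> T \<Longrightarrow> norm (Dg (x r + t *\<^sub>R dx r) \<tau> - Dg (x r) \<tau>) * norm (dx r) \<le> e"
  shows "max_pos_part T (g (x r + t *\<^sub>R dx r)) \<le> (1 - t) * max_pos_part T (g (x r)) + t * \<gamma> r + t * e"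
proof (rule max_pos_part_le[OF T(2)])
  let ?mp = "max_pos_part T (g (x r))"
  have mp: "0 \<le> ?mp" by (rule max_pos_part_bounds(2)[OF T g_continuous])
  show "0 \<le> (1 - t) * ?mp + t * \<gamma> r + t * e" using t e mp \<gamma>_nonneg[of r] by simp
  fix \<tau> assume \<tau>: "\<tau> \<in> T"
  let ?D = "Dg (x r + t *\<^sub>R dx r) \<tau>"
  have glin: "continuous_on T (\<lambda>\<tau>. g (x r) \<tau> + Dg (x r) \<tau> \<bullet> dx r)" by (intro continuous_intros g_continuous Dg_continuous)
  have "g (x r + t *\<^sub>R dx r) \<tau> \<le> g (x r) \<tau> + ?D \<bullet> (t *\<^sub>R dx r)"
    by (rule convex_descent_ineq[OF g_diff[OF \<tau>] g_conv[OF \<tau>]])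
  also have "\<dots> = (1 - t) * g (x r) \<tau> + t * (g (x r) \<tau> + Dg (x r) \<tau> \<bullet> dx r) + t * ((?D - Dg (x r) \<tau>) \<bullet> dx r)"
    by (simp add: algebra_simps)
  also have "\<dots> \<le> (1 - t) * ?mp + t * \<gamma> r + t * e"
  proof (intro add_mono mult_left_mono)
    show "g (x r) \<tau> \<le> ?mp" by (rule max_pos_part_bounds(1)[OF T g_continuous \<tau>])
    show "g (x r) \<tau> + Dg (x r) \<tau> \<bullet> dx r \<le> \<gamma> r"
      using max_pos_part_bounds(1)[OF T glin \<tau>] step_feas[of r] by linarith
    show "(?D - Dg (x r) \<tau>) \<bullet> dx r \<le> e" using norm_cauchy_schwarz[of "?D - Dg (x r) \<tau>" "dx r"] near[OF \<tau>] by linarith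
  qed (use t in auto)
  finally show "g (x r + t *\<^sub>R dx r) \<tau> \<le> (1 - t) * ?mp + t * \<gamma> r + t * e" .
qed

text \<open>
  Add up the first-order estimates of the four summands of the merit function. The slope is at most \<open>-
  Q\<^sub>r + \<rho> \<gamma>\<^sub>r\<close> by \<open>descent_direction\<close>, while the test asks only
  for \<open>- \<alpha> Q\<^sub>r + \<rho> \<gamma>\<^sub>r\<close>; the margin \<open>(1 - \<alpha>)
  \<epsilon>\<close> is split evenly between the moduli of continuity of the gradients and the quadratic
  error terms.
\<close>

lemma armijo_uniform:
  assumes U: "uniform_bounds N c K" and \<epsilon>: "0 < \<epsilon>"
  obtains t0 where "0 < t0" "\<forall>r\<ge>N. \<epsilon> \<le> Q r \<longrightarrow> (\<forall>t. 0 \<le> t \<and> t \<le> t0 \<longrightarrow> armijo r t)"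
proof -
  have c: "0 < c" and K: "0 < K" using U by (auto simp: uniform_bounds_def)
  obtain M where M: "0 < M" "\<And>r. norm (x r) \<le> M" using x_bounded by blast
  define p where "p = \<rho> N"
  have p: "0 < p" using \<rho>_pos by (simp add: p_def)
  define \<epsilon>1 where "\<epsilon>1 = ((1 - \<alpha>) * \<epsilon> / 2) / (K * (1 + p))"
  have \<epsilon>1: "0 < \<epsilon>1" using params \<epsilon> K p by (simp add: \<epsilon>1_def)
  obtain \<delta>f where \<delta>f: "0 < \<delta>f" "\<forall>u u'. norm u \<le> M + K \<longrightarrow> norm u' \<le> M + K \<longrightarrow> dist u' u < \<delta>f \<longrightarrow> dist (grad f u') (grad f u) < \<epsilon>1"
    by (rule uniform_modulus_single[OF f_cont \<epsilon>1])
  obtain \<delta>g where \<delta>g: "0 < \<delta>g" "\<forall>u u'. \<forall>\<tau>\<in>T. norm u \<le> M + K \<longrightarrow> norm u' \<le> M + K \<longrightarrow> dist u' u < \<delta>g \<longrightarrow> dist (Dg u' \<tau>) (Dg u \<tau>) < \<epsilon>1"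
    by (rule uniform_modulus[OF T(1) Dg_cont \<epsilon>1])
  define m where "m = real CARD('m)"
  define E1 where "E1 = 2 * m * K\<^sup>2 / c\<^sup>2"
  define E2 where "E2 = m * K\<^sup>2 + 2 * \<mu> * E1"
  define E3 where "E3 = \<mu> * E1 + \<nu> * E2 + 1"
  have E: "0 \<le> E1" "0 \<le> E2" "0 < E3" using c \<mu> params by (simp_all add: E1_def E2_def E3_def m_def add_nonneg_pos)
  \<comment> \<open>The five bounds keep the trial point in the ball of radius \<open>M + K\<close>, keep the trial matrices positive definite, respect the two moduli of continuity, and control the quadratic errors.\<close>
  define t0 where "t0 = Min {1, c / (2 * K), \<delta>f / (2 * K), \<delta>g / (2 * K), (1 - \<alpha>) * \<epsilon> / (2 * E3)}"
  have "0 < t0" unfolding t0_def using c K \<delta>f \<delta>g E \<epsilon> params by (simp add: Min_gr_iff)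
  moreover have "armijo r t" if r: "r \<ge> N" and Qr: "\<epsilon> \<le> Q r" and t: "0 \<le> t" "t \<le> t0" for r t
  proof -
    have "t \<le> 1" "t \<le> c / (2 * K)" "t \<le> \<delta>f / (2 * K)" "t \<le> \<delta>g / (2 * K)" "t \<le> (1 - \<alpha>) * \<epsilon> / (2 * E3)"
      using t(2) unfolding t0_def by (simp_all add: Min_ge_iff)
    then have t1: "t \<le> 1" and tc: "t * K \<le> c / 2" and tf: "t * K < \<delta>f" and tg: "t * K < \<delta>g" and tE: "t * E3 \<le> (1 - \<alpha>) * \<epsilon> / 2"
      using K E \<delta>f(1) \<delta>g(1) by (simp_all add: field_simps)
    have \<rho>N: "\<rho> (Suc r) = p" and cX: "coercive c (X r)" and cV: "coercive c (V r)" and dx: "norm (dx r) \<le> K"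
      and Lb: "op_bound (L r) K" and dVb: "op_bound (dV r) K"
      using uniform_boundsD[OF U, of "Suc r"] uniform_boundsD[OF U r] r unfolding p_def by (simp_all only: le_SucI)
    have near: "norm (x r + t' *\<^sub>R dx r) \<le> M + K \<and> dist (x r + t' *\<^sub>R dx r) (x r) \<le> t * K" if "0 \<le> t'" "t' \<le> t" for t'
    proof -
      have n: "norm (t' *\<^sub>R dx r) \<le> t * K" using that dx K by (auto intro!: mult_mono)
      have "t * K \<le> K" using t1 K by simp
      then show ?thesis using n norm_triangle_ineq[of "x r" "t' *\<^sub>R dx r"] M(2)[of r] by (auto simp: dist_norm)
    qed
    have xM: "norm (x r) \<le> M + K" using M(2)[of r] K by linarith
    define a where "a = grad f (x r) \<bullet> dx r"
    have est_f: "f (x r + t *\<^sub>R dx r) \<le> f (x r) + t * a + t * (\<epsilon>1 * K)"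
    proof -
      obtain t' where t': "0 \<le> t'" "t' \<le> t" "f (x r + t *\<^sub>R dx r) - f (x r) = t * (grad f (x r + t' *\<^sub>R dx r) \<bullet> dx r)"
        by (rule mean_value_along_line[OF f_diff t(1)])
      have "norm (grad f (x r + t' *\<^sub>R dx r) - grad f (x r)) \<le> \<epsilon>1"
        using \<delta>f(2) near[OF t'(1,2)] xM tf unfolding dist_norm[of "grad f _"] by (meson less_imp_le le_less_trans)
      then have "norm (grad f (x r + t' *\<^sub>R dx r) - grad f (x r)) * norm (dx r) \<le> \<epsilon>1 * K"
        using dx \<epsilon>1 by (intro mult_mono) auto
      then have "(grad f (x r + t' *\<^sub>R dx r) - grad f (x r)) \<bullet> dx r \<le> \<epsilon>1 * K"
        using norm_cauchy_schwarz order_trans by blast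
      then have "grad f (x r + t' *\<^sub>R dx r) \<bullet> dx r \<le> a + \<epsilon>1 * K" by (simp add: a_def inner_diff_left)
      from mult_left_mono[OF this t(1)] t'(3) show ?thesis by (simp add: algebra_simps)
    qed
    define b where "b = xi F0 F (x r) \<bullet> dx r"
    have est_barrier: "- \<mu> * ln (det (pencil F0 F (x r + t *\<^sub>R dx r))) \<le> - \<mu> * ln (det (X r)) - t * (\<mu> * b) + t\<^sup>2 * (\<mu> * E1)"
    proof -
      have "t * b - t\<^sup>2 * E1 \<le> ln (det (X r + t *\<^sub>R L r)) - ln (det (X r))"
        unfolding b_def E1_def m_def xi_inner by (rule ln_det_expansion(3)[OF pencil_sym cX c L_sym Lb t(1) tc])
      from mult_left_mono[OF this less_imp_le[OF \<mu>]] show ?thesis by (simp add: pencil_add_scaled algebra_simps)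
    qed
    define mp where "mp = max_pos_part T (g (x r))"
    have est_penalty: "p * max_pos_part T (g (x r + t *\<^sub>R dx r)) \<le> p * ((1 - t) * mp + t * \<gamma> r + t * (\<epsilon>1 * K))"
    proof (intro mult_left_mono)
      have "norm (Dg (x r + t *\<^sub>R dx r) \<tau> - Dg (x r) \<tau>) * norm (dx r) \<le> \<epsilon>1 * K" if \<tau>: "\<tau> \<in> T" for \<tau>
      proof (rule mult_mono)
        have "dist (Dg (x r + t *\<^sub>R dx r) \<tau>) (Dg (x r) \<tau>) < \<epsilon>1"
          using \<delta>g(2) near[OF t(1) order_refl] xM tg \<tau> by (meson le_less_trans)
        then show "norm (Dg (x r + t *\<^sub>R dx r) \<tau> - Dg (x r) \<tau>) \<le> \<epsilon>1" by (simp add: dist_norm)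
      qed (use dx \<epsilon>1 in auto)
      then show "max_pos_part T (g (x r + t *\<^sub>R dx r)) \<le> (1 - t) * mp + t * \<gamma> r + t * (\<epsilon>1 * K)"
        unfolding mp_def using \<epsilon>1 K by (intro max_pos_part_step t(1) t1) auto
    qed (use p in simp)
    have est_psi: "psi \<mu> F0 F (x r + t *\<^sub>R dx r, V r + t *\<^sub>R dV r) \<le> psi \<mu> F0 F (x r, V r) - t * gap r + t\<^sup>2 * E2"
    proof -
      have "\<bar>psi \<mu> F0 F (x r + t *\<^sub>R dx r, V r + t *\<^sub>R dV r) - psi \<mu> F0 F (x r, V r) - t * psi_slope \<mu> (X r) (V r) (L r) (dV r)\<bar> \<le> t\<^sup>2 * E2"
        unfolding E2_def E1_def m_def
        by (rule psi_expansion[OF F0 F pd_matsD(1)[OF iterates_pd(2)] dV_sym[OF iterates_pd] c cX cV Lb dVb less_imp_le[OF \<mu>] t(1) tc])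
      moreover have "psi_slope \<mu> (X r) (V r) (L r) (dV r) = - gap r"
        unfolding dV by (intro psi_slope_newton(1) iterates_pd F A1[rule_format])
      ultimately show ?thesis by (simp add: abs_le_iff)
    qed
    have est_psi': "\<nu> * psi \<mu> F0 F (x r + t *\<^sub>R dx r, V r + t *\<^sub>R dV r) \<le> \<nu> * psi \<mu> F0 F (x r, V r) - t * (\<nu> * gap r) + t\<^sup>2 * (\<nu> * E2)"
      using mult_left_mono[OF est_psi less_imp_le[OF params(10)]] by (simp add: algebra_simps)
    define q where "q = dx r \<bullet> (B r *v dx r)"
    have "a - \<mu> * b \<le> - q + p * mp"
      unfolding a_def b_def q_def mp_def by (rule descent_direction) (use multiplier_bound(1)[of r] \<rho>N in simp)
    from mult_left_mono[OF this t(1)] have key: "t * a - t * (\<mu> * b) \<le> - (t * q) + t * (p * mp)" by (simp add: algebra_simps)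
    have lin: "G *v (x r + t *\<^sub>R dx r) = h" by (simp add: matrix_vector_right_distrib feasible_eq matrix_vector_mult_scaleR G_dx)
    have "\<Phi> p (x r + t *\<^sub>R dx r) (V r + t *\<^sub>R dV r)
      \<le> \<Phi> p (x r) (V r) - t * Q r + p * t * \<gamma> r + t * (\<epsilon>1 * K * (1 + p)) + t\<^sup>2 * (\<mu> * E1 + \<nu> * E2)"
      unfolding merit_eq[OF lin] merit_eq[OF feasible_eq]
      using est_f est_barrier est_penalty est_psi' key unfolding Q_def q_def mp_def by (simp add: algebra_simps)
    moreover have "t * (\<epsilon>1 * K * (1 + p)) + t\<^sup>2 * (\<mu> * E1 + \<nu> * E2) \<le> t * ((1 - \<alpha>) * Q r)"
    proof -
      have "K * (1 + p) \<noteq> 0" using K p by auto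
      then have "\<epsilon>1 * (K * (1 + p)) = (1 - \<alpha>) * \<epsilon> / 2" unfolding \<epsilon>1_def by (rule nonzero_eq_divide_eq[THEN iffD1, OF _ refl])
      then have "\<epsilon>1 * K * (1 + p) = (1 - \<alpha>) * \<epsilon> / 2" by (simp only: mult.assoc)
      moreover have "t * (\<mu> * E1 + \<nu> * E2) \<le> t * E3" using t by (intro mult_left_mono) (auto simp: E3_def)
      moreover have "(1 - \<alpha>) * \<epsilon> \<le> (1 - \<alpha>) * Q r" using Qr params by (intro mult_left_mono) auto
      ultimately have "\<epsilon>1 * K * (1 + p) + t * (\<mu> * E1 + \<nu> * E2) \<le> (1 - \<alpha>) * Q r" using tE by linarith
      from mult_left_mono[OF this t(1)] show ?thesis by (simp add: power2_eq_square algebra_simps)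
    qed
    ultimately have "\<Phi> p (x r + t *\<^sub>R dx r) (V r + t *\<^sub>R dV r)
      \<le> \<Phi> p (x r) (V r) - \<alpha> * t * Q r + p * t * \<gamma> r" by (simp add: algebra_simps)
    then show ?thesis using armijo_iff[of r t] unfolding \<rho>N by blast
  qed
  ultimately show thesis by (intro that) blast+
qed

text \<open>
  Either the first trial step is accepted, and it is bounded below by \<open>step_bound\<close>, or the last
  rejected trial step exceeds the threshold of \<open>armijo_uniform\<close>.
\<close>

lemma step_lower:
  assumes U: "uniform_bounds N c K" and \<epsilon>: "0 < \<epsilon>"
  obtains s0 where "0 < s0" "\<forall>r\<ge>N. \<epsilon> \<le> Q r \<longrightarrow> s0 \<le> s r"
proof -
  obtain t0 where t0: "0 < t0" "\<forall>r\<ge>N. \<epsilon> \<le> Q r \<longrightarrow> (\<forall>t. 0 \<le> t \<and> t \<le> t0 \<longrightarrow> armijo r t)"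
    by (rule armijo_uniform[OF U \<epsilon>])
  define b where "b = min 1 (\<sigma> * c / K)"
  have cK: "0 < c" "0 < K" using U by (auto simp: uniform_bounds_def)
  have b: "0 < b" using cK params by (simp add: b_def)
  have "min b (t0 * \<beta>1) \<le> s r" if r: "r \<ge> N" "\<epsilon> \<le> Q r" for r
  proof -
    have "b \<le> step_bound \<sigma> (X r) (L r)" "b \<le> step_bound \<sigma> (V r) (dV r)"
      unfolding b_def using uniform_boundsD[OF U r(1)] params cK
      by (auto intro!: step_bound(3) iterates_pd L_sym dV_sym)
    then have sb: "b \<le> sbar r" by (simp add: sbar_def b_def)
    obtain l where l: "\<And>k. k < l \<Longrightarrow> \<not> armijo r (sbar r * \<beta>1 ^ k)" "s r = sbar r * \<beta>1 ^ l"
      using line_search[of r] by blast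
    show ?thesis
    proof (cases l)
      case 0 then show ?thesis using l sb by simp
    next
      case (Suc k)
      then have "\<not> armijo r (sbar r * \<beta>1 ^ k)" by (intro l) simp
      moreover have "0 \<le> sbar r * \<beta>1 ^ k" using steps(1)[of r] params by simp
      ultimately have "t0 < sbar r * \<beta>1 ^ k" using t0(2) r by (meson not_le)
      then have "t0 * \<beta>1 \<le> sbar r * \<beta>1 ^ k * \<beta>1" using params by simp
      then show ?thesis using l(2) Suc by (simp add: mult_ac)
    qed
  qed
  then show thesis using b t0(1) params by (intro that[of "min b (t0 * \<beta>1)"]) auto
qed

text \<open>
  The merit function is bounded below, so \<open>\<Sum>\<^sub>r s\<^sub>r Q\<^sub>r\<close> converges;
  whenever \<open>Q\<^sub>r \<ge> e\<close> the term \<open>s\<^sub>r Q\<^sub>r\<close> is at least a fixed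
  positive number, which can happen only finitely often.
\<close>

lemma Q_tendsto:
  assumes U: "uniform_bounds N c K"
  shows "Q \<longlonglongrightarrow> 0"
proof -
  have N: "\<forall>r\<ge>N. \<rho> r = \<rho> N" using uniform_boundsD(1)[OF U] by blast
  obtain C where C: "\<And>n. \<Phi> (\<rho> N) (x (N + n)) (V (N + n)) + \<alpha> * (\<Sum>k<n. s (N + k) * Q (N + k)) \<le> C"
    using merit_upper[OF N] by blast
  obtain Cf tX k where bounds: "\<forall>r. - f (x r) \<le> Cf \<and> ln (det (X r)) \<le> tX \<and> 0 \<le> trace (X r ** V r) \<and>
    trace (X r ** V r) / 2 + k \<le> psi \<mu> F0 F (x r, V r)" by (rule merit_summand_bounds)
  have low: "- Cf - \<mu> * tX + \<nu> * k \<le> \<Phi> (\<rho> N) (x r) (V r)" for r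
  proof -
    have "\<mu> * ln (det (X r)) \<le> \<mu> * tX" using bounds \<mu> by (intro mult_left_mono) auto
    moreover have "k \<le> psi \<mu> F0 F (x r, V r)" using bounds[rule_format, of r] by linarith
    then have "\<nu> * k \<le> \<nu> * psi \<mu> F0 F (x r, V r)" using params by (intro mult_left_mono) auto
    moreover have "- f (x r) \<le> Cf" using bounds by blast
    ultimately show ?thesis using merit_ge[of r N] by linarith
  qed
  have sQ: "0 \<le> s r * Q r" for r using steps(3)[of r] Q_bounds(3)[of r] by simp
  have "(\<Sum>k<n. s (N + k) * Q (N + k)) \<le> (C + Cf + \<mu> * tX - \<nu> * k) / \<alpha>" for n
    using C[of n] low[of "N + n"] params by (simp add: field_simps)
  then have "summable (\<lambda>k. s (N + k) * Q (N + k))" using sQ by (intro summableI_nonneg_bounded)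
  then have "(\<lambda>k. s (N + k) * Q (N + k)) \<longlonglongrightarrow> 0" by (rule summable_LIMSEQ_zero)
  then have sQ0: "(\<lambda>r. s r * Q r) \<longlonglongrightarrow> 0" using LIMSEQ_offset[of "\<lambda>r. s r * Q r" N] by (simp add: add.commute)
  show ?thesis
  proof (rule LIMSEQ_I)
    fix e :: real assume e: "0 < e"
    obtain s0 where s0: "0 < s0" "\<forall>r\<ge>N. e \<le> Q r \<longrightarrow> s0 \<le> s r" by (rule step_lower[OF U e])
    obtain N1 where N1: "\<forall>r\<ge>N1. norm (s r * Q r - 0) < s0 * e" using LIMSEQ_D[OF sQ0, of "s0 * e"] s0 e by auto
    have "norm (Q r - 0) < e" if "r \<ge> max N N1" for r
    proof (rule ccontr)
      assume "\<not> norm (Q r - 0) < e"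
      then have "e \<le> Q r" using Q_bounds(3)[of r] by simp
      moreover from this have "s0 \<le> s r" using s0 that by simp
      ultimately have "s0 * e \<le> s r * Q r" using s0 e steps(3)[of r] by (intro mult_mono) auto
      then show False using N1 that sQ[of r] by force
    qed
    then show "\<exists>no. \<forall>r\<ge>no. norm (Q r - 0) < e" by blast
  qed
qed

lemma dx_tendsto:
  assumes U: "uniform_bounds N c K"
  shows "(\<lambda>r. norm (dx r)) \<longlonglongrightarrow> 0"
proof -
  have "norm (dx r) \<le> sqrt (Q r / \<eta>1)" for r
    using Q_bounds(1)[of r] B_consts by (intro real_le_rsqrt) (simp add: field_simps)
  moreover have "(\<lambda>r. sqrt (Q r / \<eta>1)) \<longlonglongrightarrow> sqrt (0 / \<eta>1)"
    using B_consts by (intro tendsto_intros Q_tendsto[OF U]) auto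
  ultimately show ?thesis by (intro tendsto_sandwich[of "\<lambda>_. 0" "\<lambda>r. norm (dx r)" _ "\<lambda>r. sqrt (Q r / \<eta>1)"]) auto
qed

lemma centrality_tendsto:
  assumes U: "uniform_bounds N c K"
  shows "(\<lambda>r. trace ((X r ** V r - \<mu> *\<^sub>R mat 1) ** (X r ** V r - \<mu> *\<^sub>R mat 1))) \<longlonglongrightarrow> 0"
proof (rule tendsto_sandwich[of "\<lambda>_. 0" _ _ "\<lambda>r. K * (Q r / \<nu>)"])
  have "trace ((X r ** V r - \<mu> *\<^sub>R mat 1) ** (X r ** V r - \<mu> *\<^sub>R mat 1)) \<le> K * (Q r / \<nu>)" if "r \<ge> N" for r
  proof -
    have "trace ((X r ** V r - \<mu> *\<^sub>R mat 1) ** (X r ** V r - \<mu> *\<^sub>R mat 1)) \<le> trace (X r ** V r) * gap r"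
      by (rule centrality_gap(4)[OF iterates_pd])
    also have "\<dots> \<le> K * (Q r / \<nu>)"
      using uniform_boundsD(5)[OF U that] U gap_nonneg[of r] Q_bounds(2)[of r] params
      by (intro mult_mono) (simp_all add: uniform_bounds_def field_simps)
    finally show ?thesis .
  qed
  then show "\<forall>\<^sub>F r in sequentially. trace ((X r ** V r - \<mu> *\<^sub>R mat 1) ** (X r ** V r - \<mu> *\<^sub>R mat 1)) \<le> K * (Q r / \<nu>)"
    by (auto simp: eventually_sequentially)
  have "(\<lambda>r. K * (Q r / \<nu>)) \<longlonglongrightarrow> K * (0 / \<nu>)" using params by (intro tendsto_intros Q_tendsto[OF U]) auto
  then show "(\<lambda>r. K * (Q r / \<nu>)) \<longlonglongrightarrow> 0" by simp
  show "(\<lambda>_. 0) \<longlonglongrightarrow> (0::real)" by simp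
  show "\<forall>\<^sub>F r in sequentially. 0 \<le> trace ((X r ** V r - \<mu> *\<^sub>R mat 1) ** (X r ** V r - \<mu> *\<^sub>R mat 1))"
    using centrality_gap(3)[OF iterates_pd] by simp
qed

end

section \<open>Passage to the limit\<close>

lemma tendsto_uniform_gap:
  fixes u :: "'a::euclidean_space \<Rightarrow> 'b::real_normed_vector"
  assumes u: "continuous_on UNIV u" and M: "\<And>k. norm (a k) \<le> M" "\<And>k. norm (b k) \<le> M"
    and ab: "(\<lambda>k. dist (b k) (a k)) \<longlonglongrightarrow> 0"
  shows "(\<lambda>k. u (b k) - u (a k)) \<longlonglongrightarrow> 0"
proof (rule LIMSEQ_I)
  fix e :: real assume e: "0 < e"
  obtain \<delta> where \<delta>: "0 < \<delta>" "\<forall>x x'. norm x \<le> M \<longrightarrow> norm x' \<le> M \<longrightarrow> dist x' x < \<delta> \<longrightarrow> dist (u x') (u x) < e"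
    by (rule uniform_modulus_single[OF u e])
  obtain no where "\<forall>k\<ge>no. norm (dist (b k) (a k) - 0) < \<delta>" using LIMSEQ_D[OF ab \<delta>(1)] by blast
  then show "\<exists>no. \<forall>k\<ge>no. norm (u (b k) - u (a k) - 0) < e"
    using \<delta>(2) M by (intro exI[of _ no]) (simp add: dist_norm)
qed

text \<open>
  Uniform continuity on a compact ball times \<open>T\<close>, multiplied by the bounded mass of the
  measures.
\<close>

lemma integral_tendsto_uniform_gap:
  fixes u :: "'a::euclidean_space \<Rightarrow> 't::metric_space \<Rightarrow> 'b::{banach, second_countable_topology}"
  assumes T: "compact T" and u: "continuous_on (UNIV \<times> T) (\<lambda>(x, \<tau>). u x \<tau>)"
    and M: "\<And>k. norm (a k) \<le> M" "\<And>k. norm (b k) \<le> M" and ab: "(\<lambda>k. dist (b k) (a k)) \<longlonglongrightarrow> 0"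
    and w: "\<And>k. w k \<in> nonneg_measures T" "\<And>k. tv_norm T (w k) \<le> R" and R: "0 < R"
  shows "(\<lambda>k. signed_integral T (w k) (u (b k)) - signed_integral T (w k) (u (a k))) \<longlonglongrightarrow> 0"
proof (rule LIMSEQ_I)
  fix e :: real assume e: "0 < e"
  then have eR: "0 < e / (2 * R)" using R by simp
  obtain \<delta> where \<delta>: "0 < \<delta>" "\<forall>x x'. \<forall>\<tau>\<in>T. norm x \<le> M \<longrightarrow> norm x' \<le> M \<longrightarrow> dist x' x < \<delta> \<longrightarrow> dist (u x' \<tau>) (u x \<tau>) < e / (2 * R)"
    by (rule uniform_modulus[OF T u eR])
  have cont: "continuous_on T (u v)" for v
  proof -
    have "continuous_on T (\<lambda>\<tau>. (\<lambda>(x, \<tau>). u x \<tau>) (v, \<tau>))"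
      by (rule continuous_on_compose2[OF u]) (auto intro!: continuous_intros)
    then show ?thesis by simp
  qed
  obtain no where no: "\<forall>k\<ge>no. norm (dist (b k) (a k) - 0) < \<delta>" using LIMSEQ_D[OF ab \<delta>(1)] by blast
  have "norm (signed_integral T (w k) (u (b k)) - signed_integral T (w k) (u (a k))) < e" if k: "k \<ge> no" for k
  proof -
    have "signed_integral T (w k) (u (b k)) - signed_integral T (w k) (u (a k)) = signed_integral T (w k) (\<lambda>\<tau>. u (b k) \<tau> - u (a k) \<tau>)"
      by (rule compact_signed.signed_integral_diff[OF nonneg_measuresD[OF w(1) T] cont cont, symmetric])
    also have "norm \<dots> \<le> e / (2 * R) * tv_norm T (w k)"
    proof (rule norm_signed_integral_le[OF w(1) T])
      show "continuous_on T (\<lambda>\<tau>. u (b k) \<tau> - u (a k) \<tau>)" by (intro continuous_intros cont)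
      show "norm (u (b k) \<tau> - u (a k) \<tau>) \<le> e / (2 * R)" if "\<tau> \<in> T" for \<tau>
        using \<delta>(2) M no k that by (fastforce simp: dist_norm)
    qed
    also have "\<dots> \<le> e / (2 * R) * R" using w(2) eR by (intro mult_left_mono) auto
    also have "\<dots> < e" using R e by simp
    finally show ?thesis .
  qed
  then show "\<exists>no. \<forall>k\<ge>no. norm (signed_integral T (w k) (u (b k)) - signed_integral T (w k) (u (a k)) - 0) < e"
    by auto
qed

lemma accumulation_point_topspace:
  assumes "accumulation_point (iterate_topology T) u (xs, ys, zs, Vs)"
  shows "ys \<in> signed_measures T" "Vs \<in> sym_mats"
  using assms unfolding accumulation_point_def iterate_topology_def weak_star_topology_def
  by (auto simp: topology_generated_by_topspace)

text \<open>
  The limit conditions below involve one test function at a time, and for a single test function a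
  subsequence is found by shrinking products of balls of radius \<open>1 / (k + 1)\<close>.
\<close>

lemma accumulation_point_subsequence:
  fixes T :: "'t::metric_space set" and x :: "nat \<Rightarrow> real^'n" and z :: "nat \<Rightarrow> real^'s" and V :: "nat \<Rightarrow> real^'m^'m"
  assumes acc: "accumulation_point (iterate_topology T) (\<lambda>r. (x r, y r, z r, V r)) (xs, ys, zs, Vs)"
    and \<phi>: "continuous_on T \<phi>"
  obtains \<kappa> where "\<forall>k. N + k \<le> \<kappa> k" "(\<lambda>k. x (\<kappa> k)) \<longlonglongrightarrow> xs" "(\<lambda>k. z (\<kappa> k)) \<longlonglongrightarrow> zs" "(\<lambda>k. V (\<kappa> k)) \<longlonglongrightarrow> Vs"
    "(\<lambda>k. signed_integral T (y (\<kappa> k)) \<phi>) \<longlonglongrightarrow> (signed_integral T ys \<phi> :: real)"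
proof -
  note top = accumulation_point_topspace[OF acc]
  let ?I = "\<lambda>w. signed_integral T w \<phi>"
  have "\<exists>r\<ge>N + k. dist (x r) xs < inverse (Suc k) \<and> dist (z r) zs < inverse (Suc k) \<and> dist (V r) Vs < inverse (Suc k)
      \<and> dist (?I (y r)) (?I ys) < inverse (Suc k)" for k
  proof -
    define e where "e = inverse (real (Suc k))"
    have e: "0 < e" by (simp add: e_def)
    define W where "W = {w \<in> signed_measures T. ?I w \<in> ball (?I ys) e}"
    have "openin (weak_star_topology T) W"
      unfolding weak_star_topology_def W_def using \<phi>
      by (intro topology_generated_by_Basis) (auto intro!: exI[of _ \<phi>] exI[of _ "ball (?I ys) e"])
    then have "openin (iterate_topology T) (ball xs e \<times> W \<times> ball zs e \<times> (sym_mats \<inter> ball Vs e))"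
      unfolding iterate_topology_def by (auto simp: openin_prod_Times_iff intro: openin_open_Int)
    moreover have "(xs, ys, zs, Vs) \<in> ball xs e \<times> W \<times> ball zs e \<times> (sym_mats \<inter> ball Vs e)"
      using e top by (auto simp: W_def)
    ultimately have "\<exists>\<^sub>F r in sequentially. (x r, y r, z r, V r) \<in> ball xs e \<times> W \<times> ball zs e \<times> (sym_mats \<inter> ball Vs e)"
      using acc unfolding accumulation_point_def by blast
    then obtain r where "N + k \<le> r" "(x r, y r, z r, V r) \<in> ball xs e \<times> W \<times> ball zs e \<times> (sym_mats \<inter> ball Vs e)"
      unfolding frequently_sequentially by blast
    then show ?thesis by (intro exI[of _ r]) (auto simp: W_def dist_commute e_def)
  qed
  then obtain \<kappa> where \<kappa>: "\<forall>k. N + k \<le> \<kappa> k \<and> dist (x (\<kappa> k)) xs < inverse (Suc k) \<and> dist (z (\<kappa> k)) zs < inverse (Suc k)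
      \<and> dist (V (\<kappa> k)) Vs < inverse (Suc k) \<and> dist (?I (y (\<kappa> k))) (?I ys) < inverse (Suc k)"
    by metis
  have lim: "u \<longlonglongrightarrow> l" if "\<forall>k. dist (u k) l < inverse (Suc k)" for u :: "nat \<Rightarrow> 'z::metric_space" and l
    unfolding tendsto_dist_iff[of u]
    by (rule tendsto_sandwich[OF _ _ tendsto_const LIMSEQ_inverse_real_of_nat])
      (use that in \<open>auto intro!: always_eventually less_imp_le\<close>)
  show thesis by (rule that[of \<kappa>]) (use \<kappa> in \<open>auto intro!: lim\<close>)
qed

lemma continuous_on_matrix_mult [continuous_intros]:
  fixes A :: "'a::topological_space \<Rightarrow> real^'b^'c" and B :: "'a \<Rightarrow> real^'d^'b"
  shows "continuous_on S A \<Longrightarrow> continuous_on S B \<Longrightarrow> continuous_on S (\<lambda>p. A p ** B p)"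
  unfolding matrix_matrix_mult_def by (intro continuous_intros)

lemma continuous_on_trace [continuous_intros]:
  fixes A :: "'a::topological_space \<Rightarrow> real^'b^'b"
  shows "continuous_on S A \<Longrightarrow> continuous_on S (\<lambda>p. trace (A p))"
  unfolding trace_def by (intro continuous_intros)

lemma coercive_limit:
  fixes A :: "nat \<Rightarrow> real^'m^'m"
  assumes "A \<longlonglongrightarrow> A'" "\<And>k. coercive c (A k)"
  shows "coercive c A'"
  unfolding coercive_def
proof
  fix v :: "real^'m"
  have "continuous_on UNIV (\<lambda>A::real^'m^'m. (A, v))" by (intro continuous_intros)
  from continuous_on_compose2[OF continuous_on_matrix_quadratic this]
  have "continuous_on UNIV (\<lambda>A::real^'m^'m. v \<bullet> (A *v v))" by simp
  from continuous_on_tendsto_compose[OF this assms(1)]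
  have "(\<lambda>k. v \<bullet> (A k *v v)) \<longlonglongrightarrow> v \<bullet> (A' *v v)" by simp
  then show "c * (v \<bullet> v) \<le> v \<bullet> (A' *v v)"
    using assms(2) by (intro LIMSEQ_le_const) (auto simp: coercive_def)
qed

context bounded_run
begin

text \<open>
  The left-hand side of the stationarity condition with \<open>V\<close> eliminated by \<open>V = \<mu>
  F(x)\<^sup>-\<^sup>1\<close>, so that it involves only \<open>x\<close> and the two multipliers of the
  constraints.
\<close>

definition residual :: "real^'n \<Rightarrow> ('t set \<Rightarrow> real) \<Rightarrow> real^'s \<Rightarrow> real^'n" where
  "residual u w q = grad f u - \<mu> *\<^sub>R xi F0 F u + signed_integral T w (Dg u) + transpose G *v q"

lemma residual_gap_tendsto:
  assumes c: "0 < c" "\<And>k. coercive c (pencil F0 F (a k))" "\<And>k. coercive c (pencil F0 F (b k))"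
    and M: "\<And>k. norm (a k) \<le> M" "\<And>k. norm (b k) \<le> M" and ab: "(\<lambda>k. dist (b k) (a k)) \<longlonglongrightarrow> 0"
    and w: "\<And>k. w k \<in> nonneg_measures T" "\<And>k. tv_norm T (w k) \<le> R" and R: "0 < R"
  shows "(\<lambda>k. residual (b k) (w k) (q k) - residual (a k) (w k) (q k)) \<longlonglongrightarrow> 0"
proof -
  obtain C where "0 \<le> C" and C: "\<forall>u v. coercive c (pencil F0 F u) \<longrightarrow> coercive c (pencil F0 F v) \<longrightarrow>
      norm (xi F0 F u - xi F0 F v) \<le> C * norm (u - v)"
    and "\<forall>u. coercive c (pencil F0 F u) \<longrightarrow> norm (xi F0 F u) \<le> C"
    by (rule xi_lipschitz[OF c(1)])
  have \<xi>: "(\<lambda>k. xi F0 F (b k) - xi F0 F (a k)) \<longlonglongrightarrow> 0"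
  proof (rule Lim_null_comparison[OF always_eventually])
    show "\<forall>k. norm (xi F0 F (b k) - xi F0 F (a k)) \<le> C * dist (b k) (a k)" using C c(2,3) by (simp add: dist_norm)
    show "(\<lambda>k. C * dist (b k) (a k)) \<longlonglongrightarrow> 0" by (rule tendsto_mult_right_zero[OF ab])
  qed
  have "(\<lambda>k. (grad f (b k) - grad f (a k)) - \<mu> *\<^sub>R (xi F0 F (b k) - xi F0 F (a k))
      + (signed_integral T (w k) (Dg (b k)) - signed_integral T (w k) (Dg (a k)))) \<longlonglongrightarrow> 0 - \<mu> *\<^sub>R 0 + 0"
    by (intro tendsto_add tendsto_diff tendsto_scaleR tendsto_const \<xi> tendsto_uniform_gap[OF f_cont M ab]
        integral_tendsto_uniform_gap[OF T(1) Dg_cont M ab w R])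
  then show ?thesis by (simp add: residual_def algebra_simps)
qed

lemma multiplier_mass:
  assumes U: "uniform_bounds N c K" and r: "r \<ge> N"
  shows "tv_norm T (y (Suc r)) \<le> \<rho> N"
  using multiplier_bound(1)[of r] uniform_boundsD(1)[OF U, of "Suc r"] r by simp

lemma step_dist: "dist (x (Suc r)) (x r) \<le> norm (dx r)"
  using steps(3,5)[of r] by (simp add: x_Suc dist_norm mult_left_le_one_le)

lemma step_dist_tendsto:
  assumes U: "uniform_bounds N c K"
  shows "(\<lambda>k. dist (x (Suc (N + k))) (x (N + k))) \<longlonglongrightarrow> 0"
proof (rule Lim_null_comparison[OF always_eventually])
  show "\<forall>k. norm (dist (x (Suc (N + k))) (x (N + k))) \<le> norm (dx (N + k))" using step_dist by simp
  show "(\<lambda>k. norm (dx (N + k))) \<longlonglongrightarrow> 0"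
    using LIMSEQ_ignore_initial_segment[OF dx_tendsto[OF U], of N] by (simp add: add.commute)
qed

text \<open>
  The multipliers produced in iteration \<open>r\<close> carry the index \<open>r + 1\<close> but satisfy
  their equation at \<open>x\<^sub>r\<close>; the index shift is harmless because consecutive points
  approach each other.
\<close>

lemma residual_tendsto:
  assumes U: "uniform_bounds N c K"
  shows "(\<lambda>r. residual (x r) (y r) (z r)) \<longlonglongrightarrow> 0"
proof -
  have c: "0 < c" using U by (simp add: uniform_bounds_def)
  obtain M where M: "0 < M" "\<And>r. norm (x r) \<le> M" using x_bounded by blast
  have cX: "coercive c (X (N + k))" "coercive c (X (Suc (N + k)))" for k
    using uniform_boundsD(2)[OF U, of "N + k"] uniform_boundsD(2)[OF U, of "Suc (N + k)"] by simp_all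
  have gap: "(\<lambda>k. residual (x (Suc (N + k))) (y (Suc (N + k))) (z (Suc (N + k))) - residual (x (N + k)) (y (Suc (N + k))) (z (Suc (N + k)))) \<longlonglongrightarrow> 0"
    by (rule residual_gap_tendsto[OF c cX M(2) M(2) step_dist_tendsto[OF U] y_nonneg _ \<rho>_pos])
      (rule multiplier_mass[OF U], simp)
  have eq: "residual (x r) (y (Suc r)) (z (Suc r)) = - (B r *v dx r)" for r
    using step_eq[of r] by (simp add: residual_def algebra_simps eq_neg_iff_add_eq_0 del: transpose_matrix_vector)
  have "(\<lambda>r. residual (x r) (y (Suc r)) (z (Suc r))) \<longlonglongrightarrow> 0"
  proof (rule Lim_null_comparison[OF always_eventually])
    show "\<forall>r. norm (residual (x r) (y (Suc r)) (z (Suc r))) \<le> \<eta>2 * norm (dx r)"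
      using op_boundD[OF B_quadratic(2)] by (simp add: eq)
    show "(\<lambda>r. \<eta>2 * norm (dx r)) \<longlonglongrightarrow> 0" by (rule tendsto_mult_right_zero[OF dx_tendsto[OF U]])
  qed
  from tendsto_add[OF gap LIMSEQ_ignore_initial_segment[OF this, of N]]
  have "(\<lambda>k. residual (x (k + Suc N)) (y (k + Suc N)) (z (k + Suc N))) \<longlonglongrightarrow> 0" by (simp add: add.commute)
  then show ?thesis by (rule LIMSEQ_offset)
qed

lemma linearized_integrand_small:
  obtains C where "0 < C" "\<forall>r. \<forall>\<tau>\<in>T. \<bar>Dg (x r) \<tau> \<bullet> dx r\<bar> \<le> C * norm (dx r)"
proof -
  obtain M where M: "0 < M" "\<And>r. norm (x r) \<le> M" using x_bounded by blast
  obtain C where C: "0 < C" "\<And>v \<tau>. norm v \<le> M \<Longrightarrow> \<tau> \<in> T \<Longrightarrow> norm (Dg v \<tau>) \<le> C" using Dg_bounded[of M] by blast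
  have "\<bar>Dg (x r) \<tau> \<bullet> dx r\<bar> \<le> C * norm (dx r)" if "\<tau> \<in> T" for r \<tau>
    using Cauchy_Schwarz_ineq2[of "Dg (x r) \<tau>" "dx r"] mult_right_mono[OF C(2)[OF M(2) that], of "norm (dx r)" r] by simp
  with C(1) show thesis using that by blast
qed

text \<open>
  Complementarity holds exactly for the linearized constraint; the linear term vanishes with
  \<open>dx\<^sub>r\<close>, and the index is shifted as for the residual.
\<close>

lemma complementarity_tendsto:
  assumes U: "uniform_bounds N c K"
  shows "(\<lambda>r. signed_integral T (y r) (g (x r))) \<longlonglongrightarrow> 0"
proof -
  obtain M where M: "0 < M" "\<And>r. norm (x r) \<le> M" using x_bounded by blast
  obtain C where C: "0 < C" "\<forall>r. \<forall>\<tau>\<in>T. \<bar>Dg (x r) \<tau> \<bullet> dx r\<bar> \<le> C * norm (dx r)" by (rule linearized_integrand_small)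
  have gap: "(\<lambda>k. signed_integral T (y (Suc (N + k))) (g (x (Suc (N + k)))) - signed_integral T (y (Suc (N + k))) (g (x (N + k)))) \<longlonglongrightarrow> 0"
    by (rule integral_tendsto_uniform_gap[OF T(1) g_cont M(2) M(2) step_dist_tendsto[OF U] y_nonneg _ \<rho>_pos])
      (rule multiplier_mass[OF U], simp)
  have le: "norm (signed_integral T (y (Suc (N + k))) (g (x (N + k)))) \<le> C * \<rho> N * norm (dx (N + k))" for k
  proof -
    define r where "r = N + k"
    have cD: "continuous_on T (\<lambda>\<tau>. Dg (x r) \<tau> \<bullet> dx r)" by (intro continuous_intros Dg_continuous)
    have "signed_integral T (y (Suc r)) (g (x r)) + signed_integral T (y (Suc r)) (\<lambda>\<tau>. Dg (x r) \<tau> \<bullet> dx r) = 0"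
      using compact_signed.signed_integral_add[OF nonneg_measuresD[OF y_nonneg T(1)] g_continuous cD] step_compl by metis
    then have "norm (signed_integral T (y (Suc r)) (g (x r))) = norm (signed_integral T (y (Suc r)) (\<lambda>\<tau>. Dg (x r) \<tau> \<bullet> dx r))" by simp
    also have "\<dots> \<le> C * norm (dx r) * tv_norm T (y (Suc r))"
      using C(2) by (intro norm_signed_integral_le[OF y_nonneg T(1) cD]) simp
    also have "\<dots> \<le> C * norm (dx r) * \<rho> N" using multiplier_mass[OF U, of r] C(1) by (intro mult_left_mono) (auto simp: r_def)
    finally show ?thesis by (simp add: r_def mult_ac)
  qed
  have "(\<lambda>k. signed_integral T (y (Suc (N + k))) (g (x (N + k)))) \<longlonglongrightarrow> 0"
    by (rule Lim_null_comparison[OF always_eventually[OF allI[OF le]] tendsto_mult_right_zero])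
      (use LIMSEQ_ignore_initial_segment[OF dx_tendsto[OF U], of N] in \<open>simp add: add.commute\<close>)
  from tendsto_add[OF gap this]
  have "(\<lambda>k. signed_integral T (y (k + Suc N)) (g (x (k + Suc N)))) \<longlonglongrightarrow> 0" by (simp add: add.commute)
  then show ?thesis by (rule LIMSEQ_offset)
qed

text \<open>
  The linearized constraint is violated by at most \<open>\<gamma>\<^sub>r\<close>, and the linear term
  vanishes with \<open>dx\<^sub>r\<close>.
\<close>

lemma constraint_violation_tendsto:
  assumes U: "uniform_bounds N c K"
  obtains \<theta> where "\<theta> \<longlonglongrightarrow> 0" "\<forall>r. \<forall>\<tau>\<in>T. g (x r) \<tau> \<le> \<theta> r"
proof -
  obtain C where C: "0 < C" "\<forall>r. \<forall>\<tau>\<in>T. \<bar>Dg (x r) \<tau> \<bullet> dx r\<bar> \<le> C * norm (dx r)" by (rule linearized_integrand_small)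
  have "(\<lambda>r. \<gamma> r + C * norm (dx r)) \<longlonglongrightarrow> 0 + C * 0"
    by (intro tendsto_intros dx_tendsto[OF U] summable_LIMSEQ_zero[OF \<gamma>_summable])
  moreover have "g (x r) \<tau> \<le> \<gamma> r + C * norm (dx r)" if \<tau>: "\<tau> \<in> T" for r \<tau>
  proof -
    have glin: "continuous_on T (\<lambda>\<tau>. g (x r) \<tau> + Dg (x r) \<tau> \<bullet> dx r)" by (intro continuous_intros g_continuous Dg_continuous)
    have "g (x r) \<tau> + Dg (x r) \<tau> \<bullet> dx r \<le> \<gamma> r"
      using max_pos_part_bounds(1)[OF T glin \<tau>] step_feas[of r] by linarith
    moreover have "\<bar>Dg (x r) \<tau> \<bullet> dx r\<bar> \<le> C * norm (dx r)" using C(2) \<tau> by blast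
    ultimately show ?thesis by linarith
  qed
  ultimately show thesis by (intro that) auto
qed

lemma iterates_bounded:
  "bounded (range x) \<and> (\<exists>C. \<forall>r. tv_norm T (y r) \<le> C) \<and> bounded (range z) \<and> bounded (range V)"
proof (intro conjI)
  show "bounded (range x)" by (rule A3)
  obtain R where R: "\<And>r. \<rho> r \<le> R" using A2 unfolding bounded_iff by (auto dest: abs_le_D1)
  have "tv_norm T (y r) \<le> max (tv_norm T (y 0)) R" for r
  proof (cases r)
    case (Suc k) then show ?thesis using multiplier_bound(1)[of k] R[of "Suc k"] by simp
  qed simp
  then show "\<exists>C. \<forall>r. tv_norm T (y r) \<le> C" by blast
  obtain Cz where Cz: "\<And>r. norm (z (Suc r)) \<le> Cz" using z_bounded by blast
  have "norm (z r) \<le> max (norm (z 0)) Cz" for r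
  proof (cases r)
    case (Suc k) then show ?thesis using Cz[of k] by simp
  qed simp
  then show "bounded (range z)" unfolding bounded_iff by blast
  obtain N c K where U: "uniform_bounds N c K" by (rule uniform_bounds)
  have "bounded (V ` {N..})" unfolding bounded_iff
    using norm_le_op_bound[OF uniform_boundsD(4)[OF U]] by (auto intro!: exI)
  moreover have "bounded (V ` {..<N})" by (intro finite_imp_bounded) auto
  moreover have "{N..} \<union> {..<N} = UNIV" by auto
  then have "range V = V ` {N..} \<union> V ` {..<N}" by (simp flip: image_Un)
  ultimately show "bounded (range V)" by simp
qed

text \<open>
  All conditions are limits along subsequences. Stationarity is taken one coordinate at a time, so that each
  subsequence has to serve a single test function.
\<close>

lemma accumulation_point_kkt:
  assumes acc: "accumulation_point (iterate_topology T) (\<lambda>r. (x r, y r, z r, V r)) (xs, ys, zs, Vs)"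
  shows "kkt_point T \<mu> f g F0 F G h xs ys zs Vs"
proof -
  obtain N c K where U: "uniform_bounds N c K" by (rule uniform_bounds)
  have c: "0 < c" using U by (simp add: uniform_bounds_def)
  obtain M where M: "0 < M" "\<And>r. norm (x r) \<le> M" using x_bounded by blast
  have Vs: "Vs \<in> sym_mats" and ys: "ys \<in> signed_measures T" using accumulation_point_topspace[OF acc] by auto
  interpret ys: compact_signed T ys using T(1) ys by (simp add: compact_signed_def)
  note sub = accumulation_point_subsequence[OF acc, where N = "Suc N"]
  have at_top: "filterlim \<kappa> sequentially sequentially" if "\<forall>k. Suc N + k \<le> \<kappa> k" for \<kappa>
  proof (rule filterlim_at_top_mono[OF filterlim_ident always_eventually])
    show "\<forall>k. k \<le> \<kappa> k" using that by (meson add_leD2)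
  qed
  have mass: "tv_norm T (y (\<kappa> k)) \<le> \<rho> N" if "\<forall>k. Suc N + k \<le> \<kappa> k" for \<kappa> and k :: nat
    using multiplier_mass[OF U, of "\<kappa> k - 1"] that[rule_format, of k] by (cases "\<kappa> k") auto
  have lim: "(\<lambda>k. u (x (\<kappa> k))) \<longlonglongrightarrow> u xs"
    if "continuous_on UNIV u" "(\<lambda>k. x (\<kappa> k)) \<longlonglongrightarrow> xs" for u :: "real^'n \<Rightarrow> 'z::topological_space" and \<kappa> :: "nat \<Rightarrow> nat"
    by (rule continuous_on_tendsto_compose[OF that]) auto
  obtain \<kappa> where \<kappa>: "\<forall>k. Suc N + k \<le> \<kappa> k" and x\<kappa>: "(\<lambda>k. x (\<kappa> k)) \<longlonglongrightarrow> xs" and "(\<lambda>k. z (\<kappa> k)) \<longlonglongrightarrow> zs"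
    and V\<kappa>: "(\<lambda>k. V (\<kappa> k)) \<longlonglongrightarrow> Vs" and g\<kappa>: "(\<lambda>k. signed_integral T (y (\<kappa> k)) (g xs)) \<longlonglongrightarrow> signed_integral T ys (g xs)"
    by (rule sub[OF g_continuous])
  have tail: "N \<le> \<kappa> k" for k using \<kappa>[rule_format, of k] by simp
  have cX: "coercive c (pencil F0 F xs)"
    using uniform_boundsD(2)[OF U tail] by (rule coercive_limit[OF lim[OF pencil_continuous x\<kappa>]])
  then have Xpd: "pencil F0 F xs \<in> pd_mats" using pencil_sym c by (intro coercive_pd)
  have "coercive c Vs" using uniform_boundsD(3)[OF U tail] by (rule coercive_limit[OF V\<kappa>])
  then have Vpd: "Vs \<in> pd_mats" using Vs c by (intro coercive_pd)
  have xsM: "norm xs \<le> M" by (rule LIMSEQ_le_const2[OF tendsto_norm[OF x\<kappa>]]) (use M(2) in auto)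
  have "(\<lambda>k. G *v x (\<kappa> k)) \<longlonglongrightarrow> G *v xs"
    by (rule lim[OF linear_continuous_on[OF matrix_vector_mul_bounded_linear] x\<kappa>])
  then have Gx: "G *v xs = h" unfolding feasible_eq by (simp add: LIMSEQ_const_iff)
  obtain \<theta> where \<theta>: "\<theta> \<longlonglongrightarrow> 0" "\<forall>r. \<forall>\<tau>\<in>T. g (x r) \<tau> \<le> \<theta> r" by (rule constraint_violation_tendsto[OF U])
  have feas: "g xs \<tau> \<le> 0" if \<tau>: "\<tau> \<in> T" for \<tau>
  proof (rule LIMSEQ_le)
    have "continuous_on UNIV (\<lambda>u. (\<lambda>(u, \<tau>). g u \<tau>) (u, \<tau>))"
      by (rule continuous_on_compose2[OF g_cont]) (use \<tau> in \<open>auto intro!: continuous_intros\<close>)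
    then show "(\<lambda>k. g (x (\<kappa> k)) \<tau>) \<longlonglongrightarrow> g xs \<tau>" using lim[OF _ x\<kappa>, of "\<lambda>u. g u \<tau>"] by simp
    show "(\<lambda>k. \<theta> (\<kappa> k)) \<longlonglongrightarrow> 0" by (rule filterlim_compose[OF \<theta>(1) at_top[OF \<kappa>]])
  qed (use \<theta>(2) \<tau> in auto)
  have XV: "pencil F0 F xs ** Vs = \<mu> *\<^sub>R mat 1"
  proof (rule centrality_gap(5)[OF Xpd Vpd], rule LIMSEQ_unique)
    let ?E = "\<lambda>p::(real^'m^'m) \<times> (real^'m^'m). fst p ** snd p - \<mu> *\<^sub>R mat 1"
    have "continuous_on UNIV (\<lambda>p. trace (?E p ** ?E p))" by (intro continuous_intros)
    from continuous_on_tendsto_compose[OF this tendsto_Pair[OF lim[OF pencil_continuous x\<kappa>] V\<kappa>]]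
    show "(\<lambda>k. trace ((X (\<kappa> k) ** V (\<kappa> k) - \<mu> *\<^sub>R mat 1) ** (X (\<kappa> k) ** V (\<kappa> k) - \<mu> *\<^sub>R mat 1)))
      \<longlonglongrightarrow> trace ((pencil F0 F xs ** Vs - \<mu> *\<^sub>R mat 1) ** (pencil F0 F xs ** Vs - \<mu> *\<^sub>R mat 1))" by simp
    show "(\<lambda>k. trace ((X (\<kappa> k) ** V (\<kappa> k) - \<mu> *\<^sub>R mat 1) ** (X (\<kappa> k) ** V (\<kappa> k) - \<mu> *\<^sub>R mat 1))) \<longlonglongrightarrow> 0"
      by (rule filterlim_compose[OF centrality_tendsto[OF U] at_top[OF \<kappa>]])
  qed
  have "Vs ** pencil F0 F xs = transpose (pencil F0 F xs ** Vs)"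
    using pencil_sym Vs by (simp add: matrix_transpose_mul sym_mats_def)
  then have VX: "Vs ** pencil F0 F xs = \<mu> *\<^sub>R mat 1" by (simp add: XV transpose_scalar)
  have jordan: "jordan_prod (pencil F0 F xs) Vs = \<mu> *\<^sub>R mat 1"
    by (simp add: jordan_prod_def XV VX scaleR_2[symmetric])
  have "Vs = matrix_inv (pencil F0 F xs) ** (pencil F0 F xs ** Vs)" by (simp add: matrix_mul_assoc pd_inv Xpd)
  then have Vs_eq: "Vs = \<mu> *\<^sub>R matrix_inv (pencil F0 F xs)" by (simp add: XV matrix_scaleR_right)
  have xiV: "(\<chi> i. mat_inner (F i) Vs) = \<mu> *\<^sub>R xi F0 F xs"
    by (simp add: vec_eq_iff xi_def mat_inner_def Vs_eq matrix_scaleR_right trace_scaleR)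
  have ys_nonneg: "ys \<in> nonneg_measures T"
  proof (rule ys.nonneg_of_positive_functional)
    fix \<phi> :: "'t \<Rightarrow> real" assume \<phi>: "continuous_on T \<phi>" "\<And>\<tau>. \<tau> \<in> T \<Longrightarrow> 0 \<le> \<phi> \<tau>"
    obtain \<kappa> where "\<forall>k. Suc N + k \<le> \<kappa> k" "(\<lambda>k. x (\<kappa> k)) \<longlonglongrightarrow> xs" "(\<lambda>k. z (\<kappa> k)) \<longlonglongrightarrow> zs" "(\<lambda>k. V (\<kappa> k)) \<longlonglongrightarrow> Vs"
      and \<kappa>: "(\<lambda>k. signed_integral T (y (\<kappa> k)) \<phi>) \<longlonglongrightarrow> signed_integral T ys \<phi>"
      by (rule sub[OF \<phi>(1)])
    have "0 \<le> signed_integral T (y r) \<phi>" for r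
      unfolding signed_integral_nonneg(1)[OF y_nonneg T(1)]
      using \<phi>(2) compact_signed.space_pos_part[OF nonneg_measuresD[OF y_nonneg T(1)]] by (intro integral_nonneg_AE AE_I2) simp
    then show "0 \<le> signed_integral T ys \<phi>" using \<kappa> by (intro LIMSEQ_le_const) auto
  qed
  have compl: "signed_integral T ys (g xs) = 0"
  proof -
    have "(\<lambda>k. dist (x (\<kappa> k)) xs) \<longlonglongrightarrow> 0" using x\<kappa> by (simp flip: tendsto_dist_iff)
    from integral_tendsto_uniform_gap[where M = M, OF T(1) g_cont _ _ this y_nonneg mass[OF \<kappa>] \<rho>_pos]
    have "(\<lambda>k. signed_integral T (y (\<kappa> k)) (g (x (\<kappa> k))) - signed_integral T (y (\<kappa> k)) (g xs)) \<longlonglongrightarrow> 0"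
      using xsM M(2) by simp
    from tendsto_diff[OF filterlim_compose[OF complementarity_tendsto[OF U] at_top[OF \<kappa>]] this]
    have "(\<lambda>k. signed_integral T (y (\<kappa> k)) (g xs)) \<longlonglongrightarrow> 0" by simp
    then show ?thesis using g\<kappa> LIMSEQ_unique by blast
  qed
  have "residual xs ys zs $ i = 0" for i
  proof -
    have ci: "continuous_on T (\<lambda>\<tau>. Dg xs \<tau> $ i)" by (intro continuous_intros Dg_continuous)
    obtain \<kappa> where \<kappa>: "\<forall>k. Suc N + k \<le> \<kappa> k" and x\<kappa>: "(\<lambda>k. x (\<kappa> k)) \<longlonglongrightarrow> xs" and z\<kappa>: "(\<lambda>k. z (\<kappa> k)) \<longlonglongrightarrow> zs"
      and "(\<lambda>k. V (\<kappa> k)) \<longlonglongrightarrow> Vs" and i\<kappa>: "(\<lambda>k. signed_integral T (y (\<kappa> k)) (\<lambda>\<tau>. Dg xs \<tau> $ i)) \<longlonglongrightarrow> signed_integral T ys (\<lambda>\<tau>. Dg xs \<tau> $ i)"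
      by (rule sub[OF ci])
    have tail: "N \<le> \<kappa> k" for k using \<kappa>[rule_format, of k] by simp
    have comp: "signed_integral T w (\<lambda>\<tau>. Dg xs \<tau> $ i) = signed_integral T w (Dg xs) $ i" if "compact_signed T w" for w
      using compact_signed.signed_integral_linear[OF that Dg_continuous bounded_linear_vec_nth] by simp
    have "(\<lambda>k. dist (x (\<kappa> k)) xs) \<longlonglongrightarrow> 0" using x\<kappa> by (simp flip: tendsto_dist_iff)
    from residual_gap_tendsto[where M = M and q = "\<lambda>k. z (\<kappa> k)", OF c _ _ _ _ this y_nonneg mass[OF \<kappa>] \<rho>_pos]
    have "(\<lambda>k. residual (x (\<kappa> k)) (y (\<kappa> k)) (z (\<kappa> k)) - residual xs (y (\<kappa> k)) (z (\<kappa> k))) \<longlonglongrightarrow> 0"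
      using xsM M(2) cX uniform_boundsD(2)[OF U tail] by simp
    from tendsto_diff[OF filterlim_compose[OF residual_tendsto[OF U] at_top[OF \<kappa>]] this]
    have "(\<lambda>k. residual xs (y (\<kappa> k)) (z (\<kappa> k))) \<longlonglongrightarrow> 0" by simp
    from tendsto_vec_nth[OF this, of i]
    have 0: "(\<lambda>k. residual xs (y (\<kappa> k)) (z (\<kappa> k)) $ i) \<longlonglongrightarrow> 0" by simp
    have "(\<lambda>k. transpose G *v z (\<kappa> k)) \<longlonglongrightarrow> transpose G *v zs"
      by (rule bounded_linear.tendsto[OF matrix_vector_mul_bounded_linear z\<kappa>])
    from tendsto_vec_nth[OF this, of i]
    have "(\<lambda>k. (grad f xs - \<mu> *\<^sub>R xi F0 F xs) $ i + signed_integral T (y (\<kappa> k)) (\<lambda>\<tau>. Dg xs \<tau> $ i) + (transpose G *v z (\<kappa> k)) $ i)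
      \<longlonglongrightarrow> (grad f xs - \<mu> *\<^sub>R xi F0 F xs) $ i + signed_integral T ys (\<lambda>\<tau>. Dg xs \<tau> $ i) + (transpose G *v zs) $ i"
      by (intro tendsto_add tendsto_const i\<kappa>)
    then have "(\<lambda>k. residual xs (y (\<kappa> k)) (z (\<kappa> k)) $ i) \<longlonglongrightarrow> residual xs ys zs $ i"
      using comp[OF ys.compact_signed_axioms] comp[OF nonneg_measuresD[OF y_nonneg T(1)]]
      by (simp add: residual_def del: transpose_matrix_vector)
    then show ?thesis using 0 LIMSEQ_unique by blast
  qed
  then have "residual xs ys zs = 0" by (simp add: vec_eq_iff)
  then have "grad f xs + signed_integral T ys (Dg xs) - (\<chi> i. mat_inner (F i) Vs) + transpose G *v zs = 0"
    by (simp add: xiV residual_def algebra_simps del: transpose_matrix_vector)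
  then show ?thesis
    unfolding kkt_point_def using jordan Xpd Vpd compl feas ys_nonneg Gx by blast
qed

end

theorem theorem3p1:
  fixes T :: "'t::metric_space set"
    and \<mu> :: real
    and f :: "real^'n \<Rightarrow> real"
    and g :: "real^'n \<Rightarrow> 't \<Rightarrow> real"
    and F0 :: "real^'m^'m"
    and F :: "'n \<Rightarrow> real^'m^'m"
    and G :: "real^'n^'s"
    and h :: "real^'s"
    and \<alpha> \<beta>1 \<beta>2 \<sigma> \<delta> \<nu> \<eta>1 \<eta>2 :: real
    and x dx :: "nat \<Rightarrow> real^'n"
    and y :: "nat \<Rightarrow> 't set \<Rightarrow> real"
    and z :: "nat \<Rightarrow> real^'s"
    and V P dV :: "nat \<Rightarrow> real^'m^'m"
    and B :: "nat \<Rightarrow> real^'n^'n"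
    and \<rho> \<gamma> s :: "nat \<Rightarrow> real"
  assumes data: "problem_data T \<mu> f g F0 F G h"
    and run: "algorithm_run T \<mu> f g F0 F G h \<alpha> \<beta>1 \<beta>2 \<sigma> \<delta> \<nu> x y z V P B dx dV \<rho> \<gamma> s"
    and A1: "\<forall>r. P r = hrvw_matrix (pencil F0 F (x r)) \<or> P r = nt_matrix (pencil F0 F (x r)) (V r)"
    and A2: "bounded (range \<rho>)"
    and A3: "bounded (range x)"
    and A4: "G *v x 0 = h"
    and B_consts: "0 < \<eta>1" "\<eta>1 < \<eta>2"
    and B: "\<forall>r. \<eta>2 *\<^sub>R mat 1 - B r \<in> psd_mats \<and> B r - \<eta>1 *\<^sub>R mat 1 \<in> psd_mats"
  shows "(bounded (range x) \<and> (\<exists>C. \<forall>r. tv_norm T (y r) \<le> C) \<and> bounded (range z) \<and> bounded (range V))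
    \<and> (\<forall>xs ys zs Vs.
         accumulation_point (iterate_topology T) (\<lambda>r. (x r, y r, z r, V r)) (xs, ys, zs, Vs)
         \<longrightarrow> kkt_point T \<mu> f g F0 F G h xs ys zs Vs)"
proof -
  interpret bounded_run T \<mu> f g F0 F G h \<alpha> \<beta>1 \<beta>2 \<sigma> \<delta> \<nu> \<eta>1 \<eta>2 x dx y z V P dV B \<rho> \<gamma> s
    by unfold_locales (rule assms)+
  show ?thesis using iterates_bounded accumulation_point_kkt by blast
qed

end
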